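(* Let $\mathfrak{n}=\mathfrak{sl}_2(\mathbb{C})\oplus\mathfrak{sl}_2(\mathbb{C})$. Suppose that there exists a post-Lie algebra structure on $(\mathfrak{g},\mathfrak{n})$. Then $\mathfrak{g}$ is isomorphic to one of the following complex Lie algebras, and all these possibilities do occur (that is, for each Lie algebra $\mathfrak{h}$ in the list there is a pair $(\mathfrak{g},\mathfrak{n})$ with $\mathfrak{g}\cong\mathfrak{h}$ admitting a post-Lie algebra structure). All parameters are complex numbers; in (5)–(8) the algebra has basis $x_1,\ldots,x_6$, and brackets of basis vectors that are neither listed nor determined by skew-symmetry are zero. (1) $\mathfrak{sl}_2(\mathbb{C})\oplus\mathfrak{sl}_2(\mathbb{C})$. (2) $\mathfrak{sl}_2(\mathbb{C})\oplus\mathfrak{r}_{3,\lambda}(\mathbb{C})$, $\lambda\neq-1$. (3) $\mathfrak{r}_{3,\lambda}(\mathbb{C})\oplus\mathfrak{r}_{3,\mu}(\mathbb{C})$, $(\lambda,\mu)\neq(-1,-1)$. (4) $\mathfrak{r}_2(\mathbb{C})\oplus\mathfrak{r}_2(\mathbb{C})\oplus\mathfrak{r}_2(\mathbb{C})$. (5) $\mathfrak{r}_2(\mathbb{C})\oplus(\mathbb{C}^3\ltimes\mathbb{C})$ with brackets, for $\alpha\neq0$ and $\beta\neq0,-1$, $$[x_1,x_2]=x_1,\quad [x_3,x_6]=x_3,\quad [x_4,x_6]=\alpha x_4,\quad [x_5,x_6]=\beta x_5.$$ (6) $\mathbb{C}\oplus((\mathfrak{r}_{3,\lambda}(\mathbb{C})\oplus\mathbb{C})\ltimes\mathbb{C})$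 with brackets, for $\lambda\neq0$ and $\alpha\neq0,-1$, $$[x_2,x_4]=x_2,\quad [x_3,x_4]=\lambda x_3,\quad [x_3,x_6]=x_3,\quad [x_5,x_6]=\alpha x_5.$$ (7) $(\mathfrak{r}_{3,\lambda}(\mathbb{C})\oplus\mathbb{C}^2)\ltimes\mathbb{C}$ with brackets, for $\lambda\neq0$, $\alpha_1,\alpha_2\neq0$ and $(\lambda,\alpha_1,\alpha_2)\neq(-1,\alpha_1,-\alpha_1-1)$, $$[x_1,x_3]=x_1,\quad [x_2,x_3]=\lambda x_2,\quad [x_2,x_6]=\alpha_1x_2,\quad [x_4,x_6]=x_4,\quad [x_5,x_6]=\alpha_2x_5.$$ (8) $(\mathbb{C}^2\oplus\mathbb{C}^2)\ltimes\mathbb{C}^2$ with brackets $$[x_1,x_5]=x_1,\quad [x_2,x_5]=\alpha_2x_2,\quad [x_3,x_5]=\alpha_4x_3,\quad [x_4,x_5]=\alpha_6x_4,$$ $$[x_1,x_6]=\alpha_1x_1,\quad [x_2,x_6]=\alpha_3x_2,\quad [x_3,x_6]=\alpha_5x_3,\quad [x_4,x_6]=\alpha_7x_4,$$ with one of the following conditions: (a) $\alpha_3=1$, $\alpha_5=\alpha_1\alpha_7$, $\alpha_6=\alpha_2\alpha_4$, $\alpha_1\alpha_2\neq1$, $\alpha_4,\alpha_7\neq0,-1$; (b) $\alpha_4=\alpha_1-1$, $\alpha_5=-\alpha_1$, $\alpha_6=\alpha_2(\alpha_1-1)$, $\alpha_7=\alpha_1\alpha_3-\alpha_1^2\alpha_2-\alpha_3$,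 $\alpha_3-\alpha_1\alpha_2\neq0$, $\alpha_1\neq0,1$.
   Context: Let $\mathfrak{g}=(V,[\,,])$ and $\mathfrak{n}=(V,\{\,,\})$ be two Lie algebra structures on the same vector space $V$ over a field $K$ (here $K=\mathbb{C}$). A post-Lie algebra structure on the pair $(\mathfrak{g},\mathfrak{n})$ is a $K$-bilinear product $x\cdot y$ on $V$ satisfying, for all $x,y,z\in V$: (i) $x\cdot y-y\cdot x=[x,y]-\{x,y\}$; (ii) $[x,y]\cdot z=x\cdot(y\cdot z)-y\cdot(x\cdot z)$; (iii) $x\cdot\{y,z\}=\{x\cdot y,z\}+\{y,x\cdot z\}$. Notation: $\mathfrak{r}_2(\mathbb{C})$ is the non-abelian $2$-dimensional Lie algebra with basis $e_1,e_2$ and $[e_1,e_2]=e_2$. For $\lambda\in\mathbb{C}$, $\mathfrak{r}_{3,\lambda}(\mathbb{C})$ is the $3$-dimensional Lie algebra with basis $e_1,e_2,e_3$ and brackets $[e_1,e_2]=e_2$, $[e_1,e_3]=\lambda e_3$, $[e_2,e_3]=0$; in particular $\mathfrak{r}_{3,0}(\mathbb{C})=\mathfrak{r}_2(\mathbb{C})\oplus\mathbb{C}$. *)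

theory Defs
  imports "HOL-Analysis.Analysis"
begin

text \<open>A type \<open>'v\<close> serves as the underlying additive group; since two bracket operations on the
  same vector space are compared, the scalar multiplication is carried along explicitly.\<close>

record ('k, 'v) lie_struct =
  scal :: "'k \<Rightarrow> 'v \<Rightarrow> 'v"
  brac :: "'v \<Rightarrow> 'v \<Rightarrow> 'v"

definition bilinear_op :: "('k::field \<Rightarrow> 'v::ab_group_add \<Rightarrow> 'v) \<Rightarrow> ('v \<Rightarrow> 'v \<Rightarrow> 'v) \<Rightarrow> bool" where
  "bilinear_op s b \<longleftrightarrow>
     (\<forall>x. Vector_Spaces.linear s s (\<lambda>y. b x y)) \<and> (\<forall>y. Vector_Spaces.linear s s (\<lambda>x. b x y))"

definition lie_algebra :: "('k::field, 'v::ab_group_add) lie_struct \<Rightarrow> bool" where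
  "lie_algebra L \<longleftrightarrow>
     vector_space (scal L) \<and> bilinear_op (scal L) (brac L) \<and>
     (\<forall>x. brac L x x = 0) \<and>
     (\<forall>x y z. brac L x (brac L y z) + brac L y (brac L z x) + brac L z (brac L x y) = 0)"

definition lie_isomorphic ::
    "('k::field, 'v::ab_group_add) lie_struct \<Rightarrow> ('k, 'w::ab_group_add) lie_struct \<Rightarrow> bool"
    (infix "\<cong>\<^sub>L" 50) where
  "L \<cong>\<^sub>L M \<longleftrightarrow>
     (\<exists>f. Vector_Spaces.linear (scal L) (scal M) f \<and> bij f \<and>
          (\<forall>x y. f (brac L x y) = brac M (f x) (f y)))"

definition lie_sum ::
    "('k, 'v) lie_struct \<Rightarrow> ('k, 'w) lie_struct \<Rightarrow> ('k, 'v \<times> 'w) lie_struct" (infixr "\<oplus>\<^sub>L" 65) where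
  "L \<oplus>\<^sub>L M =
     \<lparr>scal = (\<lambda>c p. (scal L c (fst p), scal M c (snd p))),
      brac = (\<lambda>p q. (brac L (fst p) (fst q), brac M (snd p) (snd q)))\<rparr>"

definition post_lie ::
    "('k::field, 'v::ab_group_add) lie_struct \<Rightarrow> ('k, 'v) lie_struct \<Rightarrow> ('v \<Rightarrow> 'v \<Rightarrow> 'v) \<Rightarrow> bool" where
  "post_lie G N p \<longleftrightarrow>
     lie_algebra G \<and> lie_algebra N \<and> scal G = scal N \<and> bilinear_op (scal N) p \<and>
     (\<forall>x y. p x y - p y x = brac G x y - brac N x y) \<and>
     (\<forall>x y z. p (brac G x y) z = p x (p y z) - p y (p x z)) \<and>
     (\<forall>x y z. p x (brac N y z) = brac N (p x y) z + brac N y (p x z))"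

definition post_lie_occurs ::
    "('k::field, 'v::ab_group_add) lie_struct \<Rightarrow> ('k, 'w::ab_group_add) lie_struct \<Rightarrow> bool" where
  "post_lie_occurs N H \<longleftrightarrow> (\<exists>G p. G \<cong>\<^sub>L H \<and> post_lie G N p)"


text \<open>The algebra on \<open>\<complex>\<^sup>n\<close> given by a multiplication table: an entry \<open>(i, j, c, k)\<close> contributes
  \<open>c x\<^sub>k\<close> to \<open>[x\<^sub>i, x\<^sub>j]\<close> and \<open>- c x\<^sub>k\<close> to \<open>[x\<^sub>j, x\<^sub>i]\<close>; unlisted brackets vanish.
  For a numeral index type the indices are \<open>1, \<dots>, n\<close>, where the last one, \<open>n\<close>, equals
  \<open>0\<close> as an element of the index type.\<close>

definition table_lie ::
    "('n \<times> 'n \<times> complex \<times> 'n) list \<Rightarrow> (complex, complex ^ 'n) lie_struct" where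
  "table_lie T =
     \<lparr>scal = (*s),
      brac = (\<lambda>x y. \<Sum>(i, j, c, k)\<leftarrow>T. axis k (c * (x $ i * y $ j - x $ j * y $ i)))\<rparr>"

text \<open>Basis \<open>e, f, h\<close> with \<open>[e,f] = h\<close>, \<open>[h,e] = 2e\<close>, \<open>[h,f] = -2f\<close>; the lemmas below
  identify it with the traceless \<open>2 \<times> 2\<close> matrices under the commutator.\<close>

definition sl2 :: "(complex, complex ^ 3) lie_struct" where
  "sl2 = table_lie [(1, 2, 1, 3), (3, 1, 2, 1), (3, 2, -2, 2)]"

definition sl2_matrix :: "complex ^ 3 \<Rightarrow> complex ^ 2 ^ 2" where
  "sl2_matrix x = vector [vector [x $ 3, x $ 1], vector [x $ 2, - (x $ 3)]]"

lemma sl2_matrix_add: "sl2_matrix (x + y) = sl2_matrix x + sl2_matrix y"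
  by (simp add: sl2_matrix_def vec_eq_iff forall_2)

lemma sl2_matrix_scal: "sl2_matrix (scal sl2 c x) $ i $ j = c * sl2_matrix x $ i $ j"
  using exhaust_2[of i] exhaust_2[of j]
  by (auto simp: sl2_matrix_def sl2_def table_lie_def)

lemma sl2_matrix_bij: "bij_betw sl2_matrix UNIV {A. trace A = 0}"
proof (rule bij_betwI')
  fix A :: "complex ^ 2 ^ 2" assume "A \<in> {A. trace A = 0}"
  then have "A $ 2 $ 2 = - (A $ 1 $ 1)"
    by (simp add: trace_def sum_2 add_eq_0_iff)
  then have "A = sl2_matrix (vector [A $ 1 $ 2, A $ 2 $ 1, A $ 1 $ 1])"
    by (simp add: sl2_matrix_def vec_eq_iff forall_2)
  then show "\<exists>x\<in>UNIV. A = sl2_matrix x" by blast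
qed (auto simp: sl2_matrix_def vec_eq_iff forall_2 forall_3 trace_def sum_2)

lemma sl2_matrix_brac:
  "sl2_matrix (brac sl2 x y) = sl2_matrix x ** sl2_matrix y - sl2_matrix y ** sl2_matrix x"
  by (simp add: sl2_matrix_def sl2_def table_lie_def matrix_matrix_mult_def vec_eq_iff
      forall_2 sum_2 axis_def algebra_simps)

definition r2 :: "(complex, complex ^ 2) lie_struct" where
  "r2 = table_lie [(1, 2, 1, 2)]"

definition r3 :: "complex \<Rightarrow> (complex, complex ^ 3) lie_struct" where
  "r3 l = table_lie [(1, 2, 1, 2), (1, 3, l, 3)]"

definition lie5 :: "complex \<Rightarrow> complex \<Rightarrow> (complex, complex ^ 6) lie_struct" where
  "lie5 a b = table_lie [(1, 2, 1, 1), (3, 6, 1, 3), (4, 6, a, 4), (5, 6, b, 5)]"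

definition lie6 :: "complex \<Rightarrow> complex \<Rightarrow> (complex, complex ^ 6) lie_struct" where
  "lie6 l a = table_lie [(2, 4, 1, 2), (3, 4, l, 3), (3, 6, 1, 3), (5, 6, a, 5)]"

definition lie7 :: "complex \<Rightarrow> complex \<Rightarrow> complex \<Rightarrow> (complex, complex ^ 6) lie_struct" where
  "lie7 l a1 a2 =
     table_lie [(1, 3, 1, 1), (2, 3, l, 2), (2, 6, a1, 2), (4, 6, 1, 4), (5, 6, a2, 5)]"

text \<open>The parameters \<open>\<alpha>\<^sub>1, \<dots>, \<alpha>\<^sub>7\<close> are the values \<open>a 1, \<dots>, a 7\<close>; other values of \<open>a\<close> play no role.\<close>

definition lie8 :: "(nat \<Rightarrow> complex) \<Rightarrow> (complex, complex ^ 6) lie_struct" where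
  "lie8 a =
     table_lie [(1, 5, 1, 1), (2, 5, a 2, 2), (3, 5, a 4, 3), (4, 5, a 6, 4),
                (1, 6, a 1, 1), (2, 6, a 3, 2), (3, 6, a 5, 3), (4, 6, a 7, 4)]"

definition cond8a :: "(nat \<Rightarrow> complex) \<Rightarrow> bool" where
  "cond8a a \<longleftrightarrow>
     a 3 = 1 \<and> a 5 = a 1 * a 7 \<and> a 6 = a 2 * a 4 \<and> a 1 * a 2 \<noteq> 1 \<and>
     a 4 \<noteq> 0 \<and> a 4 \<noteq> -1 \<and> a 7 \<noteq> 0 \<and> a 7 \<noteq> -1"

definition cond8b :: "(nat \<Rightarrow> complex) \<Rightarrow> bool" where
  "cond8b a \<longleftrightarrow>
     a 4 = a 1 - 1 \<and> a 5 = - a 1 \<and> a 6 = a 2 * (a 1 - 1) \<and>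
     a 7 = a 1 * a 3 - (a 1)\<^sup>2 * a 2 - a 3 \<and> a 3 - a 1 * a 2 \<noteq> 0 \<and> a 1 \<noteq> 0 \<and> a 1 \<noteq> 1"

end

theory Submission
  imports Defs
begin

text \<open>Derivations of \<open>\<nn> = sl\<^sub>2 \<oplus> sl\<^sub>2\<close> are inner, so a post-Lie product is \<open>x \<cdot> y = {R x, y}\<close>, and
  both \<open>R\<close> and \<open>R + id\<close> are homomorphisms from \<open>\<gg>\<close> to \<open>\<nn>\<close>. This gives four homomorphisms
  \<open>\<rho>\<^sub>1, \<rho>\<^sub>2, \<rho>\<^sub>3, \<rho>\<^sub>4 : \<gg> \<rightarrow> sl\<^sub>2\<close> for which \<open>(\<rho>\<^sub>1 - \<rho>\<^sub>3, \<rho>\<^sub>2 - \<rho>\<^sub>4)\<close> is bijective.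

  If no \<open>\<rho>\<^sub>i\<close> is onto, each image fixes a line of \<open>\<complex>\<^sup>2\<close>, and the lines of \<open>\<rho>\<^sub>i\<close> and \<open>\<rho>\<^sub>i\<^sub>+\<^sub>2\<close> differ.
  Reading off diagonal and off-diagonal entries in the basis given by these two lines yields functionals
  with \<open>d\<theta>\<^sub>i = 0\<close> and \<open>d\<nu>\<^sub>i = \<theta>\<^sub>i \<and> \<nu>\<^sub>i\<close> such that \<open>\<nu>\<^sub>1, \<dots>, \<nu>\<^sub>4, \<theta>\<^sub>1 + \<theta>\<^sub>3, \<theta>\<^sub>2 + \<theta>\<^sub>4\<close> is a basis of the
  dual of \<open>\<gg>\<close>. Closedness of \<open>\<theta>\<^sub>1, \<theta>\<^sub>2\<close> then leaves \<open>r\<^sub>2 \<oplus> r\<^sub>2 \<oplus> r\<^sub>2\<close> and the algebras in which a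
  two-dimensional torus acts on \<open>\<complex>\<^sup>4\<close> with weights \<open>w\<^sub>i\<close> such that \<open>w\<^sub>1 + w\<^sub>3\<close> and \<open>w\<^sub>2 + w\<^sub>4\<close> are
  independent. When \<open>w\<^sub>1, w\<^sub>2\<close> and \<open>w\<^sub>3, w\<^sub>4\<close> are bases, the endomorphism taking one to the other is
  diagonalizable in case (8a) and a Jordan block in case (8b); the degenerate configurations are (3), (5)
  and (6). If some \<open>\<rho>\<^sub>i\<close> is onto, \<open>\<gg>\<close> is \<open>sl\<^sub>2 \<oplus> sl\<^sub>2\<close> or splits as \<open>sl\<^sub>2\<close> plus a solvable part, to which
  the same analysis applies in dimension three. Conversely, every admissible weight system comes from an
  explicit Rota--Baxter operator.\<close>

section \<open>Torus actions on a four-dimensional abelian ideal\<close>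

lemma exhaust_6:
  fixes x :: 6
  shows "x = 1 \<or> x = 2 \<or> x = 3 \<or> x = 4 \<or> x = 5 \<or> x = 6"
proof (induct x)
  case (of_int z)
  then have "0 \<le> z" and "z < 6" by simp_all
  then have "z = 0 \<or> z = 1 \<or> z = 2 \<or> z = 3 \<or> z = 4 \<or> z = 5" by arith
  then show ?case by auto
qed

lemma forall_6: "(\<forall>i::6. P i) \<longleftrightarrow> P 1 \<and> P 2 \<and> P 3 \<and> P 4 \<and> P 5 \<and> P 6"
  by (metis exhaust_6)

definition vec6 :: "complex \<Rightarrow> complex \<Rightarrow> complex \<Rightarrow> complex \<Rightarrow> complex \<Rightarrow> complex \<Rightarrow> complex ^ 6" where
  "vec6 a b c d e f =
     (\<chi> i. if i = 1 then a else if i = 2 then b else if i = 3 then c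
           else if i = 4 then d else if i = 5 then e else f)"

lemma vec6_nth [simp]:
  "vec6 a b c d e f $ 1 = a" "vec6 a b c d e f $ 2 = b" "vec6 a b c d e f $ 3 = c"
  "vec6 a b c d e f $ 4 = d" "vec6 a b c d e f $ 5 = e" "vec6 a b c d e f $ 6 = f"
  by (simp_all add: vec6_def)

lemma vec6_eq_iff: "(x :: complex ^ 6) = y \<longleftrightarrow>
  x $ 1 = y $ 1 \<and> x $ 2 = y $ 2 \<and> x $ 3 = y $ 3 \<and> x $ 4 = y $ 4 \<and> x $ 5 = y $ 5 \<and> x $ 6 = y $ 6"
  by (simp add: vec_eq_iff forall_6)

text \<open>\<open>(p\<^sub>i, q\<^sub>i)\<close> is, up to sign, the weight of the torus \<open>\<langle>x\<^sub>5, x\<^sub>6\<rangle>\<close> on \<open>x\<^sub>i\<close>.\<close>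

definition wlie :: "complex \<Rightarrow> complex \<Rightarrow> complex \<Rightarrow> complex \<Rightarrow> complex \<Rightarrow> complex \<Rightarrow> complex \<Rightarrow> complex
    \<Rightarrow> (complex, complex ^ 6) lie_struct" where
  "wlie p1 q1 p2 q2 p3 q3 p4 q4 =
     table_lie [(1, 5, p1, 1), (2, 5, p2, 2), (3, 5, p3, 3), (4, 5, p4, 4),
                (1, 6, q1, 1), (2, 6, q2, 2), (3, 6, q3, 3), (4, 6, q4, 4)]"

lemma lie8_eq_wlie: "lie8 a = wlie 1 (a 1) (a 2) (a 3) (a 4) (a 5) (a 6) (a 7)"
  by (simp add: lie8_def wlie_def)

lemma scal_table [simp]: "scal (table_lie T) = (*s)"
  by (simp add: table_lie_def)

lemma scal_wlie [simp]: "scal (wlie p1 q1 p2 q2 p3 q3 p4 q4) = (*s)"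
  by (simp add: wlie_def)

lemma brac_wlie:
  "brac (wlie p1 q1 p2 q2 p3 q3 p4 q4) x y =
     vec6 (p1 * (x$1 * y$5 - x$5 * y$1) + q1 * (x$1 * y$6 - x$6 * y$1))
          (p2 * (x$2 * y$5 - x$5 * y$2) + q2 * (x$2 * y$6 - x$6 * y$2))
          (p3 * (x$3 * y$5 - x$5 * y$3) + q3 * (x$3 * y$6 - x$6 * y$3))
          (p4 * (x$4 * y$5 - x$5 * y$4) + q4 * (x$4 * y$6 - x$6 * y$4)) 0 0"
  by (simp add: wlie_def table_lie_def vec6_eq_iff axis_def)

lemma brac_sl2:
  "brac sl2 x y = vector [2 * (x$3 * y$1 - x$1 * y$3), 2 * (x$2 * y$3 - x$3 * y$2), x$1 * y$2 - x$2 * y$1]"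
  by (simp add: sl2_def table_lie_def vec_eq_iff forall_3 axis_def algebra_simps)

lemma scal_sl2 [simp]: "scal sl2 = (*s)" by (simp add: sl2_def)

lemma brac_r3:
  "brac (r3 l) x y = vector [0, x$1 * y$2 - x$2 * y$1, l * (x$1 * y$3 - x$3 * y$1)]"
  by (simp add: r3_def table_lie_def vec_eq_iff forall_3 axis_def algebra_simps)

lemma scal_r3 [simp]: "scal (r3 l) = (*s)" by (simp add: r3_def)

lemma brac_r2: "brac r2 x y = vector [0, x$1 * y$2 - x$2 * y$1]"
  by (simp add: r2_def table_lie_def vec_eq_iff forall_2 axis_def algebra_simps)

lemma scal_r2 [simp]: "scal r2 = (*s)" by (simp add: r2_def)

lemma brac_sum: "brac (L \<oplus>\<^sub>L M) p q = (brac L (fst p) (fst q), brac M (snd p) (snd q))"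
  by (simp add: lie_sum_def)

lemma scal_sum: "scal (L \<oplus>\<^sub>L M) = (\<lambda>c p. (scal L c (fst p), scal M c (snd p)))"
  by (simp add: lie_sum_def)

lemma brac_lie5: "brac (lie5 a b) x y =
   vec6 (x$1 * y$2 - x$2 * y$1) 0 (x$3 * y$6 - x$6 * y$3) (a * (x$4 * y$6 - x$6 * y$4))
        (b * (x$5 * y$6 - x$6 * y$5)) 0"
  by (simp add: lie5_def table_lie_def vec6_eq_iff axis_def)

lemma brac_lie6: "brac (lie6 l a) x y =
   vec6 0 (x$2 * y$4 - x$4 * y$2) (l * (x$3 * y$4 - x$4 * y$3) + (x$3 * y$6 - x$6 * y$3)) 0
        (a * (x$5 * y$6 - x$6 * y$5)) 0"
  by (simp add: lie6_def table_lie_def vec6_eq_iff axis_def)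

lemma brac_lie7: "brac (lie7 l a1 a2) x y =
   vec6 (x$1 * y$3 - x$3 * y$1) (l * (x$2 * y$3 - x$3 * y$2) + a1 * (x$2 * y$6 - x$6 * y$2)) 0
        (x$4 * y$6 - x$6 * y$4) (a2 * (x$5 * y$6 - x$6 * y$5)) 0"
  by (simp add: lie7_def table_lie_def vec6_eq_iff axis_def)

lemma scal_lie567 [simp]: "scal (lie5 a b) = (*s)" "scal (lie6 l a) = (*s)" "scal (lie7 l a b) = (*s)"
  by (simp_all add: lie5_def lie6_def lie7_def)

lemma vector_space_vec: "vector_space ((*s) :: 'a::field \<Rightarrow> 'a ^ 'n \<Rightarrow> _)"
  by (rule vec.vector_space_axioms)

lemma vector_space_pair:
  assumes "vector_space s" "vector_space t"
  shows "vector_space (\<lambda>c p. (s c (fst p), t c (snd p)))"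
proof -
  interpret S: vector_space s by fact
  interpret T: vector_space t by fact
  show ?thesis
    by unfold_locales (simp_all add: S.scale_right_distrib T.scale_right_distrib
        S.scale_left_distrib T.scale_left_distrib prod_eq_iff)
qed

lemma linear_iff:
  "Vector_Spaces.linear s t f \<longleftrightarrow>
     vector_space s \<and> vector_space t \<and> (\<forall>x y. f (x + y) = f x + f y) \<and> (\<forall>c x. f (s c x) = t c (f x))"
  by (auto simp: Vector_Spaces.linear_def module_hom_def module_hom_axioms_def vector_space_def
      module_def)

section \<open>Isomorphisms given by coordinate functionals\<close>

lemma lie_iso_refl: "vector_space (scal L) \<Longrightarrow> L \<cong>\<^sub>L L"
  unfolding lie_isomorphic_def linear_iff by (intro exI[of _ id]) auto

lemma lie_iso_trans: "L \<cong>\<^sub>L M \<Longrightarrow> M \<cong>\<^sub>L P \<Longrightarrow> L \<cong>\<^sub>L P"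
  unfolding lie_isomorphic_def linear_iff
  by (elim exE, rule_tac x = "fa \<circ> f" in exI) (auto simp: bij_comp)

lemma lie_iso_sym: "L \<cong>\<^sub>L M \<Longrightarrow> M \<cong>\<^sub>L L"
proof -
  assume "L \<cong>\<^sub>L M"
  then obtain f where f: "vector_space (scal L)" "vector_space (scal M)" "\<And>x y. f (x + y) = f x + f y"
     "\<And>c x. f (scal L c x) = scal M c (f x)" "bij f"
    "\<And>x y. f (brac L x y) = brac M (f x) (f y)"
    unfolding lie_isomorphic_def linear_iff by auto
  have inv: "f (inv f y) = y" "inv f (f x) = x" for x y
    using f(5) by (simp_all add: bij_is_surj surj_f_inv_f bij_is_inj)
  have "inv f (x + y) = inv f x + inv f y" for x y by (metis f(3) inv)
  moreover have "inv f (scal M c x) = scal L c (inv f x)" for c x by (metis f(4) inv)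
  moreover have "inv f (brac M x y) = brac L (inv f x) (inv f y)" for x y by (metis f(6) inv)
  ultimately show ?thesis unfolding lie_isomorphic_def linear_iff
    using f bij_imp_bij_inv[OF f(5)] by (intro exI[of _ "inv f"]) auto
qed

definition lf :: "(complex ^ 'n \<Rightarrow> complex) \<Rightarrow> bool" where
  "lf f \<longleftrightarrow> (\<forall>x y. f (x + y) = f x + f y) \<and> (\<forall>c x. f (c *s x) = c * f x)"

lemma lf_nth [intro, simp]: "lf (\<lambda>x. x $ i)"
  by (simp add: lf_def)

lemma lf_add [intro]: "lf f \<Longrightarrow> lf g \<Longrightarrow> lf (\<lambda>x. f x + g x)"
  by (simp add: lf_def algebra_simps)

lemma lf_cmult [intro]: "lf f \<Longrightarrow> lf (\<lambda>x. c * f x)"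
  by (simp add: lf_def algebra_simps)

lemma lf_vec6_add:
  assumes "lf a" "lf b" "lf c" "lf d" "lf e" "lf f"
  shows "vec6 (a (x + y)) (b (x + y)) (c (x + y)) (d (x + y)) (e (x + y)) (f (x + y)) =
    vec6 (a x) (b x) (c x) (d x) (e x) (f x) + vec6 (a y) (b y) (c y) (d y) (e y) (f y)"
    "vec6 (a (r *s x)) (b (r *s x)) (c (r *s x)) (d (r *s x)) (e (r *s x)) (f (r *s x)) =
    r *s vec6 (a x) (b x) (c x) (d x) (e x) (f x)"
  using assms by (simp_all add: lf_def vec6_eq_iff)

lemma linear_vec_iff:
  "Vector_Spaces.linear (*s) (*s) (f :: 'a::field ^ 'n \<Rightarrow> 'a ^ 'm) \<longleftrightarrow>
     (\<forall>x y. f (x + y) = f x + f y) \<and> (\<forall>c x. f (c *s x) = c *s f x)"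
  by (simp add: linear_iff vector_space_vec)

lemma bij_of_trivial_kernel:
  fixes f :: "'a::field ^ 'n \<Rightarrow> 'a ^ 'n"
  assumes "\<And>x y. f (x + y) = f x + f y" "\<And>c x. f (c *s x) = c *s f x"
    and "\<And>x. f x = 0 \<Longrightarrow> x = 0"
  shows "bij f"
proof -
  have lin: "Vector_Spaces.linear (*s) (*s) f" using assms by (simp add: linear_vec_iff)
  have "inj f"
  proof (rule injI)
    fix x y assume e: "f x = f y"
    have "f x = f (x - y) + f y" using assms(1)[of "x - y" y] by simp
    then show "x = y" using assms(3)[of "x - y"] e by simp
  qed
  then show ?thesis using vec.linear_inj_imp_surj[OF lin] by (simp add: bij_def)
qed

text \<open>Isomorphisms are built on the dual side: six functionals without a common nonzero zero
  are the coordinates of a bijection by dimension count, so only the bracket identity has to be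
  checked.\<close>

lemma iso6I:
  fixes G H :: "(complex, complex ^ 6) lie_struct"
  assumes "scal G = (*s)" "scal H = (*s)"
    and "lf f1" "lf f2" "lf f3" "lf f4" "lf f5" "lf f6"
    and "\<And>x. f1 x = 0 \<Longrightarrow> f2 x = 0 \<Longrightarrow> f3 x = 0 \<Longrightarrow> f4 x = 0 \<Longrightarrow> f5 x = 0 \<Longrightarrow> f6 x = 0 \<Longrightarrow> x = 0"
    and "\<And>x y. vec6 (f1 (brac G x y)) (f2 (brac G x y)) (f3 (brac G x y)) (f4 (brac G x y))
            (f5 (brac G x y)) (f6 (brac G x y)) =
        brac H (vec6 (f1 x) (f2 x) (f3 x) (f4 x) (f5 x) (f6 x)) (vec6 (f1 y) (f2 y) (f3 y) (f4 y) (f5 y) (f6 y))"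
  shows "G \<cong>\<^sub>L H"
proof -
  define f where "f x = vec6 (f1 x) (f2 x) (f3 x) (f4 x) (f5 x) (f6 x)" for x
  have add: "f (x + y) = f x + f y" and sc: "f (c *s x) = c *s f x" for x y c
    unfolding f_def using lf_vec6_add[OF assms(3-8)] by auto
  have "bij f"
  proof (rule bij_of_trivial_kernel[OF add sc])
    fix x assume "f x = 0"
    then show "x = 0" by (intro assms(9)) (simp_all add: f_def vec6_eq_iff)
  qed
  then show ?thesis
    unfolding lie_isomorphic_def assms(1,2) linear_vec_iff
    using add sc assms(10) by (intro exI[of _ f]) (simp add: f_def)
qed

text \<open>Recognition criterion on the dual side: \<open>s\<close> and \<open>t\<close> are closed
  and are the torus coordinates, and each of the four functionals \<open>n1\<close>, ...,
  \<open>n4\<close> is scaled by one weight \<open>p * s + q * t\<close>.\<close>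

lemma wlieI:
  fixes G :: "(complex, complex ^ 6) lie_struct"
  assumes "scal G = (*s)"
    and "lf n1" "lf n2" "lf n3" "lf n4" "lf s" "lf t"
    and "\<And>x. n1 x = 0 \<Longrightarrow> n2 x = 0 \<Longrightarrow> n3 x = 0 \<Longrightarrow> n4 x = 0 \<Longrightarrow> s x = 0 \<Longrightarrow> t x = 0 \<Longrightarrow> x = 0"
    and "\<And>x y. s (brac G x y) = 0" "\<And>x y. t (brac G x y) = 0"
    and "\<And>x y. n1 (brac G x y) = n1 x * (p1 * s y + q1 * t y) - n1 y * (p1 * s x + q1 * t x)"
    and "\<And>x y. n2 (brac G x y) = n2 x * (p2 * s y + q2 * t y) - n2 y * (p2 * s x + q2 * t x)"
    and "\<And>x y. n3 (brac G x y) = n3 x * (p3 * s y + q3 * t y) - n3 y * (p3 * s x + q3 * t x)"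
    and "\<And>x y. n4 (brac G x y) = n4 x * (p4 * s y + q4 * t y) - n4 y * (p4 * s x + q4 * t x)"
  shows "G \<cong>\<^sub>L wlie p1 q1 p2 q2 p3 q3 p4 q4"
  by (rule iso6I[of G _ n1 n2 n3 n4 s t]) (use assms in \<open>simp_all add: brac_wlie vec6_eq_iff algebra_simps\<close>)

text \<open>A change of basis of the torus acts on the weights and keeps the other four coordinates.
  The eight equations expand \<open>P * s + Q * t\<close> in the old torus coordinates; the last
  assumption is invertibility of the base change.\<close>

lemma wlie_change:
  assumes "p1 = P1 * m + Q1 * m'" "q1 = P1 * k + Q1 * k'"
    and "p2 = P2 * m + Q2 * m'" "q2 = P2 * k + Q2 * k'"
    and "p3 = P3 * m + Q3 * m'" "q3 = P3 * k + Q3 * k'"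
    and "p4 = P4 * m + Q4 * m'" "q4 = P4 * k + Q4 * k'"
    and d: "m * k' \<noteq> k * m'"
  shows "wlie p1 q1 p2 q2 p3 q3 p4 q4 \<cong>\<^sub>L wlie P1 Q1 P2 Q2 P3 Q3 P4 Q4"
proof (rule wlieI[where ?n1.0 = "\<lambda>x. x$1" and ?n2.0 = "\<lambda>x. x$2" and ?n3.0 = "\<lambda>x. x$3"
      and ?n4.0 = "\<lambda>x. x$4" and s = "\<lambda>x. m * x$5 + k * x$6" and t = "\<lambda>x. m' * x$5 + k' * x$6"])
  fix x :: "complex ^ 6"
  assume *: "x$1 = 0" "x$2 = 0" "x$3 = 0" "x$4 = 0" "m * x$5 + k * x$6 = 0" "m' * x$5 + k' * x$6 = 0"
  have "(m * k' - k * m') * x$5 = 0" "(m * k' - k * m') * x$6 = 0"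
    using *(5,6) by algebra+
  then show "x = 0" using * d by (simp add: vec6_eq_iff)
qed (auto simp: brac_wlie assms(1-8) algebra_simps intro!: lf_add lf_cmult)

section \<open>Permutations of the weights, and the listed families as torus algebras\<close>

lemma wlie_swap12: "wlie p1 q1 p2 q2 p3 q3 p4 q4 \<cong>\<^sub>L wlie p2 q2 p1 q1 p3 q3 p4 q4"
  by (rule wlieI[where ?n1.0 = "\<lambda>x. x$2" and ?n2.0 = "\<lambda>x. x$1" and ?n3.0 = "\<lambda>x. x$3"
      and ?n4.0 = "\<lambda>x. x$4" and s = "\<lambda>x. x$5" and t = "\<lambda>x. x$6"])
    (auto simp: brac_wlie vec6_eq_iff algebra_simps)

lemma wlie_swap23: "wlie p1 q1 p2 q2 p3 q3 p4 q4 \<cong>\<^sub>L wlie p1 q1 p3 q3 p2 q2 p4 q4"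
  by (rule wlieI[where ?n1.0 = "\<lambda>x. x$1" and ?n2.0 = "\<lambda>x. x$3" and ?n3.0 = "\<lambda>x. x$2"
      and ?n4.0 = "\<lambda>x. x$4" and s = "\<lambda>x. x$5" and t = "\<lambda>x. x$6"])
    (auto simp: brac_wlie vec6_eq_iff algebra_simps)

lemma wlie_swap34: "wlie p1 q1 p2 q2 p3 q3 p4 q4 \<cong>\<^sub>L wlie p1 q1 p2 q2 p4 q4 p3 q3"
  by (rule wlieI[where ?n1.0 = "\<lambda>x. x$1" and ?n2.0 = "\<lambda>x. x$2" and ?n3.0 = "\<lambda>x. x$4"
      and ?n4.0 = "\<lambda>x. x$3" and s = "\<lambda>x. x$5" and t = "\<lambda>x. x$6"])
    (auto simp: brac_wlie vec6_eq_iff algebra_simps)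

lemma lie5_iso: "lie5 a b \<cong>\<^sub>L wlie 1 0 0 1 0 a 0 b"
  by (rule wlieI[where ?n1.0 = "\<lambda>x. x$1" and ?n2.0 = "\<lambda>x. x$3" and ?n3.0 = "\<lambda>x. x$4"
      and ?n4.0 = "\<lambda>x. x$5" and s = "\<lambda>x. x$2" and t = "\<lambda>x. x$6"])
    (auto simp: brac_lie5 vec6_eq_iff algebra_simps)

lemma lie6_iso: "lie6 l a \<cong>\<^sub>L wlie 1 0 l 1 0 a 0 0"
  by (rule wlieI[where ?n1.0 = "\<lambda>x. x$2" and ?n2.0 = "\<lambda>x. x$3" and ?n3.0 = "\<lambda>x. x$5"
      and ?n4.0 = "\<lambda>x. x$1" and s = "\<lambda>x. x$4" and t = "\<lambda>x. x$6"])
    (auto simp: brac_lie6 vec6_eq_iff algebra_simps)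

lemma lie7_iso: "lie7 l a1 a2 \<cong>\<^sub>L wlie 1 0 l a1 0 1 0 a2"
  by (rule wlieI[where ?n1.0 = "\<lambda>x. x$1" and ?n2.0 = "\<lambda>x. x$2" and ?n3.0 = "\<lambda>x. x$4"
      and ?n4.0 = "\<lambda>x. x$5" and s = "\<lambda>x. x$3" and t = "\<lambda>x. x$6"])
    (auto simp: brac_lie7 vec6_eq_iff algebra_simps)

lemma r3_r3_iso: "r3 l \<oplus>\<^sub>L r3 m \<cong>\<^sub>L wlie 1 0 l 0 0 1 0 m"
proof -
  let ?f = "\<lambda>p :: (complex ^ 3) \<times> (complex ^ 3).
    vec6 (fst p $ 2) (fst p $ 3) (snd p $ 2) (snd p $ 3) (- fst p $ 1) (- snd p $ 1)"
  let ?g = "\<lambda>x :: complex ^ 6. (vector [- x$5, x$1, x$2] :: complex ^ 3, vector [- x$6, x$3, x$4] :: complex ^ 3)"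
  have "bij ?f"
    by (rule o_bij[of ?g]) (auto simp: fun_eq_iff vec6_eq_iff vec_eq_iff forall_3)
  then show ?thesis
    unfolding lie_isomorphic_def scal_sum scal_r3 scal_wlie linear_iff
    by (intro exI[of _ ?f])
      (auto simp: vector_space_vec vector_space_pair vec6_eq_iff brac_sum brac_r3 brac_wlie algebra_simps)
qed

text \<open>The outcome of the classification as a predicate over an arbitrary carrier. It is
  invariant under isomorphism (\<open>listed_iso\<close>), so it may be proved for a copy of
  \<open>G\<close> on \<open>complex ^ 6\<close>.\<close>

definition listed :: "(complex, 'v::ab_group_add) lie_struct \<Rightarrow> bool" where
  "listed G \<longleftrightarrow>
        G \<cong>\<^sub>L sl2 \<oplus>\<^sub>L sl2
      \<or> (\<exists>l. l \<noteq> -1 \<and> G \<cong>\<^sub>L sl2 \<oplus>\<^sub>L r3 l)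
      \<or> (\<exists>l m. (l, m) \<noteq> (-1, -1) \<and> G \<cong>\<^sub>L r3 l \<oplus>\<^sub>L r3 m)
      \<or> G \<cong>\<^sub>L r2 \<oplus>\<^sub>L r2 \<oplus>\<^sub>L r2
      \<or> (\<exists>a b. a \<noteq> 0 \<and> b \<noteq> 0 \<and> b \<noteq> -1 \<and> G \<cong>\<^sub>L lie5 a b)
      \<or> (\<exists>l a. l \<noteq> 0 \<and> a \<noteq> 0 \<and> a \<noteq> -1 \<and> G \<cong>\<^sub>L lie6 l a)
      \<or> (\<exists>l a1 a2. l \<noteq> 0 \<and> a1 \<noteq> 0 \<and> a2 \<noteq> 0 \<and> (l, a1, a2) \<noteq> (-1, a1, - a1 - 1)
           \<and> G \<cong>\<^sub>L lie7 l a1 a2)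
      \<or> (\<exists>a. (cond8a a \<or> cond8b a) \<and> G \<cong>\<^sub>L lie8 a)"

lemma listedI:
  "G \<cong>\<^sub>L sl2 \<oplus>\<^sub>L sl2 \<Longrightarrow> listed G"
  "l \<noteq> -1 \<Longrightarrow> G \<cong>\<^sub>L sl2 \<oplus>\<^sub>L r3 l \<Longrightarrow> listed G"
  "(l, m) \<noteq> (-1, -1) \<Longrightarrow> G \<cong>\<^sub>L r3 l \<oplus>\<^sub>L r3 m \<Longrightarrow> listed G"
  "G \<cong>\<^sub>L r2 \<oplus>\<^sub>L r2 \<oplus>\<^sub>L r2 \<Longrightarrow> listed G"
  "a \<noteq> 0 \<Longrightarrow> b \<noteq> 0 \<Longrightarrow> b \<noteq> -1 \<Longrightarrow> G \<cong>\<^sub>L lie5 a b \<Longrightarrow> listed G"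
  "l \<noteq> 0 \<Longrightarrow> a \<noteq> 0 \<Longrightarrow> a \<noteq> -1 \<Longrightarrow> G \<cong>\<^sub>L lie6 l a \<Longrightarrow> listed G"
  "l \<noteq> 0 \<Longrightarrow> a1 \<noteq> 0 \<Longrightarrow> a2 \<noteq> 0 \<Longrightarrow> (l, a1, a2) \<noteq> (-1, a1, - a1 - 1) \<Longrightarrow> G \<cong>\<^sub>L lie7 l a1 a2 \<Longrightarrow> listed G"
  "cond8a al \<or> cond8b al \<Longrightarrow> G \<cong>\<^sub>L lie8 al \<Longrightarrow> listed G"
  unfolding listed_def by metis+

lemma listed_iso:
  assumes "G \<cong>\<^sub>L H" "listed H"
  shows "listed G"
proof -
  note t = lie_iso_trans[OF assms(1)]
  from assms(2)[unfolded listed_def] show ?thesis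
    apply (elim disjE exE conjE)
            apply (erule listedI(1)[OF t])
           apply (erule (1) listedI(2)[OF _ t])
          apply (erule (1) listedI(3)[OF _ t])
         apply (erule listedI(4)[OF t])
        apply (erule (3) listedI(5)[OF _ _ _ t, rotated 3])
       apply (erule (3) listedI(6)[OF _ _ _ t, rotated 3])
      apply (erule (4) listedI(7)[OF _ _ _ _ t, rotated 4])
     apply (erule listedI(8)[OF _ t, rotated], simp)+
    done
qed

lemma listed_r3_r3:
  assumes "(l, m) \<noteq> (-1, -1)"
  shows "listed (wlie 1 0 l 0 0 1 0 m)"
  using assms lie_iso_sym[OF r3_r3_iso] by (rule listedI)

lemma listed_lie5:
  assumes "a \<noteq> 0" "b \<noteq> 0" "b \<noteq> -1"
  shows "listed (wlie 1 0 0 1 0 a 0 b)"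
  using assms lie_iso_sym[OF lie5_iso] by (rule listedI)

lemma listed_lie6:
  assumes "l \<noteq> 0" "a \<noteq> 0" "a \<noteq> -1"
  shows "listed (wlie 1 0 l 1 0 a 0 0)"
  using assms lie_iso_sym[OF lie6_iso] by (rule listedI)

lemma listed_lie8:
  assumes "cond8a a \<or> cond8b a"
  shows "listed (wlie 1 (a 1) (a 2) (a 3) (a 4) (a 5) (a 6) (a 7))"
  using assms by (rule listedI) (simp add: lie8_eq_wlie lie_iso_refl vector_space_vec)

section \<open>Classification of the weight systems\<close>

definition dt :: "complex \<Rightarrow> complex \<Rightarrow> complex \<Rightarrow> complex \<Rightarrow> complex" where
  "dt p q p' q' = p * q' - q * p'"

lemma dt_eq_0_multiple:
  assumes "dt p q p' q' = 0" "(p, q) \<noteq> (0, 0)"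
  obtains k where "p' = k * p" "q' = k * q"
proof (cases "p = 0")
  case True
  then show ?thesis using assms that[of "q' / q"] by (auto simp: dt_def)
next
  case False
  then show ?thesis using assms that[of "p' / p"] by (auto simp: dt_def field_simps)
qed

lemma dt_coords:
  assumes "dt p q p' q' \<noteq> 0"
  obtains k l where "P = k * p + l * p'" "Q = k * q + l * q'"
proof
  show "P = dt P Q p' q' / dt p q p' q' * p + dt p q P Q / dt p q p' q' * p'"
    "Q = dt P Q p' q' / dt p q p' q' * q + dt p q P Q / dt p q p' q' * q'"
    using assms by (simp_all add: divide_simps) (simp_all add: dt_def algebra_simps)
qed

text \<open>Write w1, ..., w4 for the pairs (p1, q1), ..., (p4, q4), here and below. Using w2 and w1
  as torus basis, with w3 = k w1 and w4 = l w1, turns the weights into those of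
  \<open>lie5 l k\<close>; the value k = -1 is excluded because w1 + w3 is nonzero.\<close>

lemma listed_three_parallel:
  assumes "dt p1 q1 p2 q2 \<noteq> 0" "dt p1 q1 p3 q3 = 0" "dt p1 q1 p4 q4 = 0"
    and "(p3, q3) \<noteq> (0, 0)" "(p4, q4) \<noteq> (0, 0)" "(p1 + p3, q1 + q3) \<noteq> (0, 0)"
  shows "listed (wlie p1 q1 p2 q2 p3 q3 p4 q4)"
proof -
  have ne: "(p1, q1) \<noteq> (0, 0)" using assms(1) by (auto simp: dt_def)
  obtain k where k: "p3 = k * p1" "q3 = k * q1" using dt_eq_0_multiple[OF assms(2) ne] by blast
  obtain l where l: "p4 = l * p1" "q4 = l * q1" using dt_eq_0_multiple[OF assms(3) ne] by blast
  have nz: "k \<noteq> 0" "l \<noteq> 0" "k \<noteq> -1" using assms(4-6) k l by auto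
  have "wlie p1 q1 p2 q2 p3 q3 p4 q4 \<cong>\<^sub>L wlie p2 q2 p1 q1 p3 q3 p4 q4" by (rule wlie_swap12)
  moreover have "wlie p2 q2 p1 q1 p3 q3 p4 q4 \<cong>\<^sub>L wlie p2 q2 p1 q1 p4 q4 p3 q3" by (rule wlie_swap34)
  moreover have "wlie p2 q2 p1 q1 p4 q4 p3 q3 \<cong>\<^sub>L wlie 1 0 0 1 0 l 0 k"
    by (rule wlie_change[of _ _ p2 _ p1 _ q2 q1]) (use assms(1) k l in \<open>auto simp: dt_def algebra_simps\<close>)
  ultimately show ?thesis using listed_lie5[of l k] nz listed_iso by blast
qed

text \<open>With w4 = 0 the assumption says that w1 + w3 and w2 are independent. If two of the
  remaining weights are parallel, the algebra splits as \<open>r3 k\<close> plus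
  \<open>r3 0\<close>, and the parameter 0 keeps it away from (-1, -1). If they are pairwise
  independent, it is of type \<open>lie6\<close>.\<close>

lemma listed_zero_weight:
  assumes d: "dt (p1 + p3) (q1 + q3) p2 q2 \<noteq> 0"
  shows "listed (wlie p1 q1 p2 q2 p3 q3 0 0)"
proof -
  have ne2: "(p2, q2) \<noteq> (0, 0)" using d by (auto simp: dt_def)
  have s23: "wlie p1 q1 p2 q2 p3 q3 0 0 \<cong>\<^sub>L wlie p1 q1 p3 q3 p2 q2 0 0" by (rule wlie_swap23)
  have s12: "wlie p1 q1 p2 q2 p3 q3 0 0 \<cong>\<^sub>L wlie p2 q2 p1 q1 p3 q3 0 0" by (rule wlie_swap12)
  have s: "wlie p1 q1 p2 q2 p3 q3 0 0 \<cong>\<^sub>L wlie p2 q2 p3 q3 p1 q1 0 0"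
    using lie_iso_trans[OF s12 wlie_swap23] .
  consider "(p1, q1) \<noteq> (0, 0)" "dt p1 q1 p3 q3 = 0" | "(p1, q1) = (0, 0)"
    | "dt p2 q2 p1 q1 = 0" | "dt p2 q2 p3 q3 = 0"
    | "dt p2 q2 p1 q1 \<noteq> 0" "dt p2 q2 p3 q3 \<noteq> 0" "dt p1 q1 p3 q3 \<noteq> 0" by blast
  then show ?thesis
  proof cases
    case 1
    then obtain k where k: "p3 = k * p1" "q3 = k * q1" using dt_eq_0_multiple by blast
    have "p1 * q2 \<noteq> q1 * p2" using d by (auto simp: k dt_def algebra_simps)
    then have "wlie p1 q1 p3 q3 p2 q2 0 0 \<cong>\<^sub>L wlie 1 0 k 0 0 1 0 0"
      by (intro wlie_change[of _ _ p1 _ p2 _ q1 q2]) (use k in auto)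
    then show ?thesis using listed_r3_r3[of k 0] s23 listed_iso by auto
  next
    case 2
    have "p3 * q2 \<noteq> q3 * p2" using d 2 by (auto simp: dt_def)
    then have "wlie p2 q2 p1 q1 p3 q3 0 0 \<cong>\<^sub>L wlie 1 0 0 0 0 1 0 0"
      using 2 by (intro wlie_change[of _ _ p2 _ p3 _ q2 q3]) (auto simp: mult.commute)
    then show ?thesis using listed_r3_r3[of 0 0] s12 listed_iso by auto
  next
    case 3
    then obtain k where k: "p1 = k * p2" "q1 = k * q2" using dt_eq_0_multiple ne2 by blast
    have "p2 * q3 \<noteq> q2 * p3" using d by (auto simp: k dt_def algebra_simps)
    then have "wlie p2 q2 p1 q1 p3 q3 0 0 \<cong>\<^sub>L wlie 1 0 k 0 0 1 0 0"
      by (intro wlie_change[of _ _ p2 _ p3 _ q2 q3]) (use k in auto)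
    then show ?thesis using listed_r3_r3[of k 0] s12 listed_iso by auto
  next
    case 4
    then obtain k where k: "p3 = k * p2" "q3 = k * q2" using dt_eq_0_multiple ne2 by blast
    have "p2 * q1 \<noteq> q2 * p1" using d by (auto simp: k dt_def algebra_simps)
    then have "wlie p2 q2 p3 q3 p1 q1 0 0 \<cong>\<^sub>L wlie 1 0 k 0 0 1 0 0"
      by (intro wlie_change[of _ _ p2 _ p1 _ q2 q1]) (use k in auto)
    then show ?thesis using listed_r3_r3[of k 0] s listed_iso by auto
  next
    case 5
    \<comment> \<open>With w1 = l w2 + k w3, the torus basis w2, k w3 gives w2, w1, w3 the
      coordinates (1, 0), (l, 1), (0, 1/k). For k = -1 the sum w1 + w3 would be a multiple of
      w2.\<close>
    obtain l k where lk: "p1 = l * p2 + k * p3" "q1 = l * q2 + k * q3"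
      using dt_coords[OF 5(2)] by metis
    have "l \<noteq> 0" using 5(3) lk by (auto simp: dt_def)
    moreover have k0: "k \<noteq> 0" using 5(1) lk by (auto simp: dt_def)
    moreover have "1 / k \<noteq> -1"
      using d lk k0 minus_equation_iff[of k 1] by (auto simp: dt_def field_simps)
    moreover have "wlie p2 q2 p1 q1 p3 q3 0 0 \<cong>\<^sub>L wlie 1 0 l 1 0 (1 / k) 0 0"
      by (rule wlie_change[of _ _ p2 _ "k * p3" _ q2 "k * q3"])
        (use lk k0 5(2) in \<open>auto simp: dt_def\<close>)
    ultimately show ?thesis using listed_lie6[of l "1 / k"] s12 listed_iso by auto
  qed
qed

text \<open>The assumption is the characteristic equation of the matrix M with rows (a, b), (c, d).
  Rows of the adjugate of M - e are left null vectors of M - e; if the adjugate vanishes, M is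
  scalar and (1, 0) serves.\<close>

lemma row_eigenvector:
  fixes a b c d e :: complex
  assumes "(a - e) * (d - e) = b * c"
  obtains x y where "(x, y) \<noteq> (0, 0)" "x * a + y * c = e * x" "x * b + y * d = e * y"
proof (cases "c = 0 \<and> a = e")
  case True
  show ?thesis
  proof (cases "b = 0 \<and> d = e")
    case True
    with \<open>c = 0 \<and> a = e\<close> show ?thesis using that[of 1 0] by auto
  next
    case False
    with True show ?thesis using that[of "d - e" "- b"] by (auto simp: algebra_simps)
  qed
next
  case False
  then show ?thesis using assms that[of "c" "e - a"] by (auto simp: algebra_simps)
qed

text \<open>Let T be the linear map with T w1 = w3 and T w2 = w4. A left eigenvector (x, y) makes x
  w1 + y w2 an eigenvector of T, and in a torus basis of eigenvectors T becomes diag(e, e'), which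
  is the shape required by \<open>cond8a\<close>.\<close>

lemma listed_diagonalizable:
  assumes ev: "x * a + y * c = e * x" "x * b + y * d = e * y"
    "x' * a + y' * c = e' * x'" "x' * b + y' * d = e' * y'" "dt x y x' y' \<noteq> 0"
    and e: "e \<noteq> 0" "e \<noteq> -1" "e' \<noteq> 0" "e' \<noteq> -1"
  shows "listed (wlie 1 0 0 1 a b c d)"
proof -
  have main: "listed (wlie 1 0 0 1 a b c d)"
    if ev: "x * a + y * c = e * x" "x * b + y * d = e * y"
    "x' * a + y' * c = e' * x'" "x' * b + y' * d = e' * y'" "dt x y x' y' \<noteq> 0"
    and e: "e \<noteq> 0" "e \<noteq> -1" "e' \<noteq> 0" "e' \<noteq> -1" and nz: "x \<noteq> 0" "y' \<noteq> 0" for x y x' y' e e'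
  proof -
    define D where "D = dt x y x' y'"
    have D: "D = x * y' - y * x'" "D \<noteq> 0" using ev(5) by (simp_all add: D_def dt_def)
    have row: "D * a = e * x * y' - e' * y * x'" "D * b = (e - e') * y * y'"
      "D * c = (e' - e) * x * x'" "D * d = e' * x * y' - e * y * x'"
      using ev(1-4) unfolding D(1) by algebra+
    have ab: "a = (e * x * y' - e' * y * x') / D" "b = (e - e') * y * y' / D"
      "c = (e' - e) * x * x' / D" "d = (e' * x * y' - e * y * x') / D"
      using row D(2) by (simp_all add: field_simps)
    \<comment> \<open>The torus basis consists of y'/D times x w1 + y w2 and x/D times x' w1 + y'
      w2. This scaling, possible by \<open>nz\<close>, gives w1 first coordinate 1 and w2 second
      coordinate 1; their other coordinates are \<open>al 1\<close> and \<open>al 2\<close>.\<close>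
    define al :: "nat \<Rightarrow> complex" where "al = (\<lambda>_. 0)(1 := - (y / x), 2 := - (x' / y'), 3 := 1, 4 := e,
        5 := - (y / x) * e', 6 := - (x' / y') * e, 7 := e')"
    have al: "al 1 = - (y / x)" "al 2 = - (x' / y')" "al 3 = 1" "al 4 = e"
        "al 5 = - (y / x) * e'" "al 6 = - (x' / y') * e" "al 7 = e'" by (simp_all add: al_def)
    have "cond8a al"
      unfolding cond8a_def al using nz e D by (auto simp: field_simps)
    moreover have "wlie 1 0 0 1 a b c d \<cong>\<^sub>L wlie 1 (al 1) (al 2) (al 3) (al 4) (al 5) (al 6) (al 7)"
      unfolding al
    proof (rule wlie_change[of _ _ "y' / D * x" _ "x / D * x'" _ "y' / D * y" "x / D * y'"])
      have "x * y' / D - y * x' / D = 1" using D by (simp flip: diff_divide_distrib)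
      then show "1 = 1 * (y' / D * x) + - (y / x) * (x / D * x')"
        "1 = - (x' / y') * (y' / D * y) + 1 * (x / D * y')"
        using nz by (simp_all add: mult_ac)
      have "y' / D * x * (x / D * y') - y' / D * y * (x / D * x') = x * y' / D * ((x * y' - y * x') / D)"
        by (simp add: diff_divide_distrib algebra_simps)
      then show "y' / D * x * (x / D * y') \<noteq> y' / D * y * (x / D * x')"
        using nz D by auto
    qed (use nz D(2) in \<open>simp_all add: ab, simp_all add: field_simps\<close>)
    ultimately show ?thesis using listed_lie8 listed_iso by blast
  qed
  \<comment> \<open>One of the two products in the determinant is nonzero; in the second case the
    eigenvectors are exchanged.\<close>
  have "x * y' \<noteq> 0 \<or> x' * y \<noteq> 0" using ev(5) by (auto simp: dt_def)
  then show ?thesis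
  proof
    assume "x * y' \<noteq> 0"
    then show ?thesis using main[OF ev e] by simp
  next
    assume "x' * y \<noteq> 0"
    moreover have "dt x' y' x y \<noteq> 0" using ev(5) by (auto simp: dt_def algebra_simps)
    ultimately show ?thesis using main[OF ev(3,4,1,2) _ e(3,4,1,2)] by simp
  qed
qed

text \<open>Here T has the double eigenvalue e, and u = (T - e) w1 = (r, b) is a nonzero vector in
  the kernel of T - e. With A = e + 1, the torus basis f2 = - u / A^2, f1 = w1 - A f2 brings T into
  the shape of \<open>cond8b\<close>; the eigenvalues 0 and -1 correspond to the excluded values 1
  and 0 of \<open>a 1\<close>.\<close>

lemma listed_jordan:
  assumes "a = e + r" "d = e - r" "b \<noteq> 0" "b * c = - r\<^sup>2" "e \<noteq> 0" "e \<noteq> -1"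
  shows "listed (wlie 1 0 0 1 a b c d)"
proof -
  define A where "A = e + 1"
  define al :: "nat \<Rightarrow> complex" where "al = (\<lambda>_. 0)(1 := A, 2 := - (r / b), 3 := - (A * (A + r) / b),
     4 := e, 5 := - A, 6 := - (r / b) * e, 7 := A * (- (A * (A + r) / b)) + A\<^sup>2 * (r / b) + A * (A + r) / b)"
  have al: "al 1 = A" "al 2 = - (r / b)" "al 3 = - (A * (A + r) / b)" "al 4 = e"
      "al 5 = - A" "al 6 = - (r / b) * e"
      "al 7 = A * (- (A * (A + r) / b)) + A\<^sup>2 * (r / b) + A * (A + r) / b" by (simp_all add: al_def)
  have A: "A \<noteq> 0" "A \<noteq> 1" using assms(5,6) minus_equation_iff[of e 1] unfolding A_def by (auto simp: add_eq_0_iff)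
  have e: "e = A - 1" by (simp add: A_def)
  have c: "c = - r\<^sup>2 / b" using assms(3,4) by (simp add: field_simps)
  have "cond8b al"
    unfolding cond8b_def al using A e assms(3) by (auto simp: field_simps power2_eq_square)
  moreover have "wlie 1 0 0 1 a b c d \<cong>\<^sub>L wlie 1 (al 1) (al 2) (al 3) (al 4) (al 5) (al 6) (al 7)"
    unfolding al
    by (rule wlie_change[of _ _ "1 + r / A" _ "- r / A\<^sup>2" _ "b / A" "- b / A\<^sup>2"])
      (use A assms(3) in \<open>simp_all add: assms(1,2) c e, simp_all add: field_simps power2_eq_square\<close>)
  ultimately show ?thesis using listed_lie8 listed_iso by blast
qed

text \<open>The two determinants are det T and det (1 + T), so the eigenvalues of T avoid 0 and -1.
  Over the complex numbers T is then either diagonalizable or a Jordan block.\<close>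

lemma listed_invertible:
  assumes "a * d - b * c \<noteq> 0" "(1 + a) * (1 + d) - b * c \<noteq> 0"
  shows "listed (wlie 1 0 0 1 a b c d)"
proof -
  \<comment> \<open>The eigenvalues are m + s and m - s with m half the trace, so s = 0 is the case
    of a double eigenvalue.\<close>
  define s where "s = csqrt (((a - d) / 2)\<^sup>2 + b * c)"
  have s: "s\<^sup>2 = ((a - d) / 2)\<^sup>2 + b * c" by (simp add: s_def)
  define m where "m = (a + d) / 2"
  have m: "a + d = 2 * m" by (simp add: m_def)
  have d: "d = 2 * m - a" using m by (simp add: algebra_simps)
  have s': "s\<^sup>2 = (a - m)\<^sup>2 + b * c" unfolding s by (simp add: m_def power2_eq_square field_simps)
  have root: "(a - e) * (d - e) = b * c" if "e = m + s \<or> e = m - s" for e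
    using that s' unfolding d by (auto simp: power2_eq_square algebra_simps)
  have e: "e \<noteq> 0" "e \<noteq> -1" if "e = m + s \<or> e = m - s" for e
    using root[OF that] assms by (auto simp: algebra_simps)
  show ?thesis
  proof (cases "s = 0")
    case False
    obtain x y where xy: "(x, y) \<noteq> (0, 0)" "x * a + y * c = (m + s) * x" "x * b + y * d = (m + s) * y"
      using row_eigenvector[OF root[of "m + s"]] by blast
    obtain x' y' where xy': "(x', y') \<noteq> (0, 0)" "x' * a + y' * c = (m - s) * x'" "x' * b + y' * d = (m - s) * y'"
      using row_eigenvector[OF root[of "m - s"]] by blast
    have "dt x y x' y' \<noteq> 0"
    proof
      assume "dt x y x' y' = 0"
      then obtain k where k: "x' = k * x" "y' = k * y" using dt_eq_0_multiple xy(1) by metis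
      then have k0: "k \<noteq> 0" using xy'(1) by auto
      have "k * (x * a + y * c) = k * ((m - s) * x)" "k * (x * b + y * d) = k * ((m - s) * y)"
        using xy'(2,3) unfolding k by (simp_all add: algebra_simps)
      then have "(m + s) * x = (m - s) * x" "(m + s) * y = (m - s) * y" using k0 xy by simp_all
      then have "(2 * s) * x = 0" "(2 * s) * y = 0" by (simp_all add: algebra_simps)
      then show False using False xy(1) by simp
    qed
    then show ?thesis by (rule listed_diagonalizable[OF xy(2,3) xy'(2,3)]) (use e[of "m + s"] e[of "m - s"] in simp_all)
  next
    case True
    define r where "r = a - m"
    have ar: "a = m + r" "d = m - r" by (simp_all add: r_def d)
    have bc: "b * c = - r\<^sup>2" using s' True by (simp add: r_def add_eq_0_iff)
    have m0: "m \<noteq> 0" "m \<noteq> -1" using e[of m] True by auto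
    consider "b \<noteq> 0" | "c \<noteq> 0" | "b = 0" "c = 0" by blast
    then show ?thesis
    proof cases
      case 1
      then show ?thesis using listed_jordan ar bc m0 by blast
    next
      case 2
      \<comment> \<open>If only c is known to be nonzero, exchanging the indices 1 with 2 and 3 with
        4 and the two torus generators interchanges a with d and b with c.\<close>
      have "wlie 1 0 0 1 a b c d \<cong>\<^sub>L wlie 0 1 1 0 a b c d" by (rule wlie_swap12)
      moreover have "wlie 0 1 1 0 a b c d \<cong>\<^sub>L wlie 0 1 1 0 c d a b" by (rule wlie_swap34)
      moreover have "wlie 0 1 1 0 c d a b \<cong>\<^sub>L wlie 1 0 0 1 d c b a"
        by (rule wlie_change[of _ _ 0 _ 1 _ 1 0]) auto
      moreover have "listed (wlie 1 0 0 1 d c b a)"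
        using listed_jordan[of d m "- r" a c b] 2 ar bc m0 by (simp add: mult.commute)
      ultimately show ?thesis using listed_iso by blast
    next
      case 3
      then have "a = m" "d = m" using bc ar by auto
      with 3 show ?thesis
        using listed_diagonalizable[of 1 a 0 c m b d 0 1 m] m0 by (simp add: dt_def)
    qed
  qed
qed

text \<open>In the basis w1, w2 the weights w3, w4 are the rows of a matrix T, and the remaining two
  determinants equal det T and det (1 + T) times \<open>dt p1 q1 p2 q2\<close>.\<close>

lemma listed_independent:
  assumes "dt p1 q1 p2 q2 \<noteq> 0" "dt p3 q3 p4 q4 \<noteq> 0" "dt (p1 + p3) (q1 + q3) (p2 + p4) (q2 + q4) \<noteq> 0"
  shows "listed (wlie p1 q1 p2 q2 p3 q3 p4 q4)"
proof -
  obtain a b where ab: "p3 = a * p1 + b * p2" "q3 = a * q1 + b * q2" using dt_coords[OF assms(1)] by metis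
  obtain c d where cd: "p4 = c * p1 + d * p2" "q4 = c * q1 + d * q2" using dt_coords[OF assms(1)] by metis
  have "dt p3 q3 p4 q4 = (a * d - b * c) * dt p1 q1 p2 q2"
    "dt (p1 + p3) (q1 + q3) (p2 + p4) (q2 + q4) = ((1 + a) * (1 + d) - b * c) * dt p1 q1 p2 q2"
    unfolding ab cd dt_def by (simp_all add: algebra_simps)
  then have "listed (wlie 1 0 0 1 a b c d)" using assms by (intro listed_invertible) auto
  moreover have "wlie p1 q1 p2 q2 p3 q3 p4 q4 \<cong>\<^sub>L wlie 1 0 0 1 a b c d"
    by (rule wlie_change[of _ _ p1 _ p2 _ q1 q2]) (use assms(1) ab cd in \<open>auto simp: dt_def\<close>)
  ultimately show ?thesis using listed_iso by blast
qed

lemma wlie_swap24: "wlie p1 q1 p2 q2 p3 q3 p4 q4 \<cong>\<^sub>L wlie p1 q1 p4 q4 p3 q3 p2 q2"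
  by (rule lie_iso_trans[OF wlie_swap23 lie_iso_trans[OF wlie_swap34 wlie_swap23]])

lemma wlie_swap_pairs: "wlie p1 q1 p2 q2 p3 q3 p4 q4 \<cong>\<^sub>L wlie p2 q2 p1 q1 p4 q4 p3 q3"
  by (rule lie_iso_trans[OF wlie_swap12 wlie_swap34])

lemma dt_eq_0_trans:
  assumes "dt p q p' q' = 0" "dt p q p'' q'' = 0" "(p, q) \<noteq> (0, 0)"
  shows "dt p' q' p'' q'' = 0"
proof -
  obtain k where k: "p' = k * p" "q' = k * q" using dt_eq_0_multiple[OF assms(1,3)] .
  obtain l where l: "p'' = l * p" "q'' = l * q" using dt_eq_0_multiple[OF assms(2,3)] .
  show ?thesis unfolding k l dt_def by (simp add: mult_ac)
qed

lemma dt_commute: "dt p q p' q' = - dt p' q' p q"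
  by (simp add: dt_def algebra_simps)

lemma listed_wlie_three:
  assumes D: "dt (p1 + p3) (q1 + q3) (p2 + p4) (q2 + q4) \<noteq> 0"
    and nz: "(p1, q1) \<noteq> (0, 0)" "(p3, q3) \<noteq> (0, 0)" "(p4, q4) \<noteq> (0, 0)"
    and par: "dt p3 q3 p4 q4 = 0" "dt p1 q1 p4 q4 = 0"
  shows "listed (wlie p1 q1 p2 q2 p3 q3 p4 q4)"
proof (rule listed_three_parallel)
  have "dt p4 q4 p3 q3 = 0" "dt p4 q4 p1 q1 = 0" using par dt_commute by (metis neg_equal_0_iff_equal)+
  then show "dt p1 q1 p3 q3 = 0" using dt_eq_0_trans nz(3) by blast
  obtain k where k: "p3 = k * p4" "q3 = k * q4" using dt_eq_0_multiple[OF \<open>dt p4 q4 p3 q3 = 0\<close> nz(3)] by blast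
  obtain l where l: "p1 = l * p4" "q1 = l * q4" using dt_eq_0_multiple[OF \<open>dt p4 q4 p1 q1 = 0\<close> nz(3)] by blast
  have "dt (p1 + p3) (q1 + q3) (p2 + p4) (q2 + q4) = (l + k) * dt p4 q4 p2 q2"
    unfolding k l dt_def by (simp add: algebra_simps)
  moreover have "dt p1 q1 p2 q2 = l * dt p4 q4 p2 q2" unfolding l dt_def by (simp add: algebra_simps)
  ultimately show "dt p1 q1 p2 q2 \<noteq> 0" "(p1 + p3, q1 + q3) \<noteq> (0, 0)"
    using D nz(1) l by (auto simp: dt_def)
qed (use assms in auto)

text \<open>Up to sign the hypothesis is invariant under exchanging 1 with 3, 2 with 4, and the pair
  (1, 3) with (2, 4). A zero weight is moved to position 4. Otherwise one of the splittings 12|34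
  and 14|32 consists of two bases, or each contains a dependent pair; two such pairs share an index,
  so three weights are parallel.\<close>

proposition listed_wlie:
  assumes D: "dt (p1 + p3) (q1 + q3) (p2 + p4) (q2 + q4) \<noteq> 0"
  shows "listed (wlie p1 q1 p2 q2 p3 q3 p4 q4)"
proof -
  have D': "dt (p3 + p1) (q3 + q1) (p2 + p4) (q2 + q4) \<noteq> 0"
    "dt (p1 + p3) (q1 + q3) (p4 + p2) (q4 + q2) \<noteq> 0"
    "dt (p2 + p4) (q2 + q4) (p1 + p3) (q1 + q3) \<noteq> 0"
    "dt (p2 + p4) (q2 + q4) (p3 + p1) (q3 + q1) \<noteq> 0"
    using D by (simp_all add: add.commute dt_commute[of "p2 + p4"])
  consider "(p1, q1) = (0, 0)" | "(p2, q2) = (0, 0)" | "(p3, q3) = (0, 0)" | "(p4, q4) = (0, 0)"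
    | "(p1, q1) \<noteq> (0, 0)" "(p2, q2) \<noteq> (0, 0)" "(p3, q3) \<noteq> (0, 0)" "(p4, q4) \<noteq> (0, 0)" by blast
  then show ?thesis
  proof cases
    case 1
    then have "listed (wlie p2 q2 p3 q3 p4 q4 p1 q1)"
      using listed_zero_weight[of p2 p4 q2 q4 p3 q3] D'(4) by simp
    then show ?thesis
      using listed_iso[OF wlie_swap_pairs] listed_iso[OF wlie_swap24] by blast
  next
    case 2
    then have "listed (wlie p1 q1 p4 q4 p3 q3 p2 q2)"
      using listed_zero_weight[of p1 p3 q1 q3 p4 q4] D'(2) by simp
    then show ?thesis using listed_iso[OF wlie_swap24] by blast
  next
    case 3
    then have "listed (wlie p2 q2 p1 q1 p4 q4 p3 q3)"
      using listed_zero_weight[of p2 p4 q2 q4 p1 q1] D'(3) by simp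
    then show ?thesis using listed_iso[OF wlie_swap_pairs] by blast
  next
    case 4
    then show ?thesis using listed_zero_weight[of p1 p3 q1 q3 p2 q2] D by simp
  next
    case 5
    note nz = 5
    consider "dt p1 q1 p2 q2 \<noteq> 0" "dt p3 q3 p4 q4 \<noteq> 0" | "dt p1 q1 p4 q4 \<noteq> 0" "dt p3 q3 p2 q2 \<noteq> 0"
      | "dt p1 q1 p2 q2 = 0" "dt p1 q1 p4 q4 = 0" | "dt p1 q1 p2 q2 = 0" "dt p3 q3 p2 q2 = 0"
      | "dt p3 q3 p4 q4 = 0" "dt p1 q1 p4 q4 = 0" | "dt p3 q3 p4 q4 = 0" "dt p3 q3 p2 q2 = 0" by blast
    then show ?thesis
    proof cases
      case 1
      then show ?thesis using listed_independent D by blast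
    next
      case 2
      then have "listed (wlie p1 q1 p4 q4 p3 q3 p2 q2)" using listed_independent D'(2) by blast
      then show ?thesis using listed_iso[OF wlie_swap24] by blast
    next
      case 3
      then have "listed (wlie p2 q2 p3 q3 p4 q4 p1 q1)"
        using nz D'(4) by (intro listed_wlie_three) (simp_all add: dt_commute[of _ _ p1 q1])
      then show ?thesis using listed_iso[OF wlie_swap_pairs] listed_iso[OF wlie_swap24] by blast
    next
      case 4
      then have "listed (wlie p1 q1 p4 q4 p3 q3 p2 q2)"
        using nz D'(2) by (intro listed_wlie_three) simp_all
      then show ?thesis using listed_iso[OF wlie_swap24] by blast
    next
      case 5
      then show ?thesis using listed_wlie_three D nz by blast
    next
      case 6
      then have "listed (wlie p2 q2 p1 q1 p4 q4 p3 q3)"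
        using nz D'(3) by (intro listed_wlie_three) (simp_all add: dt_commute[of _ _ p3 q3])
      then show ?thesis using listed_iso[OF wlie_swap_pairs] by blast
    qed
  qed
qed

section \<open>Solvable subalgebras\<close>

text \<open>Trivial common kernel means that the functionals form a basis of the dual space.
  \<open>E\<close> inverts the coordinate map, so it supplies the dual basis vectors on which
  coefficients are later tested.\<close>

lemma dual_coordinates:
  fixes f1 f2 f3 f4 f5 f6 :: "complex ^ 6 \<Rightarrow> complex"
  assumes lf: "lf f1" "lf f2" "lf f3" "lf f4" "lf f5" "lf f6"
    and ker: "\<And>x. f1 x = 0 \<Longrightarrow> f2 x = 0 \<Longrightarrow> f3 x = 0 \<Longrightarrow> f4 x = 0 \<Longrightarrow> f5 x = 0 \<Longrightarrow> f6 x = 0 \<Longrightarrow> x = 0"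
  obtains E :: "complex ^ 6 \<Rightarrow> complex ^ 6"
  where "\<forall>u. f1 (E u) = u$1" "\<forall>u. f2 (E u) = u$2" "\<forall>u. f3 (E u) = u$3"
    "\<forall>u. f4 (E u) = u$4" "\<forall>u. f5 (E u) = u$5" "\<forall>u. f6 (E u) = u$6"
    and "\<forall>g. lf g \<longrightarrow> (\<exists>a1 a2 a3 a4 a5 a6.
       \<forall>x. g x = a1 * f1 x + a2 * f2 x + a3 * f3 x + a4 * f4 x + a5 * f5 x + a6 * f6 x)"
proof -
  define f where "f x = vec6 (f1 x) (f2 x) (f3 x) (f4 x) (f5 x) (f6 x)" for x
  have add: "f (x + y) = f x + f y" and sc: "f (c *s x) = c *s f x" for x y c
    unfolding f_def using lf_vec6_add[OF lf] by auto
  have bij: "bij f"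
  proof (rule bij_of_trivial_kernel[OF add sc])
    fix x assume "f x = 0"
    then show "x = 0" by (intro ker) (simp_all add: f_def vec6_eq_iff)
  qed
  then have fi: "f (inv f u) = u" for u by (simp add: bij_is_surj surj_f_inv_f)
  show ?thesis
  proof (rule that; intro allI impI)
    show "f1 (inv f u) = u$1" "f2 (inv f u) = u$2" "f3 (inv f u) = u$3"
      "f4 (inv f u) = u$4" "f5 (inv f u) = u$5" "f6 (inv f u) = u$6" for u
      using fi[of u] by (simp_all add: f_def vec6_eq_iff)
    fix g :: "complex ^ 6 \<Rightarrow> complex" assume g: "lf g"
    define e1 where "e1 = inv f (vec6 1 0 0 0 0 0)"
    define e2 where "e2 = inv f (vec6 0 1 0 0 0 0)"
    define e3 where "e3 = inv f (vec6 0 0 1 0 0 0)"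
    define e4 where "e4 = inv f (vec6 0 0 0 1 0 0)"
    define e5 where "e5 = inv f (vec6 0 0 0 0 1 0)"
    define e6 where "e6 = inv f (vec6 0 0 0 0 0 1)"
    have "g x = g e1 * f1 x + g e2 * f2 x + g e3 * f3 x + g e4 * f4 x + g e5 * f5 x + g e6 * f6 x" for x
    proof -
      have "f x = f (f1 x *s e1 + f2 x *s e2 + f3 x *s e3 + f4 x *s e4 + f5 x *s e5 + f6 x *s e6)"
        unfolding add sc by (simp add: e1_def e2_def e3_def e4_def e5_def e6_def fi) (simp add: f_def vec6_eq_iff)
      then have "x = f1 x *s e1 + f2 x *s e2 + f3 x *s e3 + f4 x *s e4 + f5 x *s e5 + f6 x *s e6"
        using bij by (simp add: bij_is_inj inj_eq)
      then have "g x = g (f1 x *s e1 + f2 x *s e2 + f3 x *s e3 + f4 x *s e4 + f5 x *s e5 + f6 x *s e6)"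
        by simp
      also have "\<dots> = g e1 * f1 x + g e2 * f2 x + g e3 * f3 x + g e4 * f4 x + g e5 * f5 x + g e6 * f6 x"
        using g unfolding lf_def by (simp add: mult.commute)
      finally show ?thesis .
    qed
    then show "\<exists>a1 a2 a3 a4 a5 a6. \<forall>x. g x = a1 * f1 x + a2 * f2 x + a3 * f3 x + a4 * f4 x + a5 * f5 x + a6 * f6 x"
      by blast
  qed
qed

text \<open>\<open>\<theta>\<close> is a closed functional and \<open>d\<nu> = \<theta> \<and> \<nu>\<close> in the Chevalley--Eilenberg complex.\<close>

definition triangular :: "(complex, complex ^ 6) lie_struct \<Rightarrow> (complex ^ 6 \<Rightarrow> complex) \<Rightarrow> (complex ^ 6 \<Rightarrow> complex) \<Rightarrow> bool" where
  "triangular G \<theta> \<nu> \<longleftrightarrow> lf \<theta> \<and> lf \<nu> \<and> (\<forall>x y. \<theta> (brac G x y) = 0) \<and>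
     (\<forall>x y. \<nu> (brac G x y) = \<theta> x * \<nu> y - \<theta> y * \<nu> x)"

text \<open>Each triangular pair is the dual basis of one summand \<open>r2\<close>.\<close>

lemma r2_r2_r2_iso:
  assumes sc: "scal G = (*s)"
    and tr: "triangular G t1 n1" "triangular G t2 n2" "triangular G t3 n3"
    and ker: "\<And>x. t1 x = 0 \<Longrightarrow> n1 x = 0 \<Longrightarrow> t2 x = 0 \<Longrightarrow> n2 x = 0 \<Longrightarrow> t3 x = 0 \<Longrightarrow> n3 x = 0 \<Longrightarrow> x = 0"
  shows "G \<cong>\<^sub>L r2 \<oplus>\<^sub>L r2 \<oplus>\<^sub>L r2"
proof -
  have lf: "lf t1" "lf n1" "lf t2" "lf n2" "lf t3" "lf n3" using tr by (simp_all add: triangular_def)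
  define f where "f x = vec6 (t1 x) (n1 x) (t2 x) (n2 x) (t3 x) (n3 x)" for x
  define h :: "complex ^ 6 \<Rightarrow> (complex ^ 2) \<times> (complex ^ 2) \<times> (complex ^ 2)"
    where "h x = (vector [x$1, x$2], vector [x$3, x$4], vector [x$5, x$6])" for x
  have add: "f (x + y) = f x + f y" and s: "f (c *s x) = c *s f x" for x y c
    unfolding f_def using lf_vec6_add[OF lf] by auto
  have "bij f"
  proof (rule bij_of_trivial_kernel[OF add s])
    fix x assume "f x = 0"
    then show "x = 0" by (intro ker) (simp_all add: f_def vec6_eq_iff)
  qed
  moreover have "bij h"
    by (rule o_bij[of "\<lambda>p. vec6 (fst p$1) (fst p$2) (fst (snd p)$1) (fst (snd p)$2) (snd (snd p)$1) (snd (snd p)$2)"])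
      (auto simp: h_def fun_eq_iff vec6_eq_iff vec_eq_iff forall_2)
  ultimately have "bij (h \<circ> f)" by (simp add: bij_comp)
  moreover have "h (x + y) = h x + h y" "h (c *s x) = scal (r2 \<oplus>\<^sub>L r2 \<oplus>\<^sub>L r2) c (h x)" for x y c
    by (simp_all add: h_def vec_eq_iff forall_2 scal_sum)
  moreover have "h (f (brac G x y)) = brac (r2 \<oplus>\<^sub>L r2 \<oplus>\<^sub>L r2) (h (f x)) (h (f y))" for x y
    using tr by (simp add: h_def f_def triangular_def brac_sum brac_r2 mult.commute)
  moreover have "vector_space (scal (r2 \<oplus>\<^sub>L r2 \<oplus>\<^sub>L r2))"
    unfolding scal_sum scal_r2 by (intro vector_space_pair vector_space_vec)
  ultimately show ?thesis
    unfolding lie_isomorphic_def linear_iff sc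
    using add s by (intro exI[of _ "h \<circ> f"]) (simp add: vector_space_vec)
qed

text \<open>With w3 = (w1 + w3) - w1 and w4 likewise, all four functionals are combinations of the
  two sums. The order of the factors in \<open>triangular\<close> is opposite to that in
  \<open>wlie\<close>, hence the signs. The weights then satisfy w1 + w3 = (-1, 0) and w2 + w4 = (0,
  -1), so \<open>listed_wlie\<close> applies.\<close>

lemma listed_torus:
  assumes sc: "scal G = (*s)"
    and tr: "triangular G w1 n1" "triangular G w2 n2" "triangular G w3 n3" "triangular G w4 n4"
    and ker: "\<And>x. n1 x = 0 \<Longrightarrow> n2 x = 0 \<Longrightarrow> n3 x = 0 \<Longrightarrow> n4 x = 0 \<Longrightarrow>
      w1 x + w3 x = 0 \<Longrightarrow> w2 x + w4 x = 0 \<Longrightarrow> x = 0"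
    and w1: "\<And>x. w1 x = p1 * (w1 x + w3 x) + q1 * (w2 x + w4 x)"
    and w2: "\<And>x. w2 x = p2 * (w1 x + w3 x) + q2 * (w2 x + w4 x)"
  shows "listed G"
proof (rule listed_iso)
  show "G \<cong>\<^sub>L wlie (- p1) (- q1) (- p2) (- q2) (p1 - 1) q1 p2 (q2 - 1)"
  proof (rule wlieI[OF sc, of n1 n2 n3 n4 "\<lambda>x. w1 x + w3 x" "\<lambda>x. w2 x + w4 x"])
    have dn: "n1 (brac G x y) = w1 x * n1 y - w1 y * n1 x" "n2 (brac G x y) = w2 x * n2 y - w2 y * n2 x"
      "n3 (brac G x y) = w3 x * n3 y - w3 y * n3 x" "n4 (brac G x y) = w4 x * n4 y - w4 y * n4 x" for x y
      using tr unfolding triangular_def by blast+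
    show "n1 (brac G x y) = n1 x * (- p1 * (w1 y + w3 y) + - q1 * (w2 y + w4 y)) -
        n1 y * (- p1 * (w1 x + w3 x) + - q1 * (w2 x + w4 x))" for x y
      using w1[of x] w1[of y] unfolding dn by algebra
    show "n2 (brac G x y) = n2 x * (- p2 * (w1 y + w3 y) + - q2 * (w2 y + w4 y)) -
        n2 y * (- p2 * (w1 x + w3 x) + - q2 * (w2 x + w4 x))" for x y
      using w2[of x] w2[of y] unfolding dn by algebra
    show "n3 (brac G x y) = n3 x * ((p1 - 1) * (w1 y + w3 y) + q1 * (w2 y + w4 y)) -
        n3 y * ((p1 - 1) * (w1 x + w3 x) + q1 * (w2 x + w4 x))" for x y
      using w1[of x] w1[of y] unfolding dn by algebra
    show "n4 (brac G x y) = n4 x * (p2 * (w1 y + w3 y) + (q2 - 1) * (w2 y + w4 y)) -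
        n4 y * (p2 * (w1 x + w3 x) + (q2 - 1) * (w2 x + w4 x))" for x y
      using w2[of x] w2[of y] unfolding dn by algebra
  qed (use tr ker in \<open>auto simp: triangular_def\<close>)
  show "listed (wlie (- p1) (- q1) (- p2) (- q2) (p1 - 1) q1 p2 (q2 - 1))"
    by (rule listed_wlie) (simp add: dt_def)
qed

text \<open>The last clause makes \<open>n1\<close>, ..., \<open>n4\<close>, \<open>t1 + t3\<close>,
  \<open>t2 + t4\<close> a basis of the dual space.\<close>

definition torus_data where
  "torus_data G t1 n1 t2 n2 t3 n3 t4 n4 \<longleftrightarrow>
     scal G = (*s) \<and> triangular G t1 n1 \<and> triangular G t2 n2 \<and> triangular G t3 n3 \<and> triangular G t4 n4 \<and>
     (\<forall>x. n1 x = 0 \<and> n2 x = 0 \<and> n3 x = 0 \<and> n4 x = 0 \<and> t1 x + t3 x = 0 \<and> t2 x + t4 x = 0 \<longrightarrow> x = 0)"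

lemma torus_data_swap:
  assumes "torus_data G t1 n1 t2 n2 t3 n3 t4 n4"
  shows "torus_data G t3 n3 t2 n2 t1 n1 t4 n4" "torus_data G t1 n1 t4 n4 t3 n3 t2 n2"
    "torus_data G t2 n2 t1 n1 t4 n4 t3 n3"
proof -
  note * = assms[unfolded torus_data_def]
  have "n1 x = 0 \<Longrightarrow> n2 x = 0 \<Longrightarrow> n3 x = 0 \<Longrightarrow> n4 x = 0 \<Longrightarrow> t1 x + t3 x = 0 \<Longrightarrow> t2 x + t4 x = 0 \<Longrightarrow> x = 0" for x
    using * by blast
  then show "torus_data G t3 n3 t2 n2 t1 n1 t4 n4" "torus_data G t1 n1 t4 n4 t3 n3 t2 n2"
    "torus_data G t2 n2 t1 n1 t4 n4 t3 n3"
    using * unfolding torus_data_def by (simp_all add: add.commute)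
qed

text \<open>In the basis \<open>\<nu>\<^sub>1, \<dots>, \<nu>\<^sub>4, \<theta>\<^sub>1 + \<theta>\<^sub>3, \<theta>\<^sub>2 + \<theta>\<^sub>4\<close> of the dual space, the relations below
  express that \<open>\<theta>\<^sub>1\<close> and \<open>\<theta>\<^sub>2\<close> are closed.\<close>

lemma torus_data_coeffs:
  assumes "torus_data G t1 n1 t2 n2 t3 n3 t4 n4"
  obtains c1 c2 c3 c4 p1 q1 d1 d2 d3 d4 p2 q2 where
    "\<forall>x. t1 x = c1 * n1 x + c2 * n2 x + c3 * n3 x + c4 * n4 x + p1 * (t1 x + t3 x) + q1 * (t2 x + t4 x)"
    "\<forall>x. t2 x = d1 * n1 x + d2 * n2 x + d3 * n3 x + d4 * n4 x + p2 * (t1 x + t3 x) + q2 * (t2 x + t4 x)"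
    "(p1, q1) \<noteq> (0, 0) \<longrightarrow> c1 = 0 \<and> d1 = 0"
    "(p2, q2) \<noteq> (0, 0) \<longrightarrow> c2 = 0 \<and> d2 = 0"
    "(p1, q1) \<noteq> (1, 0) \<longrightarrow> c3 = 0 \<and> d3 = 0"
    "(p2, q2) \<noteq> (0, 1) \<longrightarrow> c4 = 0 \<and> d4 = 0"
    "c4 * c3 = c4 * d3" "d3 * c4 = d3 * d4"
proof -
  note td = assms[unfolded torus_data_def triangular_def]
  have lf: "lf n1" "lf n2" "lf n3" "lf n4" "lf (\<lambda>x. t1 x + t3 x)" "lf (\<lambda>x. t2 x + t4 x)"
    using td by (auto intro: lf_add)
  have ker: "n1 x = 0 \<Longrightarrow> n2 x = 0 \<Longrightarrow> n3 x = 0 \<Longrightarrow> n4 x = 0 \<Longrightarrow> t1 x + t3 x = 0 \<Longrightarrow> t2 x + t4 x = 0 \<Longrightarrow> x = 0" for x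
    using td by blast
  obtain E :: "complex ^ 6 \<Rightarrow> complex ^ 6" where E[rule_format]: "\<forall>u. n1 (E u) = u$1" "\<forall>u. n2 (E u) = u$2" "\<forall>u. n3 (E u) = u$3"
    "\<forall>u. n4 (E u) = u$4" "\<forall>u. t1 (E u) + t3 (E u) = u$5" "\<forall>u. t2 (E u) + t4 (E u) = u$6"
    and span[rule_format]: "\<forall>g. lf g \<longrightarrow> (\<exists>a1 a2 a3 a4 a5 a6.
       \<forall>x. g x = a1 * n1 x + a2 * n2 x + a3 * n3 x + a4 * n4 x + a5 * (t1 x + t3 x) + a6 * (t2 x + t4 x))"
    by (rule dual_coordinates[OF lf ker])
  obtain c1 c2 c3 c4 p1 q1 where
    t1: "\<And>x. t1 x = c1 * n1 x + c2 * n2 x + c3 * n3 x + c4 * n4 x + p1 * (t1 x + t3 x) + q1 * (t2 x + t4 x)"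
    using span[of t1] td by (elim conjE) metis
  obtain d1 d2 d3 d4 p2 q2 where
    t2: "\<And>x. t2 x = d1 * n1 x + d2 * n2 x + d3 * n3 x + d4 * n4 x + p2 * (t1 x + t3 x) + q2 * (t2 x + t4 x)"
    using span[of t2] td by (elim conjE) metis
  have T1: "t1 (E u) = c1 * u$1 + c2 * u$2 + c3 * u$3 + c4 * u$4 + p1 * u$5 + q1 * u$6" for u
    by (subst t1) (simp add: E)
  have T2: "t2 (E u) = d1 * u$1 + d2 * u$2 + d3 * u$3 + d4 * u$4 + p2 * u$5 + q2 * u$6" for u
    by (subst t2) (simp add: E)
  have T3: "t3 (E u) = u$5 - t1 (E u)" and T4: "t4 (E u) = u$6 - t2 (E u)" for u
    using E(5,6)[of u] by (simp_all add: algebra_simps)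
  have closed: "t1 (brac G x y) = 0" "t2 (brac G x y) = 0" "t3 (brac G x y) = 0" "t4 (brac G x y) = 0"
    and dn: "n1 (brac G x y) = t1 x * n1 y - t1 y * n1 x" "n2 (brac G x y) = t2 x * n2 y - t2 y * n2 x"
      "n3 (brac G x y) = t3 x * n3 y - t3 y * n3 x" "n4 (brac G x y) = t4 x * n4 y - t4 y * n4 x" for x y
    using td by blast+
  \<comment> \<open>The expansion of \<open>t1\<close> is applied to a bracket. All \<open>t\<close>
    are closed, so the left side and the two torus terms vanish, leaving a linear relation between
    the 2-forms of the pairs (ti, ni).\<close>
  have C: "c1 * (t1 (E u) * v$1 - t1 (E v) * u$1) + c2 * (t2 (E u) * v$2 - t2 (E v) * u$2) +
     c3 * (t3 (E u) * v$3 - t3 (E v) * u$3) + c4 * (t4 (E u) * v$4 - t4 (E v) * u$4) = 0" for u v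
    using t1[of "brac G (E u) (E v)"] unfolding closed dn E by simp
  have D: "d1 * (t1 (E u) * v$1 - t1 (E v) * u$1) + d2 * (t2 (E u) * v$2 - t2 (E v) * u$2) +
     d3 * (t3 (E u) * v$3 - t3 (E v) * u$3) + d4 * (t4 (E u) * v$4 - t4 (E v) * u$4) = 0" for u v
    using t2[of "brac G (E u) (E v)"] unfolding closed dn E by simp
  note CD = C D
  note T = T3 T4 T1 T2
  let ?a = "vec6 0 0 0 0 1 0" and ?b = "vec6 0 0 0 0 0 1"
  show thesis
  proof (rule that; (intro allI impI)?)
    \<comment> \<open>A torus vector paired with the dual vector of one \<open>n\<close> isolates
      the coefficient of that \<open>n\<close> times the torus part of its \<open>t\<close>. For
      \<open>t3\<close> and \<open>t4\<close> the torus parts are (1 - p1, - q1) and (- p2, 1 -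
      q2).\<close>
    show "c1 = 0 \<and> d1 = 0" if "(p1, q1) \<noteq> (0, 0)"
      using that CD[of ?a "vec6 1 0 0 0 0 0"] CD[of ?b "vec6 1 0 0 0 0 0"] by (auto simp: T)
    show "c2 = 0 \<and> d2 = 0" if "(p2, q2) \<noteq> (0, 0)"
      using that CD[of ?a "vec6 0 1 0 0 0 0"] CD[of ?b "vec6 0 1 0 0 0 0"] by (auto simp: T)
    show "c3 = 0 \<and> d3 = 0" if "(p1, q1) \<noteq> (1, 0)"
      using that CD[of ?a "vec6 0 0 1 0 0 0"] CD[of ?b "vec6 0 0 1 0 0 0"] by (auto simp: T)
    show "c4 = 0 \<and> d4 = 0" if "(p2, q2) \<noteq> (0, 1)"
      using that CD[of ?a "vec6 0 0 0 1 0 0"] CD[of ?b "vec6 0 0 0 1 0 0"] by (auto simp: T)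
    show "t1 x = c1 * n1 x + c2 * n2 x + c3 * n3 x + c4 * n4 x + p1 * (t1 x + t3 x) + q1 * (t2 x + t4 x)"
      "t2 x = d1 * n1 x + d2 * n2 x + d3 * n3 x + d4 * n4 x + p2 * (t1 x + t3 x) + q2 * (t2 x + t4 x)" for x
      by (rule t1, rule t2)
    \<comment> \<open>These come from the dual vectors of \<open>n3\<close> and \<open>n4\<close>,
      where only the off-diagonal values t3 = - c4 and t4 = - d3 contribute.\<close>
    show "c4 * c3 = c4 * d3" "d3 * c4 = d3 * d4"
      using CD[of "vec6 0 0 1 0 0 0" "vec6 0 0 0 1 0 0"] by (auto simp: T algebra_simps)
  qed
qed

section \<open>Configurations in which some functional \<open>t\<close> has no torus
  component\<close>

definition span4 where
  "span4 t n1 n2 n3 n4 \<longleftrightarrow>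
     (\<exists>c1 c2 c3 c4 :: complex. \<forall>x. t x = c1 * n1 x + c2 * n2 x + c3 * n3 x + c4 * n4 x)"

lemma span4_swap:
  assumes "span4 t n1 n2 n3 n4"
  shows "span4 t n3 n2 n1 n4" "span4 t n1 n4 n3 n2" "span4 t n2 n1 n4 n3"
proof -
  obtain c1 c2 c3 c4 where c: "\<And>x. t x = c1 * n1 x + c2 * n2 x + c3 * n3 x + c4 * n4 x"
    using assms unfolding span4_def by blast
  show "span4 t n3 n2 n1 n4" unfolding span4_def
    by (intro exI[of _ c3] exI[of _ c2] exI[of _ c1] exI[of _ c4]) (simp add: c)
  show "span4 t n1 n4 n3 n2" unfolding span4_def
    by (intro exI[of _ c1] exI[of _ c4] exI[of _ c3] exI[of _ c2]) (simp add: c)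
  show "span4 t n2 n1 n4 n3" unfolding span4_def
    by (intro exI[of _ c2] exI[of _ c1] exI[of _ c4] exI[of _ c3]) (simp add: c)
qed

lemma torus_data_unique:
  assumes "torus_data G t1 n1 t2 n2 t3 n3 t4 n4"
    and "\<And>x. a1 * n1 x + a2 * n2 x + a3 * n3 x + a4 * n4 x + a5 * (t1 x + t3 x) + a6 * (t2 x + t4 x) = 0"
  shows "a5 = 0 \<and> a6 = 0"
proof -
  note td = assms(1)[unfolded torus_data_def triangular_def]
  have lf: "lf n1" "lf n2" "lf n3" "lf n4" "lf (\<lambda>x. t1 x + t3 x)" "lf (\<lambda>x. t2 x + t4 x)"
    using td by (auto intro: lf_add)
  have ker: "n1 x = 0 \<Longrightarrow> n2 x = 0 \<Longrightarrow> n3 x = 0 \<Longrightarrow> n4 x = 0 \<Longrightarrow> t1 x + t3 x = 0 \<Longrightarrow> t2 x + t4 x = 0 \<Longrightarrow> x = 0" for x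
    using td by blast
  obtain E :: "complex ^ 6 \<Rightarrow> complex ^ 6" where E[rule_format]: "\<forall>u. n1 (E u) = u$1" "\<forall>u. n2 (E u) = u$2" "\<forall>u. n3 (E u) = u$3"
    "\<forall>u. n4 (E u) = u$4" "\<forall>u. t1 (E u) + t3 (E u) = u$5" "\<forall>u. t2 (E u) + t4 (E u) = u$6"
    and "\<forall>g. lf g \<longrightarrow> (\<exists>a1 a2 a3 a4 a5 a6.
       \<forall>x. g x = a1 * n1 x + a2 * n2 x + a3 * n3 x + a4 * n4 x + a5 * (t1 x + t3 x) + a6 * (t2 x + t4 x))"
    by (rule dual_coordinates[OF lf ker])
  show ?thesis using assms(2)[of "E (vec6 0 0 0 0 1 0)"] assms(2)[of "E (vec6 0 0 0 0 0 1)"] by (simp add: E)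
qed

text \<open>Closedness leaves \<open>t3\<close> and \<open>t4\<close> as combinations of
  \<open>n3\<close> and \<open>n4\<close> alone. If t3 is a multiple of n3 and t4 one of n4, then n3
  and n4 are closed and both weights may be replaced by 0. Otherwise n3 is recovered from t4 and n4,
  or n4 from t3, so three triangular pairs already form a basis.\<close>

lemma listed_two_central:
  assumes td: "torus_data G t1 n1 t2 n2 t3 n3 t4 n4"
    and s: "span4 t3 n1 n2 n3 n4" "span4 t4 n1 n2 n3 n4"
  shows "listed G"
proof -
  have sc: "scal G = (*s)" and tr: "triangular G t1 n1" "triangular G t2 n2" "triangular G t3 n3" "triangular G t4 n4"
    and ker: "\<And>x. n1 x = 0 \<Longrightarrow> n2 x = 0 \<Longrightarrow> n3 x = 0 \<Longrightarrow> n4 x = 0 \<Longrightarrow> t1 x + t3 x = 0 \<Longrightarrow> t2 x + t4 x = 0 \<Longrightarrow> x = 0"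
    using td unfolding torus_data_def by blast+
  obtain c1 c2 c3 c4 p1 q1 d1 d2 d3 d4 p2 q2 where
    t1[rule_format]: "\<forall>x. t1 x = c1 * n1 x + c2 * n2 x + c3 * n3 x + c4 * n4 x + p1 * (t1 x + t3 x) + q1 * (t2 x + t4 x)"
    and t2[rule_format]: "\<forall>x. t2 x = d1 * n1 x + d2 * n2 x + d3 * n3 x + d4 * n4 x + p2 * (t1 x + t3 x) + q2 * (t2 x + t4 x)"
    and c12[rule_format]: "(p1, q1) \<noteq> (0, 0) \<longrightarrow> c1 = 0 \<and> d1 = 0"
    "(p2, q2) \<noteq> (0, 0) \<longrightarrow> c2 = 0 \<and> d2 = 0"
    "(p1, q1) \<noteq> (1, 0) \<longrightarrow> c3 = 0 \<and> d3 = 0"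
    "(p2, q2) \<noteq> (0, 1) \<longrightarrow> c4 = 0 \<and> d4 = 0"
    and cd: "c4 * c3 = c4 * d3" "d3 * c4 = d3 * d4"
    by (rule torus_data_coeffs[OF td])
  obtain k1 k2 k3 k4 where k: "\<And>x. t3 x = k1 * n1 x + k2 * n2 x + k3 * n3 x + k4 * n4 x"
    using s(1) unfolding span4_def by blast
  obtain l1 l2 l3 l4 where l: "\<And>x. t4 x = l1 * n1 x + l2 * n2 x + l3 * n3 x + l4 * n4 x"
    using s(2) unfolding span4_def by blast
  have "(c1 + k1) * n1 x + (c2 + k2) * n2 x + (c3 + k3) * n3 x + (c4 + k4) * n4 x +
      (p1 - 1) * (t1 x + t3 x) + q1 * (t2 x + t4 x) = 0" for x
    using t1[of x] k[of x] by algebra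
  from torus_data_unique[OF td this] have pq1: "p1 = 1" "q1 = 0" by simp_all
  have "(d1 + l1) * n1 x + (d2 + l2) * n2 x + (d3 + l3) * n3 x + (d4 + l4) * n4 x +
      p2 * (t1 x + t3 x) + (q2 - 1) * (t2 x + t4 x) = 0" for x
    using t2[of x] l[of x] by algebra
  from torus_data_unique[OF td this] have pq2: "p2 = 0" "q2 = 1" by simp_all
  have z: "c1 = 0" "c2 = 0" "d1 = 0" "d2 = 0" using c12 pq1 pq2 by simp_all
  have t3: "t3 x = - (c3 * n3 x + c4 * n4 x)" and t4: "t4 x = - (d3 * n3 x + d4 * n4 x)" for x
    using t1[of x] t2[of x] unfolding pq1 pq2 z by algebra+
  consider "c4 = 0" "d3 = 0" | "d3 \<noteq> 0" "d4 = c4" | "d3 = 0" "c4 \<noteq> 0" "c3 = 0"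
    using cd by auto
  then show ?thesis
  proof cases
    case 1
    have tr': "triangular G (\<lambda>_. 0) n3" "triangular G (\<lambda>_. 0) n4"
      using tr(3,4) 1 unfolding triangular_def t3 t4 by (simp_all add: lf_def)
    show ?thesis
      by (rule listed_torus[OF sc tr(1,2) tr', of 1 0 0 1]) (use ker 1 in \<open>auto simp: t3 t4\<close>)
  next
    case 2
    then show ?thesis
      by (intro listedI(4) r2_r2_r2_iso[OF sc tr(1,2,4)]) (use ker cd in \<open>auto simp: t3 t4\<close>)
  next
    case 3
    then show ?thesis
      by (intro listedI(4) r2_r2_r2_iso[OF sc tr(1,2,3)]) (use ker in \<open>auto simp: t3 t4\<close>)
  qed
qed

text \<open>If \<open>t1\<close> or \<open>t3\<close> also has no torus component, the two-fold case
  applies. Otherwise t4 = - d4 n4, so n4 is closed and has weight 0, and \<open>t1\<close> differs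
  from a combination of t1 + t3 and t2 by (c4 - q1 d4) n4. If this coefficient vanishes, the torus
  case applies; if not, n4 is recovered from t1, t2, t3 and three copies of \<open>r2\<close>
  result.\<close>

lemma listed_one_central:
  assumes td: "torus_data G t1 n1 t2 n2 t3 n3 t4 n4"
    and s: "span4 t4 n1 n2 n3 n4"
  shows "listed G"
proof -
  have sc: "scal G = (*s)" and tr: "triangular G t1 n1" "triangular G t2 n2" "triangular G t3 n3" "triangular G t4 n4"
    and ker: "\<And>x. n1 x = 0 \<Longrightarrow> n2 x = 0 \<Longrightarrow> n3 x = 0 \<Longrightarrow> n4 x = 0 \<Longrightarrow> t1 x + t3 x = 0 \<Longrightarrow> t2 x + t4 x = 0 \<Longrightarrow> x = 0"
    using td unfolding torus_data_def by blast+
  obtain c1 c2 c3 c4 p1 q1 d1 d2 d3 d4 p2 q2 where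
    t1[rule_format]: "\<forall>x. t1 x = c1 * n1 x + c2 * n2 x + c3 * n3 x + c4 * n4 x + p1 * (t1 x + t3 x) + q1 * (t2 x + t4 x)"
    and t2[rule_format]: "\<forall>x. t2 x = d1 * n1 x + d2 * n2 x + d3 * n3 x + d4 * n4 x + p2 * (t1 x + t3 x) + q2 * (t2 x + t4 x)"
    and c[rule_format]: "(p1, q1) \<noteq> (0, 0) \<longrightarrow> c1 = 0 \<and> d1 = 0"
    "(p2, q2) \<noteq> (0, 0) \<longrightarrow> c2 = 0 \<and> d2 = 0"
    "(p1, q1) \<noteq> (1, 0) \<longrightarrow> c3 = 0 \<and> d3 = 0"
    "(p2, q2) \<noteq> (0, 1) \<longrightarrow> c4 = 0 \<and> d4 = 0"
    "c4 * c3 = c4 * d3" "d3 * c4 = d3 * d4"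
    by (rule torus_data_coeffs[OF td])
  obtain l1 l2 l3 l4 where l: "\<And>x. t4 x = l1 * n1 x + l2 * n2 x + l3 * n3 x + l4 * n4 x"
    using s unfolding span4_def by blast
  have "(d1 + l1) * n1 x + (d2 + l2) * n2 x + (d3 + l3) * n3 x + (d4 + l4) * n4 x +
      p2 * (t1 x + t3 x) + (q2 - 1) * (t2 x + t4 x) = 0" for x
    using t2[of x] l[of x] by algebra
  from torus_data_unique[OF td this] have pq2: "p2 = 0" "q2 = 1" by simp_all
  consider "(p1, q1) = (0, 0)" | "(p1, q1) = (1, 0)" | "(p1, q1) \<noteq> (0, 0)" "(p1, q1) \<noteq> (1, 0)" by blast
  then show ?thesis
  proof cases
    case 1
    then have "span4 t1 n1 n2 n3 n4" using t1 unfolding span4_def by fastforce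
    then show ?thesis
      using listed_two_central[OF torus_data_swap(1)[OF td]] s span4_swap(1) by blast
  next
    case 2
    then have "t3 x = - c1 * n1 x + - c2 * n2 x + - c3 * n3 x + - c4 * n4 x" for x
      using t1[of x] unfolding prod.inject by algebra
    then have "span4 t3 n1 n2 n3 n4" unfolding span4_def by blast
    then show ?thesis using listed_two_central[OF td] s by blast
  next
    case 3
    have z: "c1 = 0" "c2 = 0" "c3 = 0" "d1 = 0" "d2 = 0" "d3 = 0" using c 3 pq2 by auto
    have t4: "t4 x = - d4 * n4 x" for x using t2[of x] unfolding z pq2 by algebra
    have t1': "t1 x = c4 * n4 x + p1 * (t1 x + t3 x) + q1 * (t2 x + t4 x)" for x
      using t1[of x] by (simp add: z)
    show ?thesis
    proof (cases "c4 = q1 * d4")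
      case True
      have tr': "triangular G (\<lambda>_. 0) n4"
        using tr(4) unfolding triangular_def t4 by (simp add: lf_def)
      show ?thesis
      proof (rule listed_torus[OF sc tr(1,2,3) tr', of p1 q1 0 1])
        show "t1 x = p1 * (t1 x + t3 x) + q1 * (t2 x + 0)" for x
          using t1'[of x] by (simp add: t4 True algebra_simps)
      qed (use ker in \<open>auto simp: t4\<close>)
    next
      case False
      show ?thesis
      proof (intro listedI(4) r2_r2_r2_iso[OF sc tr(1,2,3)])
        fix x assume *: "t1 x = 0" "n1 x = 0" "t2 x = 0" "n2 x = 0" "t3 x = 0" "n3 x = 0"
        have "c4 * n4 x = q1 * d4 * n4 x" using t1'[of x] * by (simp add: t4)
        then have "n4 x = 0" using False by simp
        then show "x = 0" using ker[of x] * by (simp add: t4)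
      qed
    qed
  qed
qed

text \<open>Generically all coefficients at the \<open>n\<close> vanish and the weights are torus
  functionals. In the exceptional cases one \<open>t\<close> lies in the span of the
  \<open>n\<close>, and the symmetries of \<open>torus_data\<close> move it to position 4.\<close>

proposition listed_torus_data:
  assumes td: "torus_data G t1 n1 t2 n2 t3 n3 t4 n4"
  shows "listed G"
proof -
  have sc: "scal G = (*s)" and tr: "triangular G t1 n1" "triangular G t2 n2" "triangular G t3 n3" "triangular G t4 n4"
    and ker: "\<And>x. n1 x = 0 \<Longrightarrow> n2 x = 0 \<Longrightarrow> n3 x = 0 \<Longrightarrow> n4 x = 0 \<Longrightarrow> t1 x + t3 x = 0 \<Longrightarrow> t2 x + t4 x = 0 \<Longrightarrow> x = 0"
    using td unfolding torus_data_def by blast+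
  obtain c1 c2 c3 c4 p1 q1 d1 d2 d3 d4 p2 q2 where
    t1[rule_format]: "\<forall>x. t1 x = c1 * n1 x + c2 * n2 x + c3 * n3 x + c4 * n4 x + p1 * (t1 x + t3 x) + q1 * (t2 x + t4 x)"
    and t2[rule_format]: "\<forall>x. t2 x = d1 * n1 x + d2 * n2 x + d3 * n3 x + d4 * n4 x + p2 * (t1 x + t3 x) + q2 * (t2 x + t4 x)"
    and c[rule_format]: "(p1, q1) \<noteq> (0, 0) \<longrightarrow> c1 = 0 \<and> d1 = 0"
    "(p2, q2) \<noteq> (0, 0) \<longrightarrow> c2 = 0 \<and> d2 = 0"
    "(p1, q1) \<noteq> (1, 0) \<longrightarrow> c3 = 0 \<and> d3 = 0"
    "(p2, q2) \<noteq> (0, 1) \<longrightarrow> c4 = 0 \<and> d4 = 0"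
    "c4 * c3 = c4 * d3" "d3 * c4 = d3 * d4"
    by (rule torus_data_coeffs[OF td])
  consider "(p1, q1) = (0, 0)" | "(p2, q2) = (0, 0)" | "(p1, q1) = (1, 0)" | "(p2, q2) = (0, 1)"
    | "(p1, q1) \<noteq> (0, 0)" "(p2, q2) \<noteq> (0, 0)" "(p1, q1) \<noteq> (1, 0)" "(p2, q2) \<noteq> (0, 1)" by blast
  then show ?thesis
  proof cases
    case 1
    then have "span4 t1 n1 n2 n3 n4" using t1 unfolding span4_def by fastforce
    then show ?thesis
      using listed_one_central[OF torus_data_swap(2)[OF torus_data_swap(3)[OF td]]]
        span4_swap(2)[OF span4_swap(3)] by blast
  next
    case 2
    then have "span4 t2 n1 n2 n3 n4" using t2 unfolding span4_def by fastforce
    then show ?thesis using listed_one_central[OF torus_data_swap(2)[OF td]] span4_swap(2) by blast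
  next
    case 3
    then have "t3 x = - c1 * n1 x + - c2 * n2 x + - c3 * n3 x + - c4 * n4 x" for x
      using t1[of x] unfolding prod.inject by algebra
    then have "span4 t3 n1 n2 n3 n4" unfolding span4_def by blast
    then show ?thesis using listed_one_central[OF torus_data_swap(3)[OF td]] span4_swap(3) by blast
  next
    case 4
    then have "t4 x = - d1 * n1 x + - d2 * n2 x + - d3 * n3 x + - d4 * n4 x" for x
      using t2[of x] unfolding prod.inject by algebra
    then have "span4 t4 n1 n2 n3 n4" unfolding span4_def by blast
    then show ?thesis using listed_one_central[OF td] by blast
  next
    case 5
    then have z: "c1 = 0" "c2 = 0" "c3 = 0" "c4 = 0" "d1 = 0" "d2 = 0" "d3 = 0" "d4 = 0" using c by auto
    show ?thesis
    proof (rule listed_torus[OF sc tr])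
      show "t1 x = p1 * (t1 x + t3 x) + q1 * (t2 x + t4 x)" for x using t1[of x] unfolding z by simp
      show "t2 x = p2 * (t1 x + t3 x) + q2 * (t2 x + t4 x)" for x using t2[of x] unfolding z by simp
    qed (use ker in blast)
  qed
qed

section \<open>Homomorphisms into \<open>sl2\<close> and their eigenlines\<close>

definition sl2_hom :: "(complex, complex ^ 'n) lie_struct \<Rightarrow> (complex ^ 'n \<Rightarrow> complex ^ 3) \<Rightarrow> bool" where
  "sl2_hom G \<rho> \<longleftrightarrow> (\<forall>x y. \<rho> (x + y) = \<rho> x + \<rho> y) \<and> (\<forall>c x. \<rho> (c *s x) = c *s \<rho> x) \<and>
     (\<forall>x y. \<rho> (brac G x y) = brac sl2 (\<rho> x) (\<rho> y))"

lemma sl2_homD: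
  assumes "sl2_hom G \<rho>"
  shows "\<rho> (x + y) = \<rho> x + \<rho> y" "\<rho> (c *s x) = c *s \<rho> x" "\<rho> (brac G x y) = brac sl2 (\<rho> x) (\<rho> y)"
    "\<rho> (x - y) = \<rho> x - \<rho> y" "\<rho> 0 = 0"
proof -
  show *: "\<rho> (x + y) = \<rho> x + \<rho> y" "\<rho> (c *s x) = c *s \<rho> x" "\<rho> (brac G x y) = brac sl2 (\<rho> x) (\<rho> y)" for x y c
    using assms unfolding sl2_hom_def by blast+
  show "\<rho> (x - y) = \<rho> x - \<rho> y" using *(1)[of "x - y" y] by simp
  show "\<rho> 0 = 0" using *(1)[of 0 0] by simp
qed

text \<open>For \<open>v = (p, q)\<close>, \<open>w = (r, s)\<close> and \<open>u\<close> regarded as a traceless matrix, \<open>polar p q r s u\<close> is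
  \<open>- det (u v, w)\<close>, a symmetric bilinear form in \<open>v, w\<close>; it vanishes for \<open>v = w\<close> iff \<open>v\<close> is an
  eigenvector of \<open>u\<close>.\<close>

definition polar :: "complex \<Rightarrow> complex \<Rightarrow> complex \<Rightarrow> complex \<Rightarrow> complex ^ 3 \<Rightarrow> complex" where
  "polar p q r s u = u$2 * p * r - u$3 * (p * s + q * r) - u$1 * q * s"

lemma polar_linear:
  "polar p q r s (u + v) = polar p q r s u + polar p q r s v"
  "polar p q r s (u - v) = polar p q r s u - polar p q r s v"
  "polar p q r s (c *s u) = c * polar p q r s u"
  by (simp_all add: polar_def algebra_simps)

lemma lf_polar: "sl2_hom G \<rho> \<Longrightarrow> lf (\<lambda>x. polar p q r s (\<rho> x))"
  by (simp add: lf_def sl2_homD polar_linear)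

text \<open>In the basis (p, q), (r, s) the three polar values are, up to factors, the lower left,
  diagonal and upper right entry of the matrix; the identities are the commutator written in that
  basis.\<close>

lemma polar_brac:
  "(p * s - q * r) * polar p q p q (brac sl2 x y) =
     2 * (polar p q r s x * polar p q p q y - polar p q p q x * polar p q r s y)"
  "(p * s - q * r) * polar p q r s (brac sl2 x y) =
     polar r s r s x * polar p q p q y - polar p q p q x * polar r s r s y"
  "(p * s - q * r) * polar r s r s (brac sl2 x y) =
     2 * (polar r s r s x * polar p q r s y - polar p q r s x * polar r s r s y)"
  unfolding polar_def brac_sl2 vector_3 by algebra+

lemma polar_nondegenerate:
  assumes "p * s - q * r \<noteq> 0" "polar p q p q u = 0" "polar p q r s u = 0" "polar r s r s u = 0"
  shows "u = 0"
proof -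
  have "(p * s - q * r)\<^sup>2 * u$2 = 0" "(p * s - q * r)\<^sup>2 * u$1 = 0" "(p * s - q * r)\<^sup>2 * u$3 = 0"
    using assms(2-4) unfolding polar_def by algebra+
  then show ?thesis using assms(1) by (simp add: vec_eq_iff forall_3)
qed

lemma eigenvector_exists:
  obtains p q where "(p, q) \<noteq> (0, 0)" "polar p q p q u = 0"
proof (cases "u$1 = 0")
  case True
  then show ?thesis using that[of 0 1] by (simp add: polar_def)
next
  case False
  \<comment> \<open>Here w^2 is minus the determinant of u, so w is an eigenvalue, and (1, q) spans
    its eigenline.\<close>
  define w where "w = csqrt ((u$3)\<^sup>2 + u$1 * u$2)"
  have w: "w * w = u$3 * u$3 + u$1 * u$2" unfolding w_def by (simp flip: power2_eq_square)
  define q where "q = (w - u$3) / u$1"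
  have q: "u$1 * q = w - u$3" using False by (simp add: q_def)
  have "u$1 * polar 1 q 1 q u = 0" unfolding polar_def using q w by algebra
  then show ?thesis using that[of 1 q] False by simp
qed

definition cross :: "complex ^ 3 \<Rightarrow> complex ^ 3 \<Rightarrow> complex ^ 3" where
  "cross u v = vector [u$2 * v$3 - u$3 * v$2, u$3 * v$1 - u$1 * v$3, u$1 * v$2 - u$2 * v$1]"

lemma cross_eq_0_multiple:
  assumes "cross u v = 0" "u \<noteq> 0"
  obtains k where "v = k *s u"
proof -
  have e: "u$2 * v$3 = u$3 * v$2" "u$3 * v$1 = u$1 * v$3" "u$1 * v$2 = u$2 * v$1"
    using assms(1) by (simp_all add: cross_def vec_eq_iff forall_3)
  consider "u$1 \<noteq> 0" | "u$2 \<noteq> 0" | "u$3 \<noteq> 0" using assms(2) by (auto simp: vec_eq_iff forall_3)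
  then show ?thesis
  proof cases
    case 1
    then have "v = (v$1 / u$1) *s u" using e by (simp add: vec_eq_iff forall_3 field_simps)
    then show ?thesis by (rule that)
  next
    case 2
    then have "v = (v$2 / u$2) *s u" using e by (simp add: vec_eq_iff forall_3 field_simps)
    then show ?thesis by (rule that)
  next
    case 3
    then have "v = (v$3 / u$3) *s u" using e by (simp add: vec_eq_iff forall_3 field_simps)
    then show ?thesis by (rule that)
  qed
qed

text \<open>A proper subalgebra of dimension two is the orthogonal complement of \<open>[u, v]\<close>, which then
  has to be isotropic; this is the relation \<open>X\<^sub>3\<^sup>2 + 4 X\<^sub>1 X\<^sub>2 = 0\<close> in the proof.\<close>

lemma not_surj_eigenvector:
  assumes hom: "sl2_hom G \<rho>" and ns: "\<not> surj \<rho>"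
  obtains p q where "(p, q) \<noteq> (0, 0)" "\<forall>x. polar p q p q (\<rho> x) = 0"
proof (cases "\<forall>x y. cross (\<rho> x) (\<rho> y) = 0")
  case True
  show ?thesis
  proof (cases "\<forall>x. \<rho> x = 0")
    case True
    then show ?thesis using that[of 1 0] by (simp add: polar_def)
  next
    case False
    then obtain x0 where x0: "\<rho> x0 \<noteq> 0" by blast
    obtain p q where pq: "(p, q) \<noteq> (0, 0)" "polar p q p q (\<rho> x0) = 0" by (rule eigenvector_exists)
    have "polar p q p q (\<rho> x) = 0" for x
    proof -
      obtain k where "\<rho> x = k *s \<rho> x0" using cross_eq_0_multiple True x0 by blast
      then show ?thesis using pq by (simp add: polar_linear)
    qed
    then show ?thesis using that pq(1) by blast
  qed
next
  case False
  then obtain x y where "cross (\<rho> x) (\<rho> y) \<noteq> 0" by blast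
  define X1 where "X1 = \<rho> x$2 * \<rho> y$3 - \<rho> x$3 * \<rho> y$2"
  define X2 where "X2 = \<rho> x$3 * \<rho> y$1 - \<rho> x$1 * \<rho> y$3"
  define X3 where "X3 = \<rho> x$1 * \<rho> y$2 - \<rho> x$2 * \<rho> y$1"
  have X0: "X1 \<noteq> 0 \<or> X2 \<noteq> 0 \<or> X3 \<noteq> 0"
    using \<open>cross (\<rho> x) (\<rho> y) \<noteq> 0\<close> by (auto simp: cross_def X1_def X2_def X3_def vec_eq_iff forall_3)
  \<comment> \<open>If some image vector were off the plane of \<rho> x and \<rho> y, Cramer's rule
    would make \<rho> onto; \<open>a\<close>, \<open>b\<close>, \<open>c\<close> below are its
    numerators.\<close>
  have det: "X1 * \<rho> z$1 + X2 * \<rho> z$2 + X3 * \<rho> z$3 = 0" for z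
  proof (rule ccontr)
    define D where "D = X1 * \<rho> z$1 + X2 * \<rho> z$2 + X3 * \<rho> z$3"
    assume "X1 * \<rho> z$1 + X2 * \<rho> z$2 + X3 * \<rho> z$3 \<noteq> 0"
    then have D: "D \<noteq> 0" by (simp add: D_def)
    have "\<exists>w. \<rho> w = u" for u
    proof -
      define a where "a = u$1 * (\<rho> y$2 * \<rho> z$3 - \<rho> y$3 * \<rho> z$2) + u$2 * (\<rho> y$3 * \<rho> z$1 - \<rho> y$1 * \<rho> z$3)
        + u$3 * (\<rho> y$1 * \<rho> z$2 - \<rho> y$2 * \<rho> z$1)"
      define b where "b = u$1 * (\<rho> z$2 * \<rho> x$3 - \<rho> z$3 * \<rho> x$2) + u$2 * (\<rho> z$3 * \<rho> x$1 - \<rho> z$1 * \<rho> x$3)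
        + u$3 * (\<rho> z$1 * \<rho> x$2 - \<rho> z$2 * \<rho> x$1)"
      define c where "c = X1 * u$1 + X2 * u$2 + X3 * u$3"
      have "D * u$1 = a * \<rho> x$1 + b * \<rho> y$1 + c * \<rho> z$1"
        "D * u$2 = a * \<rho> x$2 + b * \<rho> y$2 + c * \<rho> z$2"
        "D * u$3 = a * \<rho> x$3 + b * \<rho> y$3 + c * \<rho> z$3"
        unfolding D_def a_def b_def c_def X1_def X2_def X3_def by algebra+
      then have "a *s \<rho> x + b *s \<rho> y + c *s \<rho> z = D *s u" by (simp add: vec_eq_iff forall_3)
      then have "(1 / D) *s (a *s \<rho> x + b *s \<rho> y + c *s \<rho> z) = (1 / D) *s (D *s u)" by simp
      then have "\<rho> ((1 / D) *s (a *s x + b *s y + c *s z)) = u"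
        using D unfolding sl2_homD[OF hom] by simp
      then show ?thesis by blast
    qed
    then show False using ns by (metis surjI)
  qed
  have iso: "X3 * X3 = - 4 * X1 * X2"
    using det[of "brac G x y"] unfolding sl2_homD[OF hom] brac_sl2 vector_3
    unfolding X1_def X2_def X3_def by algebra
  show ?thesis
  proof (cases "X2 = 0")
    case True
    then have "X3 = 0" using iso by simp
    then have "\<rho> z $ 1 = 0" for z using det[of z] True X0 by simp
    then show ?thesis using that[of 0 1] by (simp add: polar_def)
  next
    case False
    \<comment> \<open>By the isotropy relation, p and q are chosen with (X1, X2, X3) = (- q^2, p^2,
      - 2 p q); the equation of the plane then reads \<open>polar p q p q\<close> = 0.\<close>
    define p where "p = csqrt X2"
    have p: "p * p = X2" "p \<noteq> 0" using False unfolding p_def by (simp_all flip: power2_eq_square)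
    define q where "q = - X3 / (2 * p)"
    have q: "2 * p * q = - X3" using p by (simp add: q_def)
    have "4 * p * p * (X1 + q * q) = 4 * (p * p) * X1 + (2 * p * q) * (2 * p * q)"
      by (simp add: algebra_simps)
    also have "\<dots> = 0" unfolding p(1) q using iso by simp
    finally have "4 * p * p * (X1 + q * q) = 0" .
    then have X1: "X1 = - (q * q)" using p(2) by (simp add: add_eq_0_iff2)
    have "polar p q p q (\<rho> z) = 0" for z
      using det[of z] X1 p(1) q unfolding polar_def by algebra
    then show ?thesis using that p(2) by blast
  qed
qed

text \<open>If \<lambda> is the eigenvalue on the line of (p, q), the first functional is 2
  \<lambda>, the root of the Borel subalgebra fixing that line; the second is a multiple of the
  off-diagonal entry.\<close>

lemma triangular_of_eigenvector:
  assumes hom: "sl2_hom G \<rho>" and ev: "\<forall>x. polar p q p q (\<rho> x) = 0" and d: "p * s - q * r \<noteq> 0"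
  shows "triangular G (\<lambda>x. - 2 / (p * s - q * r) * polar p q r s (\<rho> x)) (\<lambda>x. polar r s r s (\<rho> x))"
proof -
  note h = sl2_homD[OF hom]
  define D where "D = p * s - q * r"
  have D: "D \<noteq> 0" using d by (simp add: D_def)
  have "D * polar p q r s (\<rho> (brac G x y)) = 0" for x y
    using polar_brac(2)[of p s q r "\<rho> x" "\<rho> y"] ev by (simp add: D_def h)
  moreover have "polar r s r s (\<rho> (brac G x y)) =
      - 2 / D * polar p q r s (\<rho> x) * polar r s r s (\<rho> y) - - 2 / D * polar p q r s (\<rho> y) * polar r s r s (\<rho> x)" for x y
    using polar_brac(3)[of p s q r "\<rho> x" "\<rho> y"] D
    by (simp add: D_def[symmetric] h field_simps)
  moreover have "lf (\<lambda>x. - 2 / D * polar p q r s (\<rho> x))" "lf (\<lambda>x. polar r s r s (\<rho> x))"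
    by (intro lf_cmult lf_polar[OF hom])+
  ultimately show ?thesis
    unfolding triangular_def D_def[symmetric] using D by simp
qed

text \<open>A common eigenline of \<sigma> and \<sigma>' would be fixed by all \<sigma> x -
  \<sigma>' x, against surjectivity. So the two eigenlines form a basis, in which \<open>n\<close>,
  \<open>n'\<close> and \<open>t + t'\<close> are, up to factors, the entries of \<sigma> x -
  \<sigma>' x.\<close>

lemma triangular_pair:
  assumes hom: "sl2_hom G \<sigma>" "sl2_hom G \<sigma>'" and ns: "\<not> surj \<sigma>" "\<not> surj \<sigma>'"
    and surj: "\<forall>y. \<exists>x. \<sigma> x - \<sigma>' x = y"
  obtains t n t' n' where "triangular G t n" "triangular G t' n'"
    "\<forall>x. n x = 0 \<longrightarrow> n' x = 0 \<longrightarrow> t x + t' x = 0 \<longrightarrow> \<sigma> x = \<sigma>' x"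
proof -
  obtain p q where pq: "(p, q) \<noteq> (0, 0)" "\<forall>x. polar p q p q (\<sigma> x) = 0"
    by (rule not_surj_eigenvector[OF hom(1) ns(1)])
  obtain r s where rs: "(r, s) \<noteq> (0, 0)" "\<forall>x. polar r s r s (\<sigma>' x) = 0"
    by (rule not_surj_eigenvector[OF hom(2) ns(2)])
  have d: "p * s - q * r \<noteq> 0"
  proof
    assume "p * s - q * r = 0"
    then obtain k where k: "r = k * p" "s = k * q" using dt_eq_0_multiple[of p q r s] pq(1) unfolding dt_def by blast
    have k0: "k \<noteq> 0" using rs(1) k by auto
    have "polar r s r s u = k\<^sup>2 * polar p q p q u" for u
      unfolding k polar_def by (simp add: algebra_simps power2_eq_square)
    then have "polar p q p q (\<sigma> x - \<sigma>' x) = 0" for x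
      using pq(2) rs(2) k0 by (simp add: polar_linear)
    then have "polar p q p q y = 0" for y using surj by metis
    from this[of "vector [1, 0, 0]"] this[of "vector [0, 1, 0]"] show False
      using pq(1) by (simp add: polar_def)
  qed
  then have d': "r * q - s * p \<noteq> 0" by (auto simp: algebra_simps)
  show ?thesis
  proof (rule that[OF triangular_of_eigenvector[OF hom(1) pq(2) d] triangular_of_eigenvector[OF hom(2) rs(2) d']];
      intro allI impI)
    fix x
    assume *: "polar r s r s (\<sigma> x) = 0" "polar p q p q (\<sigma>' x) = 0"
      "- 2 / (p * s - q * r) * polar p q r s (\<sigma> x) + - 2 / (r * q - s * p) * polar r s p q (\<sigma>' x) = 0"
    have "polar r s p q (\<sigma>' x) = polar p q r s (\<sigma>' x)" by (simp add: polar_def algebra_simps)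
    moreover have "2 / (r * q - s * p) = - (2 / (p * s - q * r))"
      by (simp add: minus_divide_right mult.commute)
    ultimately have "2 / (p * s - q * r) * (polar p q r s (\<sigma> x) - polar p q r s (\<sigma>' x)) = 0"
      using *(3) unfolding minus_divide_left[symmetric] by (auto simp: right_diff_distrib)
    then have "polar p q r s (\<sigma> x) - polar p q r s (\<sigma>' x) = 0" using d by simp
    then have "\<sigma> x - \<sigma>' x = 0"
      using *(1,2) pq(2) rs(2) by (intro polar_nondegenerate[OF d]) (simp_all add: polar_linear)
    then show "\<sigma> x = \<sigma>' x" by simp
  qed
qed

lemma bij_pair:
  fixes f g :: "complex ^ 6 \<Rightarrow> complex ^ 3"
  assumes "\<And>x y. f (x + y) = f x + f y" "\<And>c x. f (c *s x) = c *s f x"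
    "\<And>x y. g (x + y) = g x + g y" "\<And>c x. g (c *s x) = c *s g x"
    and ker: "\<And>x. f x = 0 \<Longrightarrow> g x = 0 \<Longrightarrow> x = 0"
  shows "bij (\<lambda>x. (f x, g x))"
proof -
  let ?h = "\<lambda>x :: complex ^ 6. (vector [x$1, x$2, x$3] :: complex ^ 3, vector [x$4, x$5, x$6] :: complex ^ 3)"
  let ?k = "\<lambda>x. vec6 (f x$1) (f x$2) (f x$3) (g x$1) (g x$2) (g x$3)"
  have "bij ?h"
    by (rule o_bij[of "\<lambda>p. vec6 (fst p$1) (fst p$2) (fst p$3) (snd p$1) (snd p$2) (snd p$3)"])
      (auto simp: fun_eq_iff vec6_eq_iff vec_eq_iff forall_3)
  moreover have "bij ?k"
  proof (rule bij_of_trivial_kernel)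
    fix x assume "?k x = 0"
    then show "x = 0" by (intro ker) (simp_all add: vec6_eq_iff vec_eq_iff forall_3)
  qed (simp_all add: assms vec6_eq_iff)
  ultimately have "bij (?h \<circ> ?k)" by (simp add: bij_comp)
  moreover have "?h \<circ> ?k = (\<lambda>x. (f x, g x))" by (auto simp: fun_eq_iff vec_eq_iff forall_3)
  ultimately show ?thesis by simp
qed

lemma diff_pair_surj:
  fixes \<rho>1 :: "complex ^ 6 \<Rightarrow> complex ^ 3"
  assumes hom: "sl2_hom G \<rho>1" "sl2_hom G \<rho>2" "sl2_hom G \<rho>3" "sl2_hom G \<rho>4"
    and ker: "\<forall>x. \<rho>1 x = \<rho>3 x \<longrightarrow> \<rho>2 x = \<rho>4 x \<longrightarrow> x = 0"
  shows "\<exists>x. \<rho>1 x - \<rho>3 x = y \<and> \<rho>2 x - \<rho>4 x = y'"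
proof -
  have "bij (\<lambda>x. (\<rho>1 x - \<rho>3 x, \<rho>2 x - \<rho>4 x))"
    by (rule bij_pair) (use ker in \<open>auto simp: hom[THEN sl2_homD(1)] hom[THEN sl2_homD(2)] vec.scale_right_diff_distrib\<close>)
  then have "(y, y') \<in> range (\<lambda>x. (\<rho>1 x - \<rho>3 x, \<rho>2 x - \<rho>4 x))" by (simp add: bij_is_surj)
  then show ?thesis by auto
qed

proposition listed_solvable:
  fixes G :: "(complex, complex ^ 6) lie_struct"
  assumes sc: "scal G = (*s)"
    and hom: "sl2_hom G \<rho>1" "sl2_hom G \<rho>2" "sl2_hom G \<rho>3" "sl2_hom G \<rho>4"
    and ker: "\<forall>x. \<rho>1 x = \<rho>3 x \<longrightarrow> \<rho>2 x = \<rho>4 x \<longrightarrow> x = 0"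
    and ns: "\<not> surj \<rho>1" "\<not> surj \<rho>2" "\<not> surj \<rho>3" "\<not> surj \<rho>4"
  shows "listed G"
proof -
  have s13: "\<forall>y. \<exists>x. \<rho>1 x - \<rho>3 x = y" and s24: "\<forall>y. \<exists>x. \<rho>2 x - \<rho>4 x = y"
    using diff_pair_surj[OF hom ker] by blast+
  obtain t1 n1 t3 n3 where 13: "triangular G t1 n1" "triangular G t3 n3"
    "\<forall>x. n1 x = 0 \<longrightarrow> n3 x = 0 \<longrightarrow> t1 x + t3 x = 0 \<longrightarrow> \<rho>1 x = \<rho>3 x"
    by (rule triangular_pair[OF hom(1,3) ns(1,3) s13])
  obtain t2 n2 t4 n4 where 24: "triangular G t2 n2" "triangular G t4 n4"
    "\<forall>x. n2 x = 0 \<longrightarrow> n4 x = 0 \<longrightarrow> t2 x + t4 x = 0 \<longrightarrow> \<rho>2 x = \<rho>4 x"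
    by (rule triangular_pair[OF hom(2,4) ns(2,4) s24])
  have "torus_data G t1 n1 t2 n2 t3 n3 t4 n4"
    unfolding torus_data_def using sc 13 24 ker by blast
  then show ?thesis by (rule listed_torus_data)
qed

section \<open>Non-solvable subalgebras\<close>

lemma inj_of_surj:
  fixes f :: "complex ^ 'n \<Rightarrow> complex ^ 'n"
  assumes "\<And>x y. f (x + y) = f x + f y" "\<And>c x. f (c *s x) = c *s f x" "surj f"
  shows "inj f"
  using assms by (intro vec.linear_surj_imp_inj) (simp_all add: linear_vec_iff)

lemma bij_pair_of_surj:
  fixes f g :: "complex ^ 6 \<Rightarrow> complex ^ 3"
  assumes "\<And>x y. f (x + y) = f x + f y" "\<And>c x. f (c *s x) = c *s f x"
    "\<And>x y. g (x + y) = g x + g y" "\<And>c x. g (c *s x) = c *s g x"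
    and surj: "\<And>u v. \<exists>x. f x = u \<and> g x = v"
  shows "bij (\<lambda>x. (f x, g x))"
proof -
  let ?k = "\<lambda>x. vec6 (f x$1) (f x$2) (f x$3) (g x$1) (g x$2) (g x$3)"
  have "inj ?k"
  proof (rule inj_of_surj)
    show "surj ?k"
    proof (rule surjI)
      fix u :: "complex ^ 6"
      let ?x = "SOME x. f x = vector [u$1, u$2, u$3] \<and> g x = vector [u$4, u$5, u$6]"
      have "f ?x = vector [u$1, u$2, u$3] \<and> g ?x = vector [u$4, u$5, u$6]"
        by (rule someI_ex) (rule surj)
      then show "?k ?x = u" by (simp add: vec6_eq_iff)
    qed
  qed (simp_all add: assms vec6_eq_iff)
  have k0: "?k 0 = 0" using assms(2)[of 0] assms(4)[of 0] by (simp add: vec6_eq_iff)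
  show ?thesis
  proof (rule bij_pair)
    fix x assume "f x = 0" "g x = 0"
    then have "?k x = ?k 0" unfolding k0 by (simp add: vec6_eq_iff)
    then show "x = 0" using injD[OF \<open>inj ?k\<close>] by blast
  qed (fact assms)+
qed

lemma iso_of_bij_pair:
  assumes sc: "scal G = (*s)" "scal L = (*s)" "scal M = (*s)"
    and lin: "\<And>x y. f (x + y) = f x + f y" "\<And>c x. f (c *s x) = c *s f x"
    "\<And>x y. g (x + y) = g x + g y" "\<And>c x. g (c *s x) = c *s g x"
    and bij: "bij (\<lambda>x :: complex ^ 'n. (f x :: complex ^ 'm, g x :: complex ^ 'k))"
    and br: "\<And>x y. f (brac G x y) = brac L (f x) (f y)" "\<And>x y. g (brac G x y) = brac M (g x) (g y)"
  shows "G \<cong>\<^sub>L L \<oplus>\<^sub>L M"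
  unfolding lie_isomorphic_def linear_iff
  using bij
  by (intro exI[of _ "\<lambda>x. (f x, g x)"])
    (simp add: sc lin br scal_sum brac_sum vector_space_vec vector_space_pair)

lemma sl2_r3_iso:
  fixes G :: "(complex, complex ^ 6) lie_struct"
  assumes sc: "scal G = (*s)" and hom: "sl2_hom G \<rho>" and tr: "triangular G t n"
    and m: "lf m" "\<forall>x y. m (brac G x y) = l * (t x * m y - t y * m x)"
    and ker: "\<And>x. \<rho> x = 0 \<Longrightarrow> t x = 0 \<Longrightarrow> n x = 0 \<Longrightarrow> m x = 0 \<Longrightarrow> x = 0"
  shows "G \<cong>\<^sub>L sl2 \<oplus>\<^sub>L r3 l"
proof -
  define g :: "complex ^ 6 \<Rightarrow> complex ^ 3" where "g x = vector [t x, n x, m x]" for x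
  have g: "g (x + y) = g x + g y" "g (c *s x) = c *s g x" "g (brac G x y) = brac (r3 l) (g x) (g y)" for x y c
    using tr m by (simp_all add: g_def triangular_def lf_def vec_eq_iff forall_3 brac_r3 mult.commute)
  show ?thesis
  proof (rule iso_of_bij_pair[where f = \<rho> and g = g])
    show "bij (\<lambda>x. (\<rho> x, g x))"
    proof (rule bij_pair)
      fix x assume "\<rho> x = 0" "g x = 0"
      then show "x = 0" by (intro ker) (simp_all add: g_def vec_eq_iff forall_3)
    qed (simp_all add: sl2_homD[OF hom] g)
  qed (simp_all add: sc sl2_homD[OF hom] g)
qed

text \<open>The three-dimensional version of the torus analysis: \<rho>, n, n', t + t' form a basis
  of the dual, and since \<open>sl2\<close> is perfect the closed functional t has no component
  along \<rho>. The parameter (1 - p) / p cannot be -1, because adding 1 gives 1 / p.\<close>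

lemma sl2_r3_of_pair:
  fixes G :: "(complex, complex ^ 6) lie_struct"
  assumes sc: "scal G = (*s)" and hom: "sl2_hom G \<rho>" "sl2_hom G \<sigma>" "sl2_hom G \<sigma>'"
    and ns: "\<not> surj \<sigma>" "\<not> surj \<sigma>'"
    and ker: "\<And>x. \<rho> x = 0 \<Longrightarrow> \<sigma> x = \<sigma>' x \<Longrightarrow> x = 0"
  obtains l where "l \<noteq> -1" "G \<cong>\<^sub>L sl2 \<oplus>\<^sub>L r3 l"
proof -
  have "bij (\<lambda>x. (\<rho> x, \<sigma> x - \<sigma>' x))"
    by (rule bij_pair) (auto simp: hom[THEN sl2_homD(1)] hom[THEN sl2_homD(2)] vec.scale_right_diff_distrib intro: ker)
  then have "(0, y) \<in> range (\<lambda>x. (\<rho> x, \<sigma> x - \<sigma>' x))" for y by (simp add: bij_is_surj)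
  then have surj: "\<forall>y. \<exists>x. \<sigma> x - \<sigma>' x = y" by (metis (no_types, lifting) image_iff prod.inject)
  obtain t n t' n' where tr: "triangular G t n" "triangular G t' n'"
    and n: "\<forall>x. n x = 0 \<longrightarrow> n' x = 0 \<longrightarrow> t x + t' x = 0 \<longrightarrow> \<sigma> x = \<sigma>' x"
    by (rule triangular_pair[OF hom(2,3) ns surj])
  have lf: "lf (\<lambda>x. \<rho> x $ 1)" "lf (\<lambda>x. \<rho> x $ 2)" "lf (\<lambda>x. \<rho> x $ 3)" "lf n" "lf n'" "lf (\<lambda>x. t x + t' x)"
    using tr by (auto simp: lf_def sl2_homD[OF hom(1)] triangular_def algebra_simps)
  have kr: "\<rho> x $ 1 = 0 \<Longrightarrow> \<rho> x $ 2 = 0 \<Longrightarrow> \<rho> x $ 3 = 0 \<Longrightarrow> n x = 0 \<Longrightarrow> n' x = 0 \<Longrightarrow> t x + t' x = 0 \<Longrightarrow> x = 0" for x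
    using ker[of x] n by (simp add: vec_eq_iff forall_3)
  obtain E :: "complex ^ 6 \<Rightarrow> complex ^ 6" where E[rule_format]:
    "\<forall>u. \<rho> (E u) $ 1 = u$1" "\<forall>u. \<rho> (E u) $ 2 = u$2" "\<forall>u. \<rho> (E u) $ 3 = u$3"
    "\<forall>u. n (E u) = u$4" "\<forall>u. n' (E u) = u$5" "\<forall>u. t (E u) + t' (E u) = u$6"
    and span[rule_format]: "\<forall>g. lf g \<longrightarrow> (\<exists>a1 a2 a3 a4 a5 a6.
       \<forall>x. g x = a1 * \<rho> x $ 1 + a2 * \<rho> x $ 2 + a3 * \<rho> x $ 3 + a4 * n x + a5 * n' x + a6 * (t x + t' x))"
    by (rule dual_coordinates[OF lf kr])
  have "lf t" using tr by (simp add: triangular_def)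
  then obtain a1 a2 a3 c d p where
    t: "\<And>x. t x = a1 * \<rho> x $ 1 + a2 * \<rho> x $ 2 + a3 * \<rho> x $ 3 + c * n x + d * n' x + p * (t x + t' x)"
    using span[of t] by metis
  have closed: "t (brac G x y) = 0" "t' (brac G x y) = 0"
    and dn: "n (brac G x y) = t x * n y - t y * n x" "n' (brac G x y) = t' x * n' y - t' y * n' x" for x y
    using tr unfolding triangular_def by blast+
  have C: "a1 * brac sl2 (\<rho> (E u)) (\<rho> (E v)) $ 1 + a2 * brac sl2 (\<rho> (E u)) (\<rho> (E v)) $ 2
      + a3 * brac sl2 (\<rho> (E u)) (\<rho> (E v)) $ 3 + c * (t (E u) * v$4 - t (E v) * u$4)
      + d * (t' (E u) * v$5 - t' (E v) * u$5) = 0" for u v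
    using t[of "brac G (E u) (E v)"] unfolding closed dn sl2_homD(3)[OF hom(1)] E by simp
  note C = C[unfolded brac_sl2 vector_3 E]
  have a: "a1 = 0" "a2 = 0" "a3 = 0"
    using C[of "vec6 0 0 1 0 0 0" "vec6 1 0 0 0 0 0"] C[of "vec6 0 0 1 0 0 0" "vec6 0 1 0 0 0 0"]
      C[of "vec6 1 0 0 0 0 0" "vec6 0 1 0 0 0 0"] by simp_all
  have t: "t x = c * n x + d * n' x + p * (t x + t' x)" for x using t[of x] by (simp add: a)
  have tE: "t (E u) = c * u$4 + d * u$5 + p * u$6" for u
    by (subst t) (simp add: E)
  have tE': "t' (E u) = u$6 - t (E u)" for u using E(6)[of u] by (simp add: algebra_simps)
  have cp: "c * p = 0" "d * (1 - p) = 0"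
    using C[of "vec6 0 0 0 0 0 1" "vec6 0 0 0 1 0 0"] C[of "vec6 0 0 0 0 0 1" "vec6 0 0 0 0 1 0"]
    by (simp_all add: a tE tE')
  have k: "\<rho> x = 0 \<Longrightarrow> n x = 0 \<Longrightarrow> n' x = 0 \<Longrightarrow> t x + t' x = 0 \<Longrightarrow> x = 0" for x
    using kr[of x] by (simp add: vec_eq_iff)
  \<comment> \<open>In the first two cases t is a multiple of n, or t' of n', so that n or n' is
    closed and becomes the last coordinate of \<open>r3 0\<close>. In the third t' is a multiple of
    t, and the ratio is the parameter.\<close>
  consider "p = 0" "d = 0" | "p = 1" "c = 0" | "p \<noteq> 0" "c = 0" "d = 0" using cp by auto
  then show thesis
  proof cases
    case 1
    then have t: "t x = c * n x" for x using t[of x] by simp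
    have "G \<cong>\<^sub>L sl2 \<oplus>\<^sub>L r3 0"
      by (rule sl2_r3_iso[OF sc hom(1) tr(2) lf(4)]) (use k in \<open>auto simp: dn t\<close>)
    then show ?thesis using that[of 0] by simp
  next
    case 2
    then have t: "t' x = - d * n' x" for x using t[of x] unfolding 2 by algebra
    have "G \<cong>\<^sub>L sl2 \<oplus>\<^sub>L r3 0"
      by (rule sl2_r3_iso[OF sc hom(1) tr(1) lf(5)]) (use k in \<open>auto simp: dn t\<close>)
    then show ?thesis using that[of 0] by simp
  next
    case 3
    have t: "t' x = (1 - p) / p * t x" for x
    proof -
      have "t x = p * (t x + t' x)" using t[of x] 3 by simp
      then have "p * t' x = (1 - p) * t x" by algebra
      then show ?thesis using 3(1) by (simp add: field_simps)
    qed
    have "G \<cong>\<^sub>L sl2 \<oplus>\<^sub>L r3 ((1 - p) / p)"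
      by (rule sl2_r3_iso[OF sc hom(1) tr(1) lf(5)]) (use k in \<open>auto simp: dn t algebra_simps\<close>)
    moreover have "(1 - p) / p \<noteq> -1" using 3(1) by (simp add: field_simps)
    ultimately show ?thesis using that by blast
  qed
qed

section \<open>Simplicity of \<open>sl2\<close>, Levi sections and automorphisms\<close>

lemma sl2_ideal:
  assumes add: "\<And>u v. u \<in> I \<Longrightarrow> v \<in> I \<Longrightarrow> u + v \<in> I" and sc: "\<And>c u. u \<in> I \<Longrightarrow> c *s u \<in> I"
    and br: "\<And>u v. v \<in> I \<Longrightarrow> brac sl2 u v \<in> I" and z: "z \<in> I" "z \<noteq> 0"
  shows "I = UNIV"
proof -
  let ?e = "vector [1, 0, 0] :: complex ^ 3" and ?f = "vector [0, 1, 0] :: complex ^ 3"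
    and ?h = "vector [0, 0, 1] :: complex ^ 3"
  have scI: "c *s v = u \<Longrightarrow> v \<in> I \<Longrightarrow> u \<in> I" for c u v using sc by blast
  have from_h: "?e \<in> I" "?f \<in> I" if "?h \<in> I"
    by (rule scI[OF _ br[OF that, of ?e], of "- 1 / 2"], simp add: brac_sl2 vec_eq_iff forall_3)
      (rule scI[OF _ br[OF that, of ?f], of "1 / 2"], simp add: brac_sl2 vec_eq_iff forall_3)
  have "?h \<in> I"
  proof -
    \<comment> \<open>Bracketing twice with f leaves - 2 z1 f, and a further bracket with e gives -
      2 z1 h. With e and f exchanged the result is 2 z2 h.\<close>
    consider "z$1 \<noteq> 0" | "z$2 \<noteq> 0" | "z$1 = 0" "z$2 = 0" "z$3 \<noteq> 0"
      using z(2) by (auto simp: vec_eq_iff forall_3)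
    then show ?thesis
    proof cases
      case 1
      then show ?thesis
        by (intro scI[OF _ br[OF br[OF br[OF z(1), of ?f], of ?f], of ?e], of "- 1 / (2 * z$1)"])
          (simp add: brac_sl2 vec_eq_iff forall_3)
    next
      case 2
      then show ?thesis
        by (intro scI[OF _ br[OF br[OF br[OF z(1), of ?e], of ?e], of ?f], of "1 / (2 * z$2)"])
          (simp add: brac_sl2 vec_eq_iff forall_3)
    next
      case 3
      then show ?thesis by (intro scI[OF _ z(1), of "1 / z$3"]) (simp add: vec_eq_iff forall_3)
    qed
  qed
  moreover have "u = u$1 *s ?e + u$2 *s ?f + u$3 *s ?h" for u by (simp add: vec_eq_iff forall_3)
  ultimately show ?thesis using from_h add sc by (metis UNIV_eq_I)
qed

text \<open>The image lies in a Borel subalgebra, whose commutators are strictly triangular and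
  therefore commute.\<close>

lemma not_surj_double_commutator:
  assumes hom: "sl2_hom G \<sigma>" and ns: "\<not> surj \<sigma>"
  shows "\<sigma> (brac G (brac G a b) (brac G c d)) = 0"
proof -
  obtain p q where pq: "(p, q) \<noteq> (0, 0)" "\<forall>x. polar p q p q (\<sigma> x) = 0"
    by (rule not_surj_eigenvector[OF hom ns])
  obtain r s where d: "p * s - q * r \<noteq> 0"
  proof (cases "p = 0")
    case True
    then show ?thesis using pq(1) by (intro that[of 0 1]) simp
  next
    case False
    then show ?thesis by (intro that[of 1 0]) simp
  qed
  have 1: "polar p q r s (\<sigma> (brac G x y)) = 0" for x y
    using polar_brac(2)[of p s q r "\<sigma> x" "\<sigma> y"] d pq(2) by (simp add: sl2_homD(3)[OF hom])
  show ?thesis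
  proof (rule polar_nondegenerate[OF d])
    let ?A = "brac G a b" and ?B = "brac G c d"
    show "polar r s r s (\<sigma> (brac G ?A ?B)) = 0"
      using polar_brac(3)[of p s q r "\<sigma> ?A" "\<sigma> ?B"] d 1 by (simp add: sl2_homD(3)[OF hom])
  qed (use 1 pq(2) in auto)
qed

text \<open>A Levi section: double commutators span \<open>sl\<^sub>2\<close> but die in every proper image.\<close>

lemma sl2_section:
  fixes G :: "(complex, complex ^ 'n) lie_struct"
  assumes hom: "sl2_hom G \<rho>" and surj: "surj \<rho>"
  obtains s where "\<forall>u v. s (u + v) = s u + s v" "\<forall>c u. s (c *s u) = c *s s u" "\<forall>u. \<rho> (s u) = u"
    "\<forall>\<sigma>. sl2_hom G \<sigma> \<longrightarrow> \<not> surj \<sigma> \<longrightarrow> (\<forall>u. \<sigma> (s u) = 0)"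
proof -
  obtain E where E: "\<rho> E = vector [1, 0, 0]" using surj by (metis surjE)
  obtain F where F: "\<rho> F = vector [0, 1, 0]" using surj by (metis surjE)
  obtain H where H: "\<rho> H = vector [0, 0, 1]" using surj by (metis surjE)
  define b where "b = brac G"
  \<comment> \<open>The double commutators map to [h, 2e] = 4e, [h, -2f] = 4f and [2e, -2f] = -4h,
    which explains the three factors.\<close>
  define A where "A = (1 / 4) *s b (b E F) (b H E)"
  define B where "B = (1 / 4) *s b (b E F) (b H F)"
  define C where "C = (- 1 / 4) *s b (b H E) (b H F)"
  define s where "s u = u$1 *s A + u$2 *s B + u$3 *s C" for u :: "complex ^ 3"
  show thesis
  proof (rule that; intro allI impI)
    show "s (u + v) = s u + s v" for u v
      by (simp add: s_def vec.scale_left_distrib)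
    show "s (c *s u) = c *s s u" for c u
      by (simp add: s_def vec.scale_right_distrib vector_smult_assoc mult.assoc)
    show "\<rho> (s u) = u" for u
      by (simp add: s_def A_def B_def C_def b_def sl2_homD[OF hom] E F H brac_sl2 vec_eq_iff forall_3)
    show "\<sigma> (s u) = 0" if "sl2_hom G \<sigma>" "\<not> surj \<sigma>" for \<sigma> u
      using that by (simp add: s_def A_def B_def C_def b_def sl2_homD(1,2,4)[OF that(1)] not_surj_double_commutator)
  qed
qed

text \<open>The vectors a, b, h are the images of e, f, h, and the relations of \<open>sl2\<close>
  are recorded as polynomial equations for the determinant computation. The last equation says that
  h squares to 1 as a matrix; it follows from the others because surjectivity prevents a =
  0.\<close>

lemma sl2_endo:
  assumes hom: "sl2_hom sl2 \<theta>" and surj: "surj \<theta>"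
  shows "\<exists>a b h. (\<forall>u. \<theta> u = u$1 *s a + u$2 *s b + u$3 *s h) \<and>
    h$1 = 2 * (a$3 * b$1 - a$1 * b$3) \<and> h$2 = 2 * (a$2 * b$3 - a$3 * b$2) \<and> h$3 = a$1 * b$2 - a$2 * b$1 \<and>
    a$1 = h$3 * a$1 - h$1 * a$3 \<and> a$2 = h$2 * a$3 - h$3 * a$2 \<and> 2 * a$3 = h$1 * a$2 - h$2 * a$1 \<and>
    - b$1 = h$3 * b$1 - h$1 * b$3 \<and> - b$2 = h$2 * b$3 - h$3 * b$2 \<and> - 2 * b$3 = h$1 * b$2 - h$2 * b$1 \<and>
    h$1 * h$2 + h$3 * h$3 = 1"
proof -
  let ?e = "vector [1, 0, 0] :: complex ^ 3" and ?f = "vector [0, 1, 0] :: complex ^ 3"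
    and ?h = "vector [0, 0, 1] :: complex ^ 3"
  define a b h where abh: "a = \<theta> ?e" "b = \<theta> ?f" "h = \<theta> ?h"
  have br: "brac sl2 ?e ?f = ?h" "brac sl2 ?h ?e = 2 *s ?e" "brac sl2 ?h ?f = (- 2) *s ?f"
    by (simp_all add: brac_sl2 vec_eq_iff forall_3)
  have 1: "h = brac sl2 a b" "2 *s a = brac sl2 h a" "(- 2) *s b = brac sl2 h b"
    unfolding abh sl2_homD(2,3)[OF hom, symmetric] br by simp_all
  have u: "\<theta> u = u$1 *s a + u$2 *s b + u$3 *s h" for u
  proof -
    have "u = u$1 *s ?e + u$2 *s ?f + u$3 *s ?h" by (simp add: vec_eq_iff forall_3)
    then show ?thesis unfolding abh sl2_homD(1,2)[OF hom, symmetric] by simp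
  qed
  have rel: "h$1 = 2 * (a$3 * b$1 - a$1 * b$3)" "h$2 = 2 * (a$2 * b$3 - a$3 * b$2)" "h$3 = a$1 * b$2 - a$2 * b$1"
    "a$1 = h$3 * a$1 - h$1 * a$3" "a$2 = h$2 * a$3 - h$3 * a$2" "2 * a$3 = h$1 * a$2 - h$2 * a$1"
    "- b$1 = h$3 * b$1 - h$1 * b$3" "- b$2 = h$2 * b$3 - h$3 * b$2" "- 2 * b$3 = h$1 * b$2 - h$2 * b$1"
  proof -
    have 2: "h = vector [2 * (a$3 * b$1 - a$1 * b$3), 2 * (a$2 * b$3 - a$3 * b$2), a$1 * b$2 - a$2 * b$1]"
      "2 *s a = vector [2 * (h$3 * a$1 - h$1 * a$3), 2 * (h$2 * a$3 - h$3 * a$2), h$1 * a$2 - h$2 * a$1]"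
      "(- 2) *s b = vector [2 * (h$3 * b$1 - h$1 * b$3), 2 * (h$2 * b$3 - h$3 * b$2), h$1 * b$2 - h$2 * b$1]"
      using 1 unfolding brac_sl2 .
    show "h$1 = 2 * (a$3 * b$1 - a$1 * b$3)" "h$2 = 2 * (a$2 * b$3 - a$3 * b$2)" "h$3 = a$1 * b$2 - a$2 * b$1"
      by (subst 2(1), simp)+
    note c = arg_cong[where f = "\<lambda>w. w$1"] arg_cong[where f = "\<lambda>w. w$2"] arg_cong[where f = "\<lambda>w. w$3"]
    note 3 = c[OF 2(2), unfolded vector_3 vector_smult_component] c[OF 2(3), unfolded vector_3 vector_smult_component]
    show "a$1 = h$3 * a$1 - h$1 * a$3" "a$2 = h$2 * a$3 - h$3 * a$2" "2 * a$3 = h$1 * a$2 - h$2 * a$1"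
      "- b$1 = h$3 * b$1 - h$1 * b$3" "- b$2 = h$2 * b$3 - h$3 * b$2"
      using 3(1) 3(2) 3(3) 3(4) 3(5) by algebra+
    show "- 2 * b$3 = h$1 * b$2 - h$2 * b$1" by (rule 3(6))
  qed
  have "a \<noteq> 0"
  proof
    assume "a = 0"
    then have "b = 0" "h = 0" using rel by (simp_all add: vec_eq_iff forall_3)
    with \<open>a = 0\<close> u have "\<theta> v = 0" for v by simp
    moreover obtain v where "\<theta> v = ?e" using surj by (metis surjE)
    ultimately show False by (simp add: vec_eq_iff forall_3)
  qed
  moreover have "(h$1 * h$2 + h$3 * h$3 - 1) * a$1 = 0" "(h$1 * h$2 + h$3 * h$3 - 1) * a$2 = 0"
    "(h$1 * h$2 + h$3 * h$3 - 1) * a$3 = 0"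
    using rel(4-6) by algebra+
  ultimately have "h$1 * h$2 + h$3 * h$3 = 1" by (auto simp: vec_eq_iff forall_3)
  with u rel show ?thesis by blast
qed

text \<open>An automorphism of \<open>sl\<^sub>2\<close> is its own cofactor matrix up to the invariant form, so in
  \<open>det (\<theta> - \<eta>)\<close> the mixed terms cancel, leaving \<open>det \<theta> - det \<eta> = 0\<close>.\<close>

lemma sl2_automorphism_diff:
  assumes hom: "sl2_hom sl2 \<theta>" "sl2_hom sl2 \<eta>" and surj: "surj \<theta>" "surj \<eta>"
  shows "\<not> surj (\<lambda>u. \<theta> u - \<eta> u)"
proof -
  obtain a b h where u: "\<And>u. \<theta> u = u$1 *s a + u$2 *s b + u$3 *s h" and
    r: "h$1 = 2 * (a$3 * b$1 - a$1 * b$3)" "h$2 = 2 * (a$2 * b$3 - a$3 * b$2)" "h$3 = a$1 * b$2 - a$2 * b$1"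
    "a$1 = h$3 * a$1 - h$1 * a$3" "a$2 = h$2 * a$3 - h$3 * a$2" "2 * a$3 = h$1 * a$2 - h$2 * a$1"
    "- b$1 = h$3 * b$1 - h$1 * b$3" "- b$2 = h$2 * b$3 - h$3 * b$2" "- 2 * b$3 = h$1 * b$2 - h$2 * b$1"
    "h$1 * h$2 + h$3 * h$3 = 1"
    using sl2_endo[OF hom(1) surj(1)] by blast
  obtain a' b' h' where u': "\<And>u. \<eta> u = u$1 *s a' + u$2 *s b' + u$3 *s h'" and
    r': "h'$1 = 2 * (a'$3 * b'$1 - a'$1 * b'$3)" "h'$2 = 2 * (a'$2 * b'$3 - a'$3 * b'$2)" "h'$3 = a'$1 * b'$2 - a'$2 * b'$1"
    "a'$1 = h'$3 * a'$1 - h'$1 * a'$3" "a'$2 = h'$2 * a'$3 - h'$3 * a'$2" "2 * a'$3 = h'$1 * a'$2 - h'$2 * a'$1"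
    "- b'$1 = h'$3 * b'$1 - h'$1 * b'$3" "- b'$2 = h'$2 * b'$3 - h'$3 * b'$2" "- 2 * b'$3 = h'$1 * b'$2 - h'$2 * b'$1"
    "h'$1 * h'$2 + h'$3 * h'$3 = 1"
    using sl2_endo[OF hom(2) surj(2)] by blast
  define tp where "tp u v w = u$1 * (v$2 * w$3 - v$3 * w$2) + u$2 * (v$3 * w$1 - v$1 * w$3)
     + u$3 * (v$1 * w$2 - v$2 * w$1)" for u v w :: "complex ^ 3"
  have ex: "tp (a - a') (b - b') (h - h') = tp a b h - tp a b h' - tp a b' h - tp a' b h
      + tp a b' h' + tp a' b h' + tp a' b' h - tp a' b' h'"
    by (simp add: tp_def algebra_simps)
  \<comment> \<open>\<open>tp\<close> is the determinant of three columns. These identities say that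
    the cross product of two images is the third image seen through the invariant form.\<close>
  have "2 * tp a b w = h$2 * w$1 + h$1 * w$2 + 2 * h$3 * w$3"
    "2 * tp a' b' w = h'$2 * w$1 + h'$1 * w$2 + 2 * h'$3 * w$3"
    "tp a w h = a$2 * w$1 + a$1 * w$2 + 2 * a$3 * w$3"
    "tp a' w h' = a'$2 * w$1 + a'$1 * w$2 + 2 * a'$3 * w$3"
    "tp w b h = b$2 * w$1 + b$1 * w$2 + 2 * b$3 * w$3"
    "tp w b' h' = b'$2 * w$1 + b'$1 * w$2 + 2 * b'$3 * w$3" for w
    unfolding tp_def using r(1-3) r'(1-3) r(4-9) r'(4-9) by algebra+
  note T = this
  \<comment> \<open>Both pure terms equal 1. By symmetry of the invariant form the mixed terms agree
    in pairs that carry opposite signs in \<open>ex\<close>.\<close>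
  have "2 * tp a b h = 2 * tp a' b' h'"
    unfolding T(1,2) using r(10) r'(10) by algebra
  moreover have "2 * tp a b h' = 2 * tp a' b' h" unfolding T(1,2) by (simp add: mult_ac)
  moreover have "tp a b' h = tp a b' h'" unfolding T(3,6) by (simp add: mult_ac)
  moreover have "tp a' b h = tp a' b h'" unfolding T(4,5) by (simp add: mult_ac)
  ultimately have "2 * tp (a - a') (b - b') (h - h') = 0"
    unfolding ex by (simp add: algebra_simps)
  then have det0: "tp (a - a') (b - b') (h - h') = 0" by simp
  define A :: "complex ^ 3 ^ 3" where "A = (\<chi> i j. if j = 1 then (a - a')$i else if j = 2 then (b - b')$i else (h - h')$i)"
  have Av: "A *v w = \<theta> w - \<eta> w" for w
    by (simp add: A_def matrix_vector_mult_def u u' vec_eq_iff sum_3 algebra_simps)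
  have "det A = tp (a - a') (b - b') (h - h')" by (simp add: A_def det_3 tp_def algebra_simps)
  then have "\<not> invertible A" using det0 by (simp add: invertible_det_nz)
  then have "\<not> (\<forall>y. \<exists>x. A *v x = y)"
    by (metis invertible_right_inverse matrix_right_invertible_surjective surj_def)
  then show ?thesis unfolding Av surj_def by metis
qed

text \<open>By \<open>kill\<close>, \<sigma> factors through \<rho>, and composing \<sigma> with the
  section \<open>s\<close> gives the induced endomorphism of \<open>sl2\<close>.\<close>

lemma sl2_hom_factor:
  assumes hom: "sl2_hom G \<rho>" "sl2_hom G \<sigma>"
    and s: "\<forall>u v. s (u + v) = s u + s v" "\<forall>c u. s (c *s u) = c *s s u" "\<forall>u. \<rho> (s u) = u"
    and kill: "\<forall>k. \<rho> k = 0 \<longrightarrow> \<sigma> k = 0"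
  shows "\<sigma> x = \<sigma> (s (\<rho> x))" "sl2_hom sl2 (\<lambda>u. \<sigma> (s u))" "surj \<sigma> \<Longrightarrow> surj (\<lambda>u. \<sigma> (s u))"
proof -
  have eq: "\<sigma> x = \<sigma> y" if "\<rho> x = \<rho> y" for x y
    using kill[rule_format, of "x - y"] that by (simp add: sl2_homD(4)[OF hom(1)] sl2_homD(4)[OF hom(2)])
  show f: "\<sigma> x = \<sigma> (s (\<rho> x))" for x by (rule eq) (simp add: s(3))
  have "\<sigma> (s (brac sl2 u v)) = brac sl2 (\<sigma> (s u)) (\<sigma> (s v))" for u v
    unfolding sl2_homD(3)[OF hom(2), symmetric] by (rule eq) (simp add: sl2_homD(3)[OF hom(1)] s(3))
  then show "sl2_hom sl2 (\<lambda>u. \<sigma> (s u))" unfolding sl2_hom_def by (simp add: s(1,2) sl2_homD(1,2)[OF hom(2)])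
  show "surj (\<lambda>u. \<sigma> (s u))" if "surj \<sigma>" using that f by (metis surj_def)
qed

text \<open>As \<sigma> is onto, it maps the kernel of \<rho> onto an ideal, which is nonzero
  because of \<open>k\<close> and hence all of \<open>sl2\<close>. So the pair of \<rho> and
  \<sigma> is onto, and bijective by dimension.\<close>

lemma sl2_sl2_iso:
  fixes G :: "(complex, complex ^ 6) lie_struct"
  assumes sc: "scal G = (*s)" and hom: "sl2_hom G \<rho>" "sl2_hom G \<sigma>" and surj: "surj \<rho>" "surj \<sigma>"
    and k: "\<rho> k = 0" "\<sigma> k \<noteq> 0"
  shows "G \<cong>\<^sub>L sl2 \<oplus>\<^sub>L sl2"
proof (rule iso_of_bij_pair[where f = \<rho> and g = \<sigma>])
  define I where "I = \<sigma> ` {x. \<rho> x = 0}"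
  have "I = UNIV"
  proof (rule sl2_ideal)
    show "u + v \<in> I" if "u \<in> I" "v \<in> I" for u v
    proof -
      obtain x y where "\<rho> x = 0" "\<rho> y = 0" "u = \<sigma> x" "v = \<sigma> y" using \<open>u \<in> I\<close> \<open>v \<in> I\<close> by (auto simp: I_def)
      then have "u + v = \<sigma> (x + y)" "\<rho> (x + y) = 0" by (simp_all add: hom[THEN sl2_homD(1)])
      then show ?thesis by (auto simp: I_def)
    qed
    show "c *s u \<in> I" if "u \<in> I" for c u
    proof -
      obtain x where "\<rho> x = 0" "u = \<sigma> x" using \<open>u \<in> I\<close> by (auto simp: I_def)
      then have "c *s u = \<sigma> (c *s x)" "\<rho> (c *s x) = 0" by (simp_all add: hom[THEN sl2_homD(2)])
      then show ?thesis by (auto simp: I_def)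
    qed
    show "brac sl2 u v \<in> I" if "v \<in> I" for u v
    proof -
      obtain x where x: "\<rho> x = 0" "v = \<sigma> x" using \<open>v \<in> I\<close> by (auto simp: I_def)
      obtain y where y: "u = \<sigma> y" using surj(2) by (metis surjE)
      have "brac sl2 u v = \<sigma> (brac G y x)" "\<rho> (brac G y x) = 0"
        using x y by (simp_all add: hom[THEN sl2_homD(3)]) (simp add: brac_sl2 vec_eq_iff forall_3)
      then show ?thesis by (auto simp: I_def)
    qed
    show "\<sigma> k \<in> I" "\<sigma> k \<noteq> 0" using k by (auto simp: I_def)
  qed
  show "bij (\<lambda>x. (\<rho> x, \<sigma> x))"
  proof (rule bij_pair_of_surj)
    fix u v
    obtain x where x: "\<rho> x = u" using surj(1) by (metis surjE)
    have "v - \<sigma> x \<in> I" using \<open>I = UNIV\<close> by simp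
    then obtain y where "\<rho> y = 0" "\<sigma> y = v - \<sigma> x" by (auto simp: I_def)
    then have "\<rho> (x + y) = u \<and> \<sigma> (x + y) = v" using x by (simp add: hom[THEN sl2_homD(1)])
    then show "\<exists>x. \<rho> x = u \<and> \<sigma> x = v" by blast
  qed (simp_all add: hom[THEN sl2_homD(1)] hom[THEN sl2_homD(2)])
qed (simp_all add: sc hom[THEN sl2_homD(1)] hom[THEN sl2_homD(2)] hom[THEN sl2_homD(3)])

text \<open>Here \<rho>2 is \<rho>1 followed by an automorphism \<theta>. Thus \<rho>1 splits off
  \<open>sl2\<close>, while \<rho>3 followed by \<theta>, together with \<rho>4, is the pair
  describing the solvable part.\<close>

lemma listed_mixed:
  fixes G :: "(complex, complex ^ 6) lie_struct"
  assumes sc: "scal G = (*s)"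
    and hom: "sl2_hom G \<rho>1" "sl2_hom G \<rho>2" "sl2_hom G \<rho>3" "sl2_hom G \<rho>4"
    and ker: "\<forall>x. \<rho>1 x = \<rho>3 x \<longrightarrow> \<rho>2 x = \<rho>4 x \<longrightarrow> x = 0"
    and s: "\<forall>u v. s (u + v) = s u + s v" "\<forall>c u. s (c *s u) = c *s s u" "\<forall>u. \<rho>1 (s u) = u"
    "\<forall>\<sigma>. sl2_hom G \<sigma> \<longrightarrow> \<not> surj \<sigma> \<longrightarrow> (\<forall>u. \<sigma> (s u) = 0)"
    and ns: "\<not> surj \<rho>3" "\<not> surj \<rho>4" and surj: "surj \<rho>2" and kill: "\<forall>k. \<rho>1 k = 0 \<longrightarrow> \<rho>2 k = 0"
  shows "listed G"
proof -
  define \<theta> where "\<theta> u = \<rho>2 (s u)" for u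
  note f = sl2_hom_factor[OF hom(1,2) s(1-3) kill, folded \<theta>_def]
  note th = sl2_homD[OF f(2)]
  have inj: "inj \<theta>" by (rule inj_of_surj) (simp_all add: th f(3) surj)
  have hom': "sl2_hom G (\<lambda>x. \<theta> (\<rho>3 x))"
    unfolding sl2_hom_def by (simp add: sl2_homD[OF hom(3)] th)
  have ns': "\<not> surj (\<lambda>x. \<theta> (\<rho>3 x))"
  proof
    assume *: "surj (\<lambda>x. \<theta> (\<rho>3 x))"
    have "\<exists>x. u = \<rho>3 x" for u using surjD[OF *, of "\<theta> u"] inj by (auto dest: injD)
    then show False using ns(1) unfolding surj_def by blast
  qed
  obtain l where "l \<noteq> -1" "G \<cong>\<^sub>L sl2 \<oplus>\<^sub>L r3 l"
  proof (rule sl2_r3_of_pair[OF sc hom(1) hom' hom(4) ns' ns(2)])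
    fix x assume x: "\<rho>1 x = 0" "\<theta> (\<rho>3 x) = \<rho>4 x"
    \<comment> \<open>The correction by the section makes \<rho>1 agree with \<rho>3 and leaves
      \<rho>3 and \<rho>4 unchanged, since both vanish on the section. Then \<open>ker\<close>
      applies to y.\<close>
    define y where "y = x + s (\<rho>3 x)"
    have "\<rho>3 (s u) = 0" "\<rho>4 (s u) = 0" for u using s(4) hom(3,4) ns by blast+
    then have "\<rho>1 y = \<rho>3 x" "\<rho>3 y = \<rho>3 x" "\<rho>2 y = \<rho>4 y"
      using x kill s(3) by (simp_all add: y_def hom[THEN sl2_homD(1)] \<theta>_def)
    then have "y = 0" using ker by simp
    then have "\<rho>3 x = 0" using \<open>\<rho>1 y = \<rho>3 x\<close> sl2_homD(5)[OF hom(1)] by simp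
    moreover have "s 0 = 0" using s(2)[rule_format, of 0 0] by simp
    ultimately show "x = 0" using \<open>y = 0\<close> by (simp add: y_def)
  qed blast
  then show ?thesis by (rule listedI(2))
qed

text \<open>If some surjective homomorphism to \<open>sl2\<close> does not vanish on the kernel of
  \<rho>1, then \<open>G\<close> is two copies of \<open>sl2\<close>. Otherwise every surjective one
  factors through \<rho>1, and two of them cannot have a surjective difference, since it would come
  from a difference of automorphisms. So \<rho>3 is not onto, and at most one of \<rho>2, \<rho>4
  is.\<close>

proposition listed_not_solvable:
  fixes G :: "(complex, complex ^ 6) lie_struct"
  assumes sc: "scal G = (*s)"
    and hom: "sl2_hom G \<rho>1" "sl2_hom G \<rho>2" "sl2_hom G \<rho>3" "sl2_hom G \<rho>4"
    and ker: "\<forall>x. \<rho>1 x = \<rho>3 x \<longrightarrow> \<rho>2 x = \<rho>4 x \<longrightarrow> x = 0"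
    and surj: "surj \<rho>1"
  shows "listed G"
proof (cases "\<exists>\<sigma> k. sl2_hom G \<sigma> \<and> surj \<sigma> \<and> \<rho>1 k = 0 \<and> \<sigma> k \<noteq> 0")
  case True
  then show ?thesis using sl2_sl2_iso[OF sc hom(1) _ surj] listedI(1) by blast
next
  case False
  then have kill: "\<forall>k. \<rho>1 k = 0 \<longrightarrow> \<sigma> k = 0" if "sl2_hom G \<sigma>" "surj \<sigma>" for \<sigma> using that by blast
  obtain s where s: "\<forall>u v. s (u + v) = s u + s v" "\<forall>c u. s (c *s u) = c *s s u" "\<forall>u. \<rho>1 (s u) = u"
    "\<forall>\<sigma>. sl2_hom G \<sigma> \<longrightarrow> \<not> surj \<sigma> \<longrightarrow> (\<forall>u. \<sigma> (s u) = 0)"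
    by (rule sl2_section[OF hom(1) surj])
  have no_pair: False
    if "sl2_hom G \<sigma>" "sl2_hom G \<sigma>'" "surj \<sigma>" "surj \<sigma>'" and d: "\<forall>y. \<exists>x. \<sigma> x - \<sigma>' x = y" for \<sigma> \<sigma>'
  proof -
    note f = sl2_hom_factor[OF hom(1) that(1) s(1-3) kill[OF that(1,3)]]
    note f' = sl2_hom_factor[OF hom(1) that(2) s(1-3) kill[OF that(2,4)]]
    have "\<not> surj (\<lambda>u. \<sigma> (s u) - \<sigma>' (s u))"
      by (rule sl2_automorphism_diff[OF f(2) f'(2) f(3)[OF that(3)] f'(3)[OF that(4)]])
    then obtain y where y: "\<And>u. y \<noteq> \<sigma> (s u) - \<sigma>' (s u)" unfolding surj_def by blast
    obtain x where "\<sigma> x - \<sigma>' x = y" using d by blast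
    then have "y = \<sigma> (s (\<rho>1 x)) - \<sigma>' (s (\<rho>1 x))" using f(1)[of x] f'(1)[of x] by simp
    then show False using y by blast
  qed
  have d: "\<forall>y. \<exists>x. \<rho>1 x - \<rho>3 x = y" "\<forall>y. \<exists>x. \<rho>2 x - \<rho>4 x = y"
    using diff_pair_surj[OF hom ker] by blast+
  have ns3: "\<not> surj \<rho>3" using no_pair[OF hom(1,3) surj _ d(1)] by blast
  have ns24: "\<not> surj \<rho>2 \<or> \<not> surj \<rho>4" using no_pair[OF hom(2,4) _ _ d(2)] by blast
  have ker': "\<forall>x. \<rho>1 x = \<rho>3 x \<longrightarrow> \<rho>4 x = \<rho>2 x \<longrightarrow> x = 0" using ker by metis
  consider "surj \<rho>2" "\<not> surj \<rho>4" | "surj \<rho>4" "\<not> surj \<rho>2" | "\<not> surj \<rho>2" "\<not> surj \<rho>4" using ns24 by blast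
  then show ?thesis
  proof cases
    case 1
    then show ?thesis using listed_mixed[OF sc hom ker s ns3 1(2,1) kill[OF hom(2) 1(1)]] by blast
  next
    case 2
    then show ?thesis
      using listed_mixed[OF sc hom(1,4,3,2) ker' s ns3 2(2,1) kill[OF hom(4) 2(1)]] by blast
  next
    case 3
    obtain l where "l \<noteq> -1" "G \<cong>\<^sub>L sl2 \<oplus>\<^sub>L r3 l"
    proof (rule sl2_r3_of_pair[OF sc hom(1,2,4) 3])
      fix x assume x: "\<rho>1 x = 0" "\<rho>2 x = \<rho>4 x"
      define y where "y = x + s (\<rho>3 x)"
      have "\<rho>2 (s u) = 0" "\<rho>3 (s u) = 0" "\<rho>4 (s u) = 0" for u using s(4) hom ns3 3 by blast+
      then have "\<rho>1 y = \<rho>3 x" "\<rho>3 y = \<rho>3 x" "\<rho>2 y = \<rho>4 y"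
        using x s(3) by (simp_all add: y_def hom[THEN sl2_homD(1)])
      then have "y = 0" using ker by simp
      then have "\<rho>3 x = 0" using \<open>\<rho>1 y = \<rho>3 x\<close> sl2_homD(5)[OF hom(1)] by simp
      moreover have "s 0 = 0" using s(2)[rule_format, of 0 0] by simp
      ultimately show "x = 0" using \<open>y = 0\<close> by (simp add: y_def)
    qed blast
    then show ?thesis by (rule listedI(2))
  qed
qed

text \<open>The hypotheses are symmetric under exchanging within or between the pairs (\<rho>1,
  \<rho>3) and (\<rho>2, \<rho>4), so any surjective one may be put first.\<close>

proposition listed_of_homs:
  fixes G :: "(complex, complex ^ 6) lie_struct"
  assumes sc: "scal G = (*s)"
    and hom: "sl2_hom G \<rho>1" "sl2_hom G \<rho>2" "sl2_hom G \<rho>3" "sl2_hom G \<rho>4"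
    and ker: "\<forall>x. \<rho>1 x = \<rho>3 x \<longrightarrow> \<rho>2 x = \<rho>4 x \<longrightarrow> x = 0"
  shows "listed G"
proof -
  have k: "\<forall>x. \<rho>3 x = \<rho>1 x \<longrightarrow> \<rho>2 x = \<rho>4 x \<longrightarrow> x = 0" "\<forall>x. \<rho>2 x = \<rho>4 x \<longrightarrow> \<rho>1 x = \<rho>3 x \<longrightarrow> x = 0"
    "\<forall>x. \<rho>4 x = \<rho>2 x \<longrightarrow> \<rho>1 x = \<rho>3 x \<longrightarrow> x = 0" using ker by metis+
  show ?thesis
    using listed_not_solvable[OF sc hom ker] listed_not_solvable[OF sc hom(3,2,1,4) k(1)]
      listed_not_solvable[OF sc hom(2,1,4,3) k(2)] listed_not_solvable[OF sc hom(4,1,2,3) k(3)]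
      listed_solvable[OF sc hom ker] by blast
qed

section \<open>Post-Lie structures as pairs of homomorphisms\<close>

lemma sl2_perfect:
  assumes lin: "\<And>u v. d (u + v) = d u + d v" "\<And>c u. d (c *s u) = c *s d u"
    and br: "\<And>u v. d (brac sl2 u v) = (0 :: complex ^ 3)"
  shows "d u = 0"
proof -
  let ?e = "vector [1, 0, 0] :: complex ^ 3" and ?f = "vector [0, 1, 0] :: complex ^ 3"
    and ?h = "vector [0, 0, 1] :: complex ^ 3"
  have "u = (u$1 / 2) *s brac sl2 ?h ?e + (- u$2 / 2) *s brac sl2 ?h ?f + u$3 *s brac sl2 ?e ?f"
    by (simp add: brac_sl2 vec_eq_iff forall_3)
  then have "d u = d ((u$1 / 2) *s brac sl2 ?h ?e + (- u$2 / 2) *s brac sl2 ?h ?f + u$3 *s brac sl2 ?e ?f)"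
    by simp
  also have "\<dots> = 0" unfolding lin br by simp
  finally show ?thesis .
qed

text \<open>The element whose adjoint map is \<open>d\<close>, read off from two values: ad a sends
  e to (2 a3, 0, - a2), and its value at f has third coordinate a1.\<close>

definition sl2_inner :: "(complex ^ 3 \<Rightarrow> complex ^ 3) \<Rightarrow> complex ^ 3" where
  "sl2_inner d = vector [d (vector [0, 1, 0]) $ 3, - d (vector [1, 0, 0]) $ 3, d (vector [1, 0, 0]) $ 1 / 2]"

lemma sl2_derivation_inner:
  assumes lin: "\<And>u v. d (u + v) = d u + d v" "\<And>c u. d (c *s u) = c *s d u"
    and der: "\<And>u v. d (brac sl2 u v) = brac sl2 (d u) v + brac sl2 u (d v)"
  shows "d u = brac sl2 (sl2_inner d) u"
proof -
  let ?e = "vector [1, 0, 0] :: complex ^ 3" and ?f = "vector [0, 1, 0] :: complex ^ 3"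
    and ?h = "vector [0, 0, 1] :: complex ^ 3"
  have br: "brac sl2 ?e ?f = ?h" "brac sl2 ?h ?e = 2 *s ?e" "brac sl2 ?h ?f = (- 2) *s ?f"
    by (simp_all add: brac_sl2 vec_eq_iff forall_3)
  note D = der[of ?e ?f, unfolded br] der[of ?h ?e, unfolded br lin] der[of ?h ?f, unfolded br lin]
  have r: "d ?h $ 1 = - 2 * d ?f $ 3" "d ?h $ 2 = - 2 * d ?e $ 3" "d ?h $ 3 = 0"
    "d ?e $ 2 = 0" "d ?f $ 1 = 0" "d ?f $ 2 = - d ?e $ 1"
    using D by (auto simp: brac_sl2 vec_eq_iff forall_3 algebra_simps)
  have "u = u$1 *s ?e + u$2 *s ?f + u$3 *s ?h" by (simp add: vec_eq_iff forall_3)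
  then have "d u = d (u$1 *s ?e + u$2 *s ?f + u$3 *s ?h)" by simp
  also have "\<dots> = u$1 *s d ?e + u$2 *s d ?f + u$3 *s d ?h" unfolding lin ..
  also have "\<dots> = brac sl2 (sl2_inner d) u"
    by (simp add: vec_eq_iff forall_3 brac_sl2 sl2_inner_def r algebra_simps)
  finally show ?thesis .
qed

lemma brac_sl2_bilinear:
  "brac sl2 (u + v) w = brac sl2 u w + brac sl2 v w" "brac sl2 u (v + w) = brac sl2 u v + brac sl2 u w"
  "brac sl2 (u - v) w = brac sl2 u w - brac sl2 v w" "brac sl2 u (v - w) = brac sl2 u v - brac sl2 u w"
  "brac sl2 (c *s u) v = c *s brac sl2 u v" "brac sl2 u (c *s v) = c *s brac sl2 u v"
  "brac sl2 0 u = 0" "brac sl2 u 0 = 0"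
  by (simp_all add: brac_sl2 vec_eq_iff forall_3 algebra_simps)

lemma sl2_centerless:
  assumes "\<And>v. brac sl2 u v = 0"
  shows "u = 0"
  using assms[of "vector [1, 0, 0]"] assms[of "vector [0, 1, 0]"]
  by (simp add: brac_sl2 vec_eq_iff forall_3)

lemma sl2_jacobi: "brac sl2 u (brac sl2 v w) - brac sl2 v (brac sl2 u w) = brac sl2 (brac sl2 u v) w"
  by (simp add: brac_sl2 vec_eq_iff forall_3 algebra_simps)

lemma sl2_skew: "brac sl2 u v = - brac sl2 v u"
  by (simp add: brac_sl2 vec_eq_iff forall_3 algebra_simps)

text \<open>The component in one \<open>sl\<^sub>2\<close>-summand of the operator \<open>R\<close> with \<open>x \<cdot> y = {R x, y}\<close>.\<close>

lemma post_lie_component: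
  fixes N :: "(complex, 'v::ab_group_add) lie_struct" and \<pi> :: "'v \<Rightarrow> complex ^ 3"
  assumes pl: "post_lie G N p"
    and \<pi>: "\<And>x y. \<pi> (x + y) = \<pi> x + \<pi> y" "\<And>c x. \<pi> (scal N c x) = c *s \<pi> x"
      "\<And>x y. \<pi> (brac N x y) = brac sl2 (\<pi> x) (\<pi> y)"
    and i: "\<And>u v. i (u + v) = i u + i v" "\<And>c u. i (c *s u) = scal N c (i u)"
      "\<And>u v. i (brac sl2 u v) = brac N (i u) (i v)"
    and j: "\<And>u v. j (u + v) = j u + j v" "\<And>c u. j (c *s u) = scal N c (j u)"
      "\<And>u v. j (brac sl2 u v) = brac N (j u) (j v)"
    and dec: "\<And>u. \<pi> (i u) = u" "\<And>u. \<pi> (j u) = 0" "\<And>x. \<exists>u v. x = i u + j v"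
  obtains R where "\<forall>x y. R (x + y) = R x + R y" "\<forall>c x. R (scal N c x) = c *s R x"
    "\<forall>x y. R (brac G x y) = brac sl2 (R x) (R y)"
    "\<forall>x y. R (brac G x y) + \<pi> (brac G x y) = brac sl2 (R x + \<pi> x) (R y + \<pi> y)"
proof -
  have bil: "bilinear_op (scal N) p" and p1: "p x y - p y x = brac G x y - brac N x y"
    and p2: "p (brac G x y) z = p x (p y z) - p y (p x z)"
    and p3: "p x (brac N y z) = brac N (p x y) z + brac N y (p x z)" for x y z
    using pl unfolding post_lie_def by blast+
  have pr: "p x (y + z) = p x y + p x z" "p x (scal N c y) = scal N c (p x y)"
    and pl: "p (x + y) z = p x z + p y z" "p (scal N c x) z = scal N c (p x z)" for x y z c
    using bil unfolding bilinear_op_def linear_iff by blast+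
  define d where "d x u = \<pi> (p x (i u))" for x u
  define R where "R x = sl2_inner (d x)" for x
  have d: "d x u = brac sl2 (R x) u" for x u
    unfolding R_def
    by (rule sl2_derivation_inner) (simp_all add: d_def i pr \<pi> p3 dec)
  \<comment> \<open>There is no component from the other summand: on a bracket of that summand the
    derivation rule yields terms with a factor of zero \<pi>-component, and the summand is
    perfect.\<close>
  have z: "\<pi> (p x (j u)) = 0" for x u
  proof (rule sl2_perfect[where d = "\<lambda>u. \<pi> (p x (j u))"])
    show "\<pi> (p x (j (brac sl2 u v))) = 0" for u v
      unfolding j p3 \<pi> dec brac_sl2_bilinear by simp
  qed (simp_all add: j pr \<pi>)
  have R: "\<pi> (p x y) = brac sl2 (R x) (\<pi> y)" for x y
  proof -
    obtain u v where y: "y = i u + j v" using dec(3) by blast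
    show ?thesis using d[of x u] by (simp add: y pr \<pi> z dec d_def)
  qed
  \<comment> \<open>Axiom (ii) shows that both sides have the same adjoint action, and the center of
    \<open>sl2\<close> is trivial.\<close>
  have hom: "R (brac G x y) = brac sl2 (R x) (R y)" for x y
  proof -
    have "brac sl2 (R (brac G x y) - brac sl2 (R x) (R y)) u = 0" for u
    proof -
      have "brac sl2 (R (brac G x y)) u = \<pi> (p (brac G x y) (i u))" by (simp add: R dec)
      also have "\<dots> = \<pi> (p x (p y (i u)) - p y (p x (i u)))" by (simp only: p2)
      also have "\<dots> = \<pi> (p x (p y (i u))) - \<pi> (p y (p x (i u)))"
        using \<pi>(1)[of "p x (p y (i u)) - p y (p x (i u))" "p y (p x (i u))"] by simp
      also have "\<dots> = brac sl2 (brac sl2 (R x) (R y)) u" by (simp add: R dec sl2_jacobi)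
      finally show ?thesis by (simp add: brac_sl2_bilinear)
    qed
    then show ?thesis using sl2_centerless by fastforce
  qed
  have lin: "R (x + y) = R x + R y" "R (scal N c x) = c *s R x" for x y c
    unfolding R_def sl2_inner_def d_def pl \<pi> by (simp_all add: vec_eq_iff forall_3 algebra_simps add_divide_distrib)
  show thesis
  proof (rule that[of R]; intro allI)
    fix x y
    \<comment> \<open>By axiom (i) the \<pi>-component of the bracket of \<open>G\<close> consists
      of the three terms that complete [R x, R y] to [R x + \<pi> x, R y + \<pi> y].\<close>
    have "brac G x y = p x y + brac N x y - p y x" using p1[of x y] by (simp add: algebra_simps)
    then have "brac G x y + p y x = p x y + brac N x y" by simp
    then have "\<pi> (brac G x y + p y x) = \<pi> (p x y + brac N x y)" by simp
    then have "\<pi> (brac G x y) = brac sl2 (R x) (\<pi> y) + brac sl2 (\<pi> x) (\<pi> y) - brac sl2 (R y) (\<pi> x)"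
      unfolding \<pi> R by (simp add: algebra_simps)
    then show "R (brac G x y) + \<pi> (brac G x y) = brac sl2 (R x + \<pi> x) (R y + \<pi> y)"
      using sl2_skew[of "\<pi> x" "R y"] by (simp add: hom brac_sl2_bilinear)
  qed (simp_all add: lin hom)
qed

text \<open>The four homomorphisms are R1, R2, R1 + \<pi>1, R2 + \<pi>2. The differences within the
  two pairs are, up to sign, the projections of \<open>N\<close>, which have no common kernel. The
  algebra is first copied to \<open>complex ^ 6\<close> along the isomorphism of
  \<open>N\<close>.\<close>

proposition post_lie_listed:
  fixes N :: "(complex, 'v::ab_group_add) lie_struct"
  assumes N: "N \<cong>\<^sub>L sl2 \<oplus>\<^sub>L sl2" and pl: "post_lie G N p"
  shows "listed G"
proof -
  obtain f where f: "\<And>x y. f (x + y) = f x + f y" "\<And>c x. f (scal N c x) = scal (sl2 \<oplus>\<^sub>L sl2) c (f x)"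
    "bij f" "\<And>x y. f (brac N x y) = brac (sl2 \<oplus>\<^sub>L sl2) (f x) (f y)"
    using N unfolding lie_isomorphic_def linear_iff by blast
  obtain g where g: "\<And>x y. g (x + y) = g x + g y" "\<And>c x. g (scal (sl2 \<oplus>\<^sub>L sl2) c x) = scal N c (g x)"
    "\<And>x y. g (brac (sl2 \<oplus>\<^sub>L sl2) x y) = brac N (g x) (g y)" "\<And>x. f (g x) = x" "\<And>x. g (f x) = x"
  proof
    have fi: "f (inv f x) = x" "inv f (f y) = y" for x y
      using f(3) by (simp_all add: bij_is_surj surj_f_inv_f bij_is_inj)
    show "inv f (x + y) = inv f x + inv f y" for x y by (metis f(1) fi)
    show "inv f (scal (sl2 \<oplus>\<^sub>L sl2) c x) = scal N c (inv f x)" for c x by (metis f(2) fi)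
    show "inv f (brac (sl2 \<oplus>\<^sub>L sl2) x y) = brac N (inv f x) (inv f y)" for x y by (metis f(4) fi)
    show "f (inv f x) = x" for x by (rule fi)
    show "inv f (f x) = x" for x by (rule fi)
  qed
  have g1: "g (u + v, 0) = g (u, 0) + g (v, 0)" "g (0, u + v) = g (0, u) + g (0, v)"
     "g (c *s u, 0) = scal N c (g (u, 0))" "g (0, c *s u) = scal N c (g (0, u))"
     "g (brac sl2 u v, 0) = brac N (g (u, 0)) (g (v, 0))" "g (0, brac sl2 u v) = brac N (g (0, u)) (g (0, v))"
    for u v c
    by (simp_all flip: g add: scal_sum brac_sum brac_sl2_bilinear)
  have dec: "\<exists>u v. x = g (u, 0) + g (0, v)" "\<exists>u v. x = g (0, u) + g (v, 0)" for x
  proof -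
    have "x = g (fst (f x), snd (f x))" by (simp add: g)
    then have "x = g (fst (f x), 0) + g (0, snd (f x))" by (simp flip: g(1))
    moreover from this have "x = g (0, snd (f x)) + g (fst (f x), 0)" by (simp add: add.commute)
    ultimately show "\<exists>u v. x = g (u, 0) + g (0, v)" "\<exists>u v. x = g (0, u) + g (v, 0)" by blast+
  qed
  define \<pi>1 where "\<pi>1 x = fst (f x)" for x
  define \<pi>2 where "\<pi>2 x = snd (f x)" for x
  have \<pi>1: "\<pi>1 (x + y) = \<pi>1 x + \<pi>1 y" "\<pi>1 (scal N c x) = c *s \<pi>1 x" "\<pi>1 (brac N x y) = brac sl2 (\<pi>1 x) (\<pi>1 y)"
    "\<pi>1 (g (u, v)) = u" for x y c u v by (simp_all add: \<pi>1_def f g scal_sum brac_sum)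
  have \<pi>2: "\<pi>2 (x + y) = \<pi>2 x + \<pi>2 y" "\<pi>2 (scal N c x) = c *s \<pi>2 x" "\<pi>2 (brac N x y) = brac sl2 (\<pi>2 x) (\<pi>2 y)"
    "\<pi>2 (g (u, v)) = v" for x y c u v by (simp_all add: \<pi>2_def f g scal_sum brac_sum)
  obtain R1 where R1: "\<forall>x y. R1 (x + y) = R1 x + R1 y" "\<forall>c x. R1 (scal N c x) = c *s R1 x"
    "\<forall>x y. R1 (brac G x y) = brac sl2 (R1 x) (R1 y)"
    "\<forall>x y. R1 (brac G x y) + \<pi>1 (brac G x y) = brac sl2 (R1 x + \<pi>1 x) (R1 y + \<pi>1 y)"
    by (rule post_lie_component[OF pl, of \<pi>1 "\<lambda>u. g (u, 0)" "\<lambda>u. g (0, u)"]) (simp_all add: \<pi>1 g1 dec)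
  obtain R2 where R2: "\<forall>x y. R2 (x + y) = R2 x + R2 y" "\<forall>c x. R2 (scal N c x) = c *s R2 x"
    "\<forall>x y. R2 (brac G x y) = brac sl2 (R2 x) (R2 y)"
    "\<forall>x y. R2 (brac G x y) + \<pi>2 (brac G x y) = brac sl2 (R2 x + \<pi>2 x) (R2 y + \<pi>2 y)"
    by (rule post_lie_component[OF pl, of \<pi>2 "\<lambda>u. g (0, u)" "\<lambda>u. g (u, 0)"]) (simp_all add: \<pi>2 g1 dec)
  define k :: "complex ^ 6 \<Rightarrow> 'v" where "k x = g (vector [x$1, x$2, x$3], vector [x$4, x$5, x$6])" for x
  define k' where "k' v = vec6 (\<pi>1 v$1) (\<pi>1 v$2) (\<pi>1 v$3) (\<pi>2 v$1) (\<pi>2 v$2) (\<pi>2 v$3)" for v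
  have kk: "k' (k x) = x" for x by (simp add: k_def k'_def \<pi>1 \<pi>2 vec6_eq_iff)
  have kk': "k (k' v) = v" for v
  proof -
    have "(vector [\<pi>1 v$1, \<pi>1 v$2, \<pi>1 v$3], vector [\<pi>2 v$1, \<pi>2 v$2, \<pi>2 v$3]) = f v"
      by (simp add: \<pi>1_def \<pi>2_def prod_eq_iff vec_eq_iff forall_3)
    then show ?thesis by (simp add: k_def k'_def g)
  qed
  have k'lin: "k' (v + w) = k' v + k' w" "k' (scal N c v) = c *s k' v" for v w c
    by (simp_all add: k'_def \<pi>1 \<pi>2 vec6_eq_iff)
  have klin: "k (x + y) = k x + k y" "k (c *s x) = scal N c (k x)" for x y c
    by (metis kk kk' k'lin)+
  define G' where "G' = \<lparr>scal = (*s), brac = (\<lambda>x y. k' (brac G (k x) (k y)))\<rparr>"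
  have G': "scal G' = (*s)" "k (brac G' x y) = brac G (k x) (k y)" for x y
    by (simp_all add: G'_def kk')
  have sG: "scal G = scal N" and vsN: "vector_space (scal N)"
    using pl unfolding post_lie_def lie_algebra_def by blast+
  have "listed G'"
  proof (rule listed_of_homs[OF G'(1)])
    show "sl2_hom G' (\<lambda>x. R1 (k x))" "sl2_hom G' (\<lambda>x. R2 (k x))"
      unfolding sl2_hom_def by (simp_all add: G' klin R1(1-3) R2(1-3))
    show "sl2_hom G' (\<lambda>x. R1 (k x) + \<pi>1 (k x))" "sl2_hom G' (\<lambda>x. R2 (k x) + \<pi>2 (k x))"
      unfolding sl2_hom_def using R1(4) R2(4)
      by (simp_all add: G' klin R1(1,2) R2(1,2) \<pi>1(1,2) \<pi>2(1,2) vec.scale_right_distrib)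
    show "\<forall>x. R1 (k x) = R1 (k x) + \<pi>1 (k x) \<longrightarrow> R2 (k x) = R2 (k x) + \<pi>2 (k x) \<longrightarrow> x = 0"
    proof (intro allI impI)
      fix x assume "R1 (k x) = R1 (k x) + \<pi>1 (k x)" "R2 (k x) = R2 (k x) + \<pi>2 (k x)"
      then have "k' (k x) = 0" by (simp add: k'_def vec6_eq_iff)
      then show "x = 0" by (simp add: kk)
    qed
  qed
  moreover have "bij k'" by (rule o_bij[of k]) (simp_all add: fun_eq_iff kk kk')
  then have "G \<cong>\<^sub>L G'" unfolding lie_isomorphic_def linear_iff sG G'(1)
    using k'lin by (intro exI[of _ k']) (simp add: vsN vector_space_vec G'_def kk')
  ultimately show ?thesis using listed_iso by blast
qed

section \<open>Realization\<close>

text \<open>Pulling the bracket and the product back along the isomorphism means that examples need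
  only be constructed on one concrete model.\<close>

lemma post_lie_transport:
  fixes N :: "(complex, 'v::ab_group_add) lie_struct" and M :: "(complex, 'w::ab_group_add) lie_struct"
  assumes N: "lie_algebra N" and iso: "N \<cong>\<^sub>L M" and pl: "post_lie G M p" and H: "G \<cong>\<^sub>L H"
  shows "post_lie_occurs N H"
proof -
  obtain f where f: "\<And>x y. f (x + y) = f x + f y" "\<And>c x. f (scal N c x) = scal M c (f x)"
    "bij f" "\<And>x y. f (brac N x y) = brac M (f x) (f y)" and vs: "vector_space (scal N)" "vector_space (scal M)"
    using iso unfolding lie_isomorphic_def linear_iff by blast
  define g where "g = inv f"
  have fg: "f (g x) = x" "g (f y) = y" for x y
    using f(3) by (simp_all add: g_def bij_is_surj surj_f_inv_f bij_is_inj)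
  have g: "g (x + y) = g x + g y" "g (scal M c x) = scal N c (g x)" "g (brac M x y) = brac N (g x) (g y)"
    "g (x - y) = g x - g y" "g 0 = 0" for x y c
  proof -
    show add: "g (x + y) = g x + g y" for x y by (metis f(1) fg)
    show "g (scal M c x) = scal N c (g x)" by (metis f(2) fg)
    show "g (brac M x y) = brac N (g x) (g y)" by (metis f(4) fg)
    show "g (x - y) = g x - g y" using add[of "x - y" y] by simp
    show "g 0 = 0" using add[of 0 0] by simp
  qed
  define G' where "G' = \<lparr>scal = scal N, brac = (\<lambda>x y. g (brac G (f x) (f y)))\<rparr>"
  define p' where "p' x y = g (p (f x) (f y))" for x y
  have bil: "bilinear_op (scal N) (\<lambda>x y. g (b (f x) (f y)))" if "bilinear_op (scal M) b" for b
    using that vs unfolding bilinear_op_def linear_iff by (simp add: f g)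
  note P = pl[unfolded post_lie_def lie_algebra_def]
  have sG: "scal G = scal M" using P by blast
  have "lie_algebra G'"
    unfolding lie_algebra_def
  proof (intro conjI allI)
    show "bilinear_op (scal G') (brac G')" unfolding G'_def using bil[of "brac G"] P sG by simp
    show "brac G' x (brac G' y z) + brac G' y (brac G' z x) + brac G' z (brac G' x y) = 0" for x y z
      unfolding G'_def using P by (simp add: fg flip: g(1,5))
  qed (use P vs in \<open>simp_all add: G'_def g\<close>)
  moreover have "bilinear_op (scal N) p'" unfolding p'_def using bil[of p] P by simp
  moreover have "p' x y - p' y x = brac G' x y - brac N x y" for x y
  proof -
    have "p (f x) (f y) - p (f y) (f x) = brac G (f x) (f y) - brac M (f x) (f y)" using P by blast
    then have "g (p (f x) (f y) - p (f y) (f x)) = g (brac G (f x) (f y) - brac M (f x) (f y))" by simp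
    then show ?thesis by (simp add: p'_def G'_def g fg)
  qed
  moreover have "p' (brac G' x y) z = p' x (p' y z) - p' y (p' x z)" for x y z
    unfolding p'_def G'_def using P by (simp add: fg flip: g(4))
  moreover have "p' x (brac N y z) = brac N (p' x y) z + brac N y (p' x z)" for x y z
  proof -
    have "p (f x) (brac M (f y) (f z)) = brac M (p (f x) (f y)) (f z) + brac M (f y) (p (f x) (f z))"
      using P by blast
    then have "g (p (f x) (brac M (f y) (f z))) = g (brac M (p (f x) (f y)) (f z) + brac M (f y) (p (f x) (f z)))"
      by simp
    then show ?thesis by (simp add: p'_def f g fg)
  qed
  ultimately have "post_lie G' N p'" unfolding post_lie_def using N by (simp add: G'_def)
  moreover have "G' \<cong>\<^sub>L G"
    unfolding lie_isomorphic_def linear_iff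
    using f vs by (intro exI[of _ f]) (simp add: G'_def sG fg)
  ultimately show ?thesis unfolding post_lie_occurs_def using lie_iso_trans[OF _ H] by blast
qed

text \<open>The descendent bracket of a Rota--Baxter operator of weight one.\<close>

definition rb_lie where
  "rb_lie N R = \<lparr>scal = scal N, brac = (\<lambda>x y. brac N (R x) y + brac N x (R y) + brac N x y)\<rparr>"

text \<open>\<open>rb\<close> makes \<open>R\<close> a homomorphism from the new bracket to the old
  one. Axioms (ii) and (iii) then are the Jacobi identity of \<open>N\<close>, and (i) is the
  definition of the new bracket.\<close>

lemma rota_baxter_post_lie:
  fixes N :: "(complex, 'v::ab_group_add) lie_struct"
  assumes N: "lie_algebra N"
    and R: "\<And>x y. R (x + y) = R x + R y" "\<And>c x. R (scal N c x) = scal N c (R x)"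
    and rb: "\<And>x y. R (brac (rb_lie N R) x y) = brac N (R x) (R y)"
  shows "post_lie (rb_lie N R) N (\<lambda>x y. brac N (R x) y)"
proof -
  define b where "b = brac N"
  note N' = N[unfolded lie_algebra_def bilinear_op_def linear_iff, folded b_def]
  have vs: "vector_space (scal N)" using N' by blast
  interpret vector_space "scal N" by (rule vs)
  have br: "b (x + y) z = b x z + b y z" "b z (x + y) = b z x + b z y"
    "b (scal N c x) y = scal N c (b x y)" "b x (scal N c y) = scal N c (b x y)" for x y z c
    using N' by blast+
  have alt: "b x x = 0" and jac: "b x (b y z) + b y (b z x) + b z (b x y) = 0" for x y z
    using N' by blast+
  have skew: "b x y = - b y x" for x y
  proof -
    have "b (x + y) (x + y) = b x y + b y x" unfolding br by (simp add: alt)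
    then have "b x y + b y x = 0" using alt by (rule trans[OF sym])
    then show ?thesis by (simp add: eq_neg_iff_add_eq_0)
  qed
  have neg: "b (- x) y = - b x y" "b x (- y) = - b x y" for x y
    using br(1)[of x "- x" y] br(2)[of x y "- y"] br(1)[of 0 0 y] br(2)[of x 0 0]
    by (simp_all add: eq_neg_iff_add_eq_0 add.commute)
  have jac': "b (b x y) z = b x (b y z) - b y (b x z)" for x y z
    using jac[of x y z] skew[of z "b x y"] skew[of z x] by (simp add: neg algebra_simps)
  define c where "c x y = b (R x) y + b x (R y) + b x y" for x y
  have c: "brac (rb_lie N R) = c" "scal (rb_lie N R) = scal N" by (simp_all add: rb_lie_def c_def b_def fun_eq_iff)
  have rb': "R (c x y) = b (R x) (R y)" for x y using rb unfolding c b_def .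
  have cjac: "c x (c y z) + c y (c z x) + c z (c x y) = 0" for x y z
  proof -
    have e: "c x (c y z) = b (R x) (b (R y) z) + b (R x) (b y (R z)) + b (R x) (b y z)
       + b x (b (R y) (R z)) + (b x (b (R y) z) + b x (b y (R z)) + b x (b y z))" for x y z
      unfolding c_def[of x] rb' by (simp add: c_def br add.assoc)
    \<comment> \<open>The cyclic sum splits into seven Jacobi sums of \<open>N\<close>, one for each
      proper subset of x, y, z to which \<open>R\<close> is applied.\<close>
    have "c x (c y z) + c y (c z x) + c z (c x y) =
        (b (R x) (b (R y) z) + b (R y) (b z (R x)) + b z (b (R x) (R y)))
      + (b (R x) (b y (R z)) + b y (b (R z) (R x)) + b (R z) (b (R x) y))
      + (b x (b (R y) (R z)) + b (R y) (b (R z) x) + b (R z) (b x (R y)))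
      + (b (R x) (b y z) + b y (b z (R x)) + b z (b (R x) y))
      + (b x (b (R y) z) + b (R y) (b z x) + b z (b x (R y)))
      + (b x (b y (R z)) + b y (b (R z) x) + b (R z) (b x y))
      + (b x (b y z) + b y (b z x) + b z (b x y))"
      unfolding e by (simp add: ac_simps)
    then show ?thesis unfolding jac by simp
  qed
  have cbil: "c (x + y) z = c x z + c y z" "c z (x + y) = c z x + c z y"
    "c (scal N k x) y = scal N k (c x y)" "c x (scal N k y) = scal N k (c x y)" for x y z k
    by (simp_all add: c_def br R scale_right_distrib ac_simps)
  have calt: "c x x = 0" for x
    using skew[of "R x" x] by (simp add: c_def alt)
  show ?thesis
    unfolding post_lie_def c bilinear_op_def linear_iff b_def[symmetric]
  proof (intro conjI allI)
    show "lie_algebra (rb_lie N R)"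
      unfolding lie_algebra_def c bilinear_op_def linear_iff using vs by (simp add: cjac cbil calt)
    show "b (R x) y - b (R y) x = c x y - b x y" for x y
      using skew[of "R y" x] by (simp add: c_def)
    show "b (R (c x y)) z = b (R x) (b (R y) z) - b (R y) (b (R x) z)" for x y z
      unfolding rb' jac' ..
    show "b (R x) (b y z) = b (b (R x) y) z + b y (b (R x) z)" for x y z
      by (simp add: jac')
  qed (simp_all only: N vs br R)
qed

lemma lie_algebra_sl2_sl2: "lie_algebra (sl2 \<oplus>\<^sub>L sl2)"
proof -
  have "brac sl2 x (brac sl2 y z) + brac sl2 y (brac sl2 z x) + brac sl2 z (brac sl2 x y) = 0" for x y z
    by (simp add: brac_sl2 vec_eq_iff forall_3 algebra_simps)
  moreover have "brac sl2 x x = 0" for x by (simp add: brac_sl2 vec_eq_iff forall_3)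
  ultimately show ?thesis
    unfolding lie_algebra_def bilinear_op_def linear_iff
    by (simp add: scal_sum brac_sum vector_space_pair vector_space_vec brac_sl2_bilinear zero_prod_def)
qed

lemma occurs_of_rota_baxter:
  fixes N :: "(complex, 'v::ab_group_add) lie_struct"
  assumes "lie_algebra N" "N \<cong>\<^sub>L sl2 \<oplus>\<^sub>L sl2"
    and R: "\<And>x y. R (x + y) = R x + R y" "\<And>c u v. R (c *s u, c *s v) = (c *s fst (R (u, v)), c *s snd (R (u, v)))"
    and rb: "\<And>x y. R (brac (rb_lie (sl2 \<oplus>\<^sub>L sl2) R) x y) = brac (sl2 \<oplus>\<^sub>L sl2) (R x) (R y)"
    and "rb_lie (sl2 \<oplus>\<^sub>L sl2) R \<cong>\<^sub>L H"
  shows "post_lie_occurs N H"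
proof (rule post_lie_transport[OF assms(1,2) rota_baxter_post_lie])
  show "R (scal (sl2 \<oplus>\<^sub>L sl2) c x) = scal (sl2 \<oplus>\<^sub>L sl2) c (R x)" for c x
    using R(2)[of c "fst x" "snd x"] by (simp add: scal_sum)
qed (use assms lie_algebra_sl2_sl2 in auto)

lemmas rb_simps = rb_lie_def brac_sum scal_sum brac_sl2 prod_eq_iff vec_eq_iff forall_3

text \<open>In each summand \<open>R\<close> and \<open>R + id\<close> map into opposite Borel subalgebras.\<close>

lemma occurs_wlie_normal:
  fixes N :: "(complex, 'v::ab_group_add) lie_struct"
  assumes "lie_algebra N" "N \<cong>\<^sub>L sl2 \<oplus>\<^sub>L sl2"
  shows "post_lie_occurs N (wlie (- p1) (- q1) (- p2) (- q2) (p1 - 1) q1 p2 (q2 - 1))"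
proof -
  \<comment> \<open>\<open>R\<close> is -1 on both e, 0 on both f, and minus the matrix with rows
    (p1, q1), (p2, q2) on the two h. The factors -2 in \<open>?f\<close> absorb [h, e] = 2 e and the
    sign convention of \<open>wlie\<close>.\<close>
  define R :: "(complex ^ 3) \<times> (complex ^ 3) \<Rightarrow> (complex ^ 3) \<times> (complex ^ 3)" where
    "R x = (vector [- fst x$1, 0, - (p1 * fst x$3 + q1 * snd x$3)],
            vector [- snd x$1, 0, - (p2 * fst x$3 + q2 * snd x$3)])" for x
  let ?f = "\<lambda>x :: (complex ^ 3) \<times> (complex ^ 3).
    vec6 (fst x$1) (snd x$1) (fst x$2) (snd x$2) (- 2 * fst x$3) (- 2 * snd x$3)"
  let ?g = "\<lambda>x. (vector [x$1, x$3, - x$5 / 2] :: complex ^ 3, vector [x$2, x$4, - x$6 / 2] :: complex ^ 3)"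
  show ?thesis
  proof (rule occurs_of_rota_baxter[OF assms, of R])
    show "rb_lie (sl2 \<oplus>\<^sub>L sl2) R \<cong>\<^sub>L wlie (- p1) (- q1) (- p2) (- q2) (p1 - 1) q1 p2 (q2 - 1)"
      unfolding lie_isomorphic_def linear_iff
    proof (intro exI[of _ ?f] conjI allI)
      show "bij ?f" by (rule o_bij[of ?g]) (simp_all add: fun_eq_iff vec6_eq_iff prod_eq_iff vec_eq_iff forall_3)
      show "?f (brac (rb_lie (sl2 \<oplus>\<^sub>L sl2) R) x y) =
        brac (wlie (- p1) (- q1) (- p2) (- q2) (p1 - 1) q1 p2 (q2 - 1)) (?f x) (?f y)" for x y
        by (simp add: rb_lie_def brac_sum brac_sl2 R_def brac_wlie vec6_eq_iff algebra_simps)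
    qed (simp_all add: rb_lie_def scal_sum vector_space_pair vector_space_vec vec6_eq_iff)
  qed (simp_all add: R_def rb_simps algebra_simps)
qed

text \<open>Expanding w1 and w2 in the basis w1 + w3, w2 + w4 gives the parameters, and passing to
  the negatives of these sums as torus basis gives the normal form already realized.\<close>

lemma occurs_wlie:
  fixes N :: "(complex, 'v::ab_group_add) lie_struct"
  assumes N: "lie_algebra N" "N \<cong>\<^sub>L sl2 \<oplus>\<^sub>L sl2"
    and D: "dt (p1 + p3) (q1 + q3) (p2 + p4) (q2 + q4) \<noteq> 0"
    and H: "wlie p1 q1 p2 q2 p3 q3 p4 q4 \<cong>\<^sub>L H"
  shows "post_lie_occurs N H"
proof -
  obtain k l where k: "p1 = k * (p1 + p3) + l * (p2 + p4)" "q1 = k * (q1 + q3) + l * (q2 + q4)"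
    using dt_coords[OF D] by metis
  obtain m n where m: "p2 = m * (p1 + p3) + n * (p2 + p4)" "q2 = m * (q1 + q3) + n * (q2 + q4)"
    using dt_coords[OF D] by metis
  have "wlie p1 q1 p2 q2 p3 q3 p4 q4 \<cong>\<^sub>L wlie (- k) (- l) (- m) (- n) (k - 1) l m (n - 1)"
  proof (rule wlie_change[of _ _ "- (p1 + p3)" _ "- (p2 + p4)" _ "- (q1 + q3)" "- (q2 + q4)"])
    show "- (p1 + p3) * - (q2 + q4) \<noteq> - (q1 + q3) * - (p2 + p4)" using D unfolding dt_def minus_mult_minus by simp
  qed (use k m in algebra)+
  then have "wlie (- k) (- l) (- m) (- n) (k - 1) l m (n - 1) \<cong>\<^sub>L H"
    using lie_iso_trans[OF lie_iso_sym H] by blast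
  then show ?thesis
    using occurs_wlie_normal[OF N, of k l m n] lie_iso_trans unfolding post_lie_occurs_def by blast
qed

section \<open>Occurrence of the individual families\<close>

lemma occurs_sl2_r3:
  fixes N :: "(complex, 'v::ab_group_add) lie_struct"
  assumes "lie_algebra N" "N \<cong>\<^sub>L sl2 \<oplus>\<^sub>L sl2" and l: "l \<noteq> -1"
  shows "post_lie_occurs N (sl2 \<oplus>\<^sub>L r3 l)"
proof -
  have "1 + l \<noteq> 0" using l by (simp add: eq_neg_iff_add_eq_0 add.commute)
  \<comment> \<open>In the second summand the new bracket has [h, e] = - 2 p e and [h, f] = - 2 (1 -
    p) f, so p is chosen to make the ratio (1 - p) / p equal to l. On the first summand
    \<open>R\<close> is 0 and the bracket stays that of \<open>sl2\<close>.\<close>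
  define p where "p = 1 / (1 + l)"
  have p: "p \<noteq> 0" "l = (1 - p) / p" using \<open>1 + l \<noteq> 0\<close> by (simp_all add: p_def field_simps)
  define R :: "(complex ^ 3) \<times> (complex ^ 3) \<Rightarrow> (complex ^ 3) \<times> (complex ^ 3)" where
    "R x = (0, vector [- snd x$1, 0, - p * snd x$3])" for x
  let ?f = "\<lambda>x :: (complex ^ 3) \<times> (complex ^ 3). (fst x, vector [- 2 * p * snd x$3, snd x$1, snd x$2] :: complex ^ 3)"
  let ?g = "\<lambda>x. (fst x, vector [snd x$2, snd x$3, - snd x$1 / (2 * p)] :: complex ^ 3)"
  show ?thesis
  proof (rule occurs_of_rota_baxter[OF assms(1,2), of R])
    show "rb_lie (sl2 \<oplus>\<^sub>L sl2) R \<cong>\<^sub>L sl2 \<oplus>\<^sub>L r3 l"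
      unfolding lie_isomorphic_def linear_iff
    proof (intro exI[of _ ?f] conjI allI)
      show "bij ?f" using p(1) by (intro o_bij[of ?g]) (simp_all add: fun_eq_iff prod_eq_iff vec_eq_iff forall_3)
      show "?f (brac (rb_lie (sl2 \<oplus>\<^sub>L sl2) R) x y) = brac (sl2 \<oplus>\<^sub>L r3 l) (?f x) (?f y)" for x y
        using p(1) by (simp add: rb_simps R_def brac_r3 p(2) field_simps)
    qed (simp_all add: rb_lie_def scal_sum vector_space_pair vector_space_vec prod_eq_iff vec_eq_iff forall_3 algebra_simps)
  qed (simp_all add: R_def rb_simps algebra_simps)
qed

lemma occurs_r2_r2_r2:
  fixes N :: "(complex, 'v::ab_group_add) lie_struct"
  assumes "lie_algebra N" "N \<cong>\<^sub>L sl2 \<oplus>\<^sub>L sl2"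
  shows "post_lie_occurs N (r2 \<oplus>\<^sub>L r2 \<oplus>\<^sub>L r2)"
proof -
  \<comment> \<open>Without the entry \<open>snd x$2\<close> this is the earlier diagonal operator,
    for which f of the second summand is central in the new bracket. The entry sends this f to h of
    the first summand, so it acts there and produces the third copy of \<open>r2\<close>.\<close>
  define R :: "(complex ^ 3) \<times> (complex ^ 3) \<Rightarrow> (complex ^ 3) \<times> (complex ^ 3)" where
    "R x = (vector [- fst x$1, 0, snd x$2], vector [- snd x$1, 0, - snd x$3])" for x
  let ?f = "\<lambda>x :: (complex ^ 3) \<times> (complex ^ 3).
    (vector [2 * snd x$2, fst x$1] :: complex ^ 2, vector [- 2 * snd x$3, snd x$1] :: complex ^ 2,
     vector [- 2 * (fst x$3 + snd x$2), fst x$2] :: complex ^ 2)"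
  let ?g = "\<lambda>x :: (complex ^ 2) \<times> (complex ^ 2) \<times> (complex ^ 2).
    (vector [fst x$2, snd (snd x)$2, - (snd (snd x)$1) / 2 - fst x$1 / 2] :: complex ^ 3,
     vector [fst (snd x)$2, fst x$1 / 2, - (fst (snd x)$1) / 2] :: complex ^ 3)"
  show ?thesis
  proof (rule occurs_of_rota_baxter[OF assms, of R])
    show "rb_lie (sl2 \<oplus>\<^sub>L sl2) R \<cong>\<^sub>L r2 \<oplus>\<^sub>L r2 \<oplus>\<^sub>L r2"
      unfolding lie_isomorphic_def linear_iff
    proof (intro exI[of _ ?f] conjI allI)
      show "bij ?f"
        by (rule o_bij[of ?g]) (simp_all add: fun_eq_iff prod_eq_iff vec_eq_iff forall_2 forall_3 field_simps)
      show "?f (brac (rb_lie (sl2 \<oplus>\<^sub>L sl2) R) x y) = brac (r2 \<oplus>\<^sub>L r2 \<oplus>\<^sub>L r2) (?f x) (?f y)" for x y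
        by (simp add: rb_simps R_def brac_r2 forall_2 algebra_simps)
      show "vector_space (scal (r2 \<oplus>\<^sub>L r2 \<oplus>\<^sub>L r2))"
        unfolding scal_sum scal_r2 by (intro vector_space_pair vector_space_vec)
    qed (simp_all add: rb_lie_def scal_sum vector_space_pair vector_space_vec prod_eq_iff vec_eq_iff forall_2 algebra_simps)
  qed (simp_all add: R_def rb_simps algebra_simps)
qed

lemma occurs_self:
  fixes N :: "(complex, 'v::ab_group_add) lie_struct"
  assumes "lie_algebra N" "N \<cong>\<^sub>L H"
  shows "post_lie_occurs N H"
proof -
  have vs: "vector_space (scal N)" and bl: "bilinear_op (scal N) (brac N)"
    using assms(1) unfolding lie_algebra_def by blast+
  interpret vector_space "scal N" by (rule vs)
  have "brac N 0 x = 0" "brac N x 0 = 0" for x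
    using bl unfolding bilinear_op_def linear_iff by (metis add_cancel_right_right)+
  then have "post_lie N N (\<lambda>_ _. 0)"
    using assms(1) vs unfolding post_lie_def by (simp add: bilinear_op_def linear_iff)
  then show ?thesis using assms(2) unfolding post_lie_occurs_def by blast
qed

text \<open>The four weights can be matched into two pairs in three ways, with determinants (1 +
  l)(1 + m), m - l and 1 - l m. All three vanish only for l = m = -1.\<close>

lemma occurs_r3_r3:
  fixes N :: "(complex, 'v::ab_group_add) lie_struct"
  assumes N: "lie_algebra N" "N \<cong>\<^sub>L sl2 \<oplus>\<^sub>L sl2" and lm: "(l, m) \<noteq> (-1, -1)"
  shows "post_lie_occurs N (r3 l \<oplus>\<^sub>L r3 m)"
proof -
  note W = lie_iso_sym[OF r3_r3_iso[of l m]]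
  have "(1 + l) * (1 + m) \<noteq> 0 \<or> m \<noteq> l \<or> l * m \<noteq> 1"
  proof (rule ccontr)
    assume *: "\<not> ((1 + l) * (1 + m) \<noteq> 0 \<or> m \<noteq> l \<or> l * m \<noteq> 1)"
    then have "m = l" "1 + l = 0" by auto
    then show False using lm by (simp add: eq_neg_iff_add_eq_0 add.commute)
  qed
  then consider "dt (1 + l) 0 0 (1 + m) \<noteq> 0" | "dt 1 1 l m \<noteq> 0" | "dt 1 m l 1 \<noteq> 0"
    by (auto simp: dt_def mult.commute)
  then show ?thesis
  proof cases
    case 1
    then show ?thesis
      \<comment> \<open>The arguments come in the order p1, p3, q1, q3, p2, p4, q2, q4.\<close>
      using occurs_wlie[OF N, of 1 l 0 0 0 0 1 m] lie_iso_trans[OF wlie_swap23 W] by simp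
  next
    case 2
    then show ?thesis using occurs_wlie[OF N, of 1 0 0 1 l 0 0 m] W by simp
  next
    case 3
    then show ?thesis
      using occurs_wlie[OF N, of 1 0 0 m l 0 0 1] lie_iso_trans[OF wlie_swap34 W] by simp
  qed
qed

text \<open>Again one of the three matchings of the weights has to have a nonzero determinant. If
  all vanish, then l = -1, which forces the excluded triple, or a2 = -1, which forces a1 =
  0.\<close>

lemma occurs_lie7:
  fixes N :: "(complex, 'v::ab_group_add) lie_struct"
  assumes N: "lie_algebra N" "N \<cong>\<^sub>L sl2 \<oplus>\<^sub>L sl2"
    and a1: "a1 \<noteq> 0" and la: "(l, a1, a2) \<noteq> (-1, a1, - a1 - 1)"
  shows "post_lie_occurs N (lie7 l a1 a2)"
proof -
  note W = lie_iso_sym[OF lie7_iso[of l a1 a2]]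
  have "(1 + l) * (1 + a2) \<noteq> 0 \<or> a1 + a2 \<noteq> l \<or> 1 + a1 \<noteq> l * a2"
  proof (rule ccontr)
    assume *: "\<not> ((1 + l) * (1 + a2) \<noteq> 0 \<or> a1 + a2 \<noteq> l \<or> 1 + a1 \<noteq> l * a2)"
    then have e: "l = a1 + a2" "1 + a1 = l * a2" by auto
    have "1 + l = 0 \<or> 1 + a2 = 0" using * by auto
    then show False
    proof
      assume "1 + l = 0"
      then have "l = -1" by (simp add: add_eq_0_iff)
      then have "a2 = - a1 - 1" using e(2) by algebra
      with \<open>l = -1\<close> show False using la by simp
    next
      assume "1 + a2 = 0"
      then have "a2 = -1" by (simp add: add_eq_0_iff)
      then have "2 * a1 = 0" using e by algebra
      then show False using a1 by simp
    qed
  qed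
  then consider "dt (1 + l) a1 0 (1 + a2) \<noteq> 0" | "dt 1 1 l (a1 + a2) \<noteq> 0" | "dt 1 a2 l (a1 + 1) \<noteq> 0"
    by (auto simp: dt_def mult.commute add.commute)
  then show ?thesis
  proof cases
    case 1
    then show ?thesis
      using occurs_wlie[OF N, of 1 l 0 a1 0 0 1 a2] lie_iso_trans[OF wlie_swap23 W] by simp
  next
    case 2
    then show ?thesis using occurs_wlie[OF N, of 1 0 0 1 l 0 a1 a2] W by simp
  next
    case 3
    then show ?thesis
      using occurs_wlie[OF N, of 1 0 0 a2 l 0 a1 1] lie_iso_trans[OF wlie_swap34 W] by simp
  qed
qed

text \<open>The weights are ordered so that the determinant of the sums is - (1 + b).\<close>

lemma occurs_lie5:
  fixes N :: "(complex, 'v::ab_group_add) lie_struct"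
  assumes N: "lie_algebra N" "N \<cong>\<^sub>L sl2 \<oplus>\<^sub>L sl2" and b: "b \<noteq> -1"
  shows "post_lie_occurs N (lie5 a b)"
proof (rule occurs_wlie[OF N])
  show "wlie 0 1 1 0 0 b 0 a \<cong>\<^sub>L lie5 a b"
    by (rule lie_iso_trans[OF wlie_swap12 lie_iso_trans[OF wlie_swap34 lie_iso_sym[OF lie5_iso]]])
  show "dt (0 + 0) (1 + b) (1 + 0) (0 + a) \<noteq> 0" using b by (simp add: dt_def add_eq_0_iff)
qed

text \<open>The weights are ordered so that the determinant of the sums is - (1 + a), independently
  of \<open>l\<close>.\<close>

lemma occurs_lie6:
  fixes N :: "(complex, 'v::ab_group_add) lie_struct"
  assumes N: "lie_algebra N" "N \<cong>\<^sub>L sl2 \<oplus>\<^sub>L sl2" and a: "a \<noteq> -1"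
  shows "post_lie_occurs N (lie6 l a)"
proof (rule occurs_wlie[OF N])
  show "wlie l 1 1 0 0 a 0 0 \<cong>\<^sub>L lie6 l a"
    by (rule lie_iso_trans[OF wlie_swap12 lie_iso_sym[OF lie6_iso]])
  show "dt (l + 0) (1 + a) (1 + 0) (0 + 0) \<noteq> 0" using a by (simp add: dt_def add_eq_0_iff)
qed

text \<open>With T taking w1, w2 to w3, w4, the determinant of the sums is det (1 + T) times that of
  w1, w2. The conditions on the parameters keep both factors nonzero; in the Jordan case 1 + T has
  the double eigenvalue \<open>a 1\<close>.\<close>

lemma occurs_lie8:
  fixes N :: "(complex, 'v::ab_group_add) lie_struct"
  assumes N: "lie_algebra N" "N \<cong>\<^sub>L sl2 \<oplus>\<^sub>L sl2" and a: "cond8a a \<or> cond8b a"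
  shows "post_lie_occurs N (lie8 a)"
proof (rule occurs_wlie[OF N])
  show "wlie 1 (a 1) (a 2) (a 3) (a 4) (a 5) (a 6) (a 7) \<cong>\<^sub>L lie8 a"
    unfolding lie8_eq_wlie by (rule lie_iso_refl) (simp add: vector_space_vec)
  show "dt (1 + a 4) (a 1 + a 5) (a 2 + a 6) (a 3 + a 7) \<noteq> 0" using a
  proof
    assume *: "cond8a a"
    then have "dt (1 + a 4) (a 1 + a 5) (a 2 + a 6) (a 3 + a 7) = (1 + a 4) * (1 + a 7) * (1 - a 1 * a 2)"
      by (simp add: cond8a_def dt_def algebra_simps)
    then show ?thesis using * by (auto simp: cond8a_def add_eq_0_iff)
  next
    assume *: "cond8b a"
    then have "dt (1 + a 4) (a 1 + a 5) (a 2 + a 6) (a 3 + a 7) = a 1 * a 1 * (a 3 - a 1 * a 2)"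
    proof -
      have e: "a 4 = a 1 - 1" "a 5 = - a 1" "a 6 = a 2 * (a 1 - 1)" "a 7 = a 1 * a 3 - (a 1)\<^sup>2 * a 2 - a 3"
        using * unfolding cond8b_def by blast+
      show ?thesis unfolding e dt_def by (simp add: algebra_simps power2_eq_square)
    qed
    then show ?thesis using * by (auto simp: cond8b_def)
  qed
qed

theorem theorem4p1:
  fixes N :: "(complex, 'v::ab_group_add) lie_struct"
  assumes "lie_algebra N" and "N \<cong>\<^sub>L sl2 \<oplus>\<^sub>L sl2"
  shows
    "(\<forall>G. (\<exists>p. post_lie G N p) \<longrightarrow>
        G \<cong>\<^sub>L sl2 \<oplus>\<^sub>L sl2
      \<or> (\<exists>l. l \<noteq> -1 \<and> G \<cong>\<^sub>L sl2 \<oplus>\<^sub>L r3 l)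
      \<or> (\<exists>l m. (l, m) \<noteq> (-1, -1) \<and> G \<cong>\<^sub>L r3 l \<oplus>\<^sub>L r3 m)
      \<or> G \<cong>\<^sub>L r2 \<oplus>\<^sub>L r2 \<oplus>\<^sub>L r2
      \<or> (\<exists>a b. a \<noteq> 0 \<and> b \<noteq> 0 \<and> b \<noteq> -1 \<and> G \<cong>\<^sub>L lie5 a b)
      \<or> (\<exists>l a. l \<noteq> 0 \<and> a \<noteq> 0 \<and> a \<noteq> -1 \<and> G \<cong>\<^sub>L lie6 l a)
      \<or> (\<exists>l a1 a2. l \<noteq> 0 \<and> a1 \<noteq> 0 \<and> a2 \<noteq> 0 \<and> (l, a1, a2) \<noteq> (-1, a1, - a1 - 1)
           \<and> G \<cong>\<^sub>L lie7 l a1 a2)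
      \<or> (\<exists>a. (cond8a a \<or> cond8b a) \<and> G \<cong>\<^sub>L lie8 a))
   \<and> post_lie_occurs N (sl2 \<oplus>\<^sub>L sl2)
   \<and> (\<forall>l. l \<noteq> -1 \<longrightarrow> post_lie_occurs N (sl2 \<oplus>\<^sub>L r3 l))
   \<and> (\<forall>l m. (l, m) \<noteq> (-1, -1) \<longrightarrow> post_lie_occurs N (r3 l \<oplus>\<^sub>L r3 m))
   \<and> post_lie_occurs N (r2 \<oplus>\<^sub>L r2 \<oplus>\<^sub>L r2)
   \<and> (\<forall>a b. a \<noteq> 0 \<and> b \<noteq> 0 \<and> b \<noteq> -1 \<longrightarrow> post_lie_occurs N (lie5 a b))
   \<and> (\<forall>l a. l \<noteq> 0 \<and> a \<noteq> 0 \<and> a \<noteq> -1 \<longrightarrow> post_lie_occurs N (lie6 l a))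
   \<and> (\<forall>l a1 a2. l \<noteq> 0 \<and> a1 \<noteq> 0 \<and> a2 \<noteq> 0 \<and> (l, a1, a2) \<noteq> (-1, a1, - a1 - 1)
        \<longrightarrow> post_lie_occurs N (lie7 l a1 a2))
   \<and> (\<forall>a. cond8a a \<or> cond8b a \<longrightarrow> post_lie_occurs N (lie8 a))"
proof (intro conjI allI impI)
  fix G :: "(complex, 'v) lie_struct"
  assume "\<exists>p. post_lie G N p"
  then have "listed G" using post_lie_listed[OF assms(2)] by blast
  then show "G \<cong>\<^sub>L sl2 \<oplus>\<^sub>L sl2
      \<or> (\<exists>l. l \<noteq> -1 \<and> G \<cong>\<^sub>L sl2 \<oplus>\<^sub>L r3 l)
      \<or> (\<exists>l m. (l, m) \<noteq> (-1, -1) \<and> G \<cong>\<^sub>L r3 l \<oplus>\<^sub>L r3 m)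
      \<or> G \<cong>\<^sub>L r2 \<oplus>\<^sub>L r2 \<oplus>\<^sub>L r2
      \<or> (\<exists>a b. a \<noteq> 0 \<and> b \<noteq> 0 \<and> b \<noteq> -1 \<and> G \<cong>\<^sub>L lie5 a b)
      \<or> (\<exists>l a. l \<noteq> 0 \<and> a \<noteq> 0 \<and> a \<noteq> -1 \<and> G \<cong>\<^sub>L lie6 l a)
      \<or> (\<exists>l a1 a2. l \<noteq> 0 \<and> a1 \<noteq> 0 \<and> a2 \<noteq> 0 \<and> (l, a1, a2) \<noteq> (-1, a1, - a1 - 1)
           \<and> G \<cong>\<^sub>L lie7 l a1 a2)
      \<or> (\<exists>a. (cond8a a \<or> cond8b a) \<and> G \<cong>\<^sub>L lie8 a)"
    unfolding listed_def .
next
  show "post_lie_occurs N (sl2 \<oplus>\<^sub>L sl2)" by (rule occurs_self[OF assms])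
  show "post_lie_occurs N (sl2 \<oplus>\<^sub>L r3 l)" if "l \<noteq> -1" for l by (rule occurs_sl2_r3[OF assms that])
  show "post_lie_occurs N (r3 l \<oplus>\<^sub>L r3 m)" if "(l, m) \<noteq> (-1, -1)" for l m
    by (rule occurs_r3_r3[OF assms that])
  show "post_lie_occurs N (r2 \<oplus>\<^sub>L r2 \<oplus>\<^sub>L r2)" by (rule occurs_r2_r2_r2[OF assms])
  show "post_lie_occurs N (lie5 a b)" if "a \<noteq> 0 \<and> b \<noteq> 0 \<and> b \<noteq> -1" for a b
    using occurs_lie5[OF assms] that by blast
  show "post_lie_occurs N (lie6 l a)" if "l \<noteq> 0 \<and> a \<noteq> 0 \<and> a \<noteq> -1" for l a
    using occurs_lie6[OF assms] that by blast
  show "post_lie_occurs N (lie7 l a1 a2)"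
    if "l \<noteq> 0 \<and> a1 \<noteq> 0 \<and> a2 \<noteq> 0 \<and> (l, a1, a2) \<noteq> (-1, a1, - a1 - 1)" for l a1 a2
    using occurs_lie7[OF assms] that by blast
  show "post_lie_occurs N (lie8 a)" if "cond8a a \<or> cond8b a" for a
    by (rule occurs_lie8[OF assms that])
qed

end
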